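(* Let $C=C(m,n;k,l;c,d)$ be a $C$-shaped supergrid graph (with $m\geq 2$, $n\geq 3$, $k,l,c\geq1$, $d=n-l-c\geq 1$, $a=m-k\geq 1$) and let $s=(s_x,s_y)$, $t=(t_x,t_y)$ be two distinct vertices of $C$, labeled so that $s_x\leq t_x$. Then $C$ contains a Hamiltonian path from $s$ to $t$ if and only if $(C,s,t)$ satisfies none of the following conditions: (F1) $s$ or $t$ is a cut vertex of $C$, or $\{s,t\}$ is a vertex cut of $C$; (F3) there is a vertex $w\in V(C)$ with $\deg(w)=1$, $w\neq s$ and $w\neq t$; (F7) $m=3$, $a=2$, and either ($c=1$ and $\{s,t\}=\{(1,1),(2,2)\}$ or $\{s,t\}=\{(1,2),(2,1)\}$) or ($d=1$ and $\{s,t\}=\{(1,n),(2,n-1)\}$ or $\{s,t\}=\{(1,n-1),(2,n)\}$); (F8) $n=3$, $k=c=d=1$, and one of: (1) $a\geq 2$, $s_x=t_x=m-1$ and $|s_y-t_y|=2$; (2) $a=2$, $s_x=1$, $t_x=2$ and $|s_y-t_y|=2$; (3) $a>2$, $s_x<m-1$ and $t=(m-1,2)$; (F9) $a=1$, and ($s_y,t_y\leq c$ or $s_y,t_y>c+l$).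
   Context: The supergrid graph $S^\infty$ has vertex set $\mathbb{Z}^2$, two distinct vertices $u,v$ being adjacent iff $|u_x-v_x|\leq 1$ and $|u_y-v_y|\leq 1$; a supergrid graph is a finite vertex-induced subgraph of $S^\infty$. For integers $m\geq 2$, $n\geq 3$, $k,l,c\geq 1$ with $d=n-l-c\geq 1$ and $a=m-k\geq 1$, $C(m,n;k,l;c,d)$ is the supergrid graph induced by $\{(x,y):1\leq x\leq m,\ 1\leq y\leq n\}\setminus\{(x,y): a+1\leq x\leq m,\ c+1\leq y\leq c+l\}$. A vertex $v$ is a cut vertex of a connected graph $G$ if $G-v$ is disconnected; a vertex set $V_1$ is a vertex cut if $G-V_1$ is disconnected. $\deg(w)$ is the number of neighbors of $w$. A Hamiltonian path from $s$ to $t$ is a simple path starting at $s$, ending at $t$, visiting every vertex exactly once. The paper assumes throughout that the two given vertices are named so that $s_x\leq t_x$. *)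

theory Defs
  imports Main
begin

type_synonym vtx = "int \<times> int"

definition sg_adj :: "vtx \<Rightarrow> vtx \<Rightarrow> bool" where
  "sg_adj u v \<longleftrightarrow> u \<noteq> v \<and> \<bar>fst u - fst v\<bar> \<le> 1 \<and> \<bar>snd u - snd v\<bar> \<le> 1"

definition C_graph :: "int \<Rightarrow> int \<Rightarrow> int \<Rightarrow> int \<Rightarrow> int \<Rightarrow> vtx set" where
  "C_graph m n k l c =
     {(x, y). 1 \<le> x \<and> x \<le> m \<and> 1 \<le> y \<and> y \<le> n}
     - {(x, y). m - k + 1 \<le> x \<and> x \<le> m \<and> c + 1 \<le> y \<and> y \<le> c + l}"

definition sg_walk :: "vtx set \<Rightarrow> vtx list \<Rightarrow> bool" where
  "sg_walk V ps \<longleftrightarrow> ps \<noteq> [] \<and> set ps \<subseteq> V \<and>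
     (\<forall>i. Suc i < length ps \<longrightarrow> sg_adj (ps ! i) (ps ! Suc i))"

definition sg_connected :: "vtx set \<Rightarrow> bool" where
  "sg_connected V \<longleftrightarrow>
     (\<forall>u\<in>V. \<forall>v\<in>V. \<exists>ps. sg_walk V ps \<and> hd ps = u \<and> last ps = v)"

text \<open>v is a cut vertex of the (connected) induced graph V.\<close>
definition cut_vertex :: "vtx set \<Rightarrow> vtx \<Rightarrow> bool" where
  "cut_vertex V v \<longleftrightarrow> v \<in> V \<and> \<not> sg_connected (V - {v})"

definition vertex_cut :: "vtx set \<Rightarrow> vtx set \<Rightarrow> bool" where
  "vertex_cut V W \<longleftrightarrow> W \<subseteq> V \<and> \<not> sg_connected (V - W)"

definition sg_deg :: "vtx set \<Rightarrow> vtx \<Rightarrow> nat" where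
  "sg_deg V w = card {u \<in> V. sg_adj w u}"

definition ham_path :: "vtx set \<Rightarrow> vtx \<Rightarrow> vtx \<Rightarrow> vtx list \<Rightarrow> bool" where
  "ham_path V s t ps \<longleftrightarrow> sg_walk V ps \<and> distinct ps \<and> set ps = V \<and>
     hd ps = s \<and> last ps = t"

end

theory Submission
  imports Defs
begin

text \<open>
  Sufficiency. A Hamiltonian path of a union of two disjoint shapes is obtained either by joining two
  paths end to end, or by replacing an edge \<open>u v\<close> of the first path by \<open>u, u', \<dots>, v', v\<close>, where
  \<open>u', \<dots>, v'\<close> is a path of the second shape. Edges for the second construction come for free at a
  convex corner \<open>w\<close>: its neighbourhood is so small that every Hamiltonian path with \<open>w\<close> and the next
  boundary vertex \<open>r\<close> in its interior can be rerouted through the edge \<open>w r\<close>. For rectangles this gives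
  an induction in which two columns are stripped off, or the rectangle is cut between the two ends, down to
  three columns and three rows. The rectangle results also settle when the edge at a corner can be
  prescribed if one end lies on it. The C-shape is then cut along the boundary rows of the hole, and each arm
  that contains no end is inserted into an edge of a path of the remaining shape.

  Necessity. A cut (F1), or a vertex of degree one that is not an end (F3), excludes a Hamiltonian path.
  In (F7) and (F8), a vertex with two neighbours one of which is an end forces the beginning or the end
  of the path, which then misses a vertex. In (F9) the path would have to pass twice through a vertex of
  the single narrow column.
\<close>

subsection \<open>Hamiltonian paths with prescribed ends\<close>

text \<open>A strip of width one can only be traversed from end to end. Columns are therefore
  stripped in pairs, since two columns admit a path between adjacent vertices, and arms of one row
  or one column cause nearly all special cases. A one-row arm of at least two cells has a tip of
  degree one, so an end must sit there. A one-column arm goes into the edge of column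
  \<open>a\<close> beside it, but only up to three rows, since its far cell must still touch that
  edge; longer ones are shortened by setting aside full rows. Rerouting at a corner of the narrow
  part needs the column outside it to be empty for three rows. If the whole shape has only three
  rows, the opposite arm is too close for this, so that shape is built separately and has exceptions
  of its own.\<close>

lemma sg_adj_sym: "sg_adj u v \<longleftrightarrow> sg_adj v u"
  by (auto simp: sg_adj_def)

lemma sg_adj_pair [simp]:
  "sg_adj (x, y) (x', y') \<longleftrightarrow> (x, y) \<noteq> (x', y') \<and> \<bar>x - x'\<bar> \<le> 1 \<and> \<bar>y - y'\<bar> \<le> 1"
  by (simp add: sg_adj_def)

lemma ham_path_iff:
  "ham_path V s t ps \<longleftrightarrow>
     ps \<noteq> [] \<and> successively sg_adj ps \<and> distinct ps \<and> set ps = V \<and> hd ps = s \<and> last ps = t"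
  by (auto simp: ham_path_def sg_walk_def successively_conv_nth)

definition hp :: "vtx set \<Rightarrow> vtx \<Rightarrow> vtx \<Rightarrow> bool" where
  "hp V s t \<longleftrightarrow> (\<exists>ps. ham_path V s t ps)"

text \<open>The edge carries no direction, so the predicate survives reversal of the path.\<close>

definition hpe :: "vtx set \<Rightarrow> vtx \<Rightarrow> vtx \<Rightarrow> vtx \<Rightarrow> vtx \<Rightarrow> bool" where
  "hpe V s t u v \<longleftrightarrow>
     (\<exists>as bs. ham_path V s t (as @ u # v # bs) \<or> ham_path V s t (as @ v # u # bs))"

lemma hpeI: "ham_path V s t (as @ u # v # bs) \<Longrightarrow> hpe V s t u v"
  unfolding hpe_def by blast

lemma successively_sg_adj_rev: "successively sg_adj (rev ps) \<longleftrightarrow> successively sg_adj ps"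
proof -
  have "(\<lambda>x y. sg_adj y x) = sg_adj"
    by (intro ext) (rule sg_adj_sym)
  then show ?thesis by (simp only: successively_rev)
qed

lemma ham_path_rev: "ham_path V s t ps \<Longrightarrow> ham_path V t s (rev ps)"
  by (auto simp: ham_path_iff successively_sg_adj_rev hd_rev last_rev simp del: successively_rev)

lemma hp_sym: "hp V s t \<Longrightarrow> hp V t s"
  unfolding hp_def using ham_path_rev by blast

lemma hpe_sym: "hpe V s t u v \<Longrightarrow> hpe V t s u v"
proof -
  assume "hpe V s t u v"
  then consider as bs where "ham_path V s t (as @ u # v # bs)"
    | as bs where "ham_path V s t (as @ v # u # bs)"
    unfolding hpe_def by blast
  then show ?thesis
  proof cases
    case 1
    from ham_path_rev[OF this] have "ham_path V t s (rev bs @ v # u # rev as)" by simp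
    then show ?thesis unfolding hpe_def by blast
  next
    case 2
    from ham_path_rev[OF this] have "ham_path V t s (rev bs @ u # v # rev as)" by simp
    then show ?thesis unfolding hpe_def by blast
  qed
qed

lemma hpe_swap: "hpe V s t u v \<Longrightarrow> hpe V s t v u"
  unfolding hpe_def by blast

lemma hp_endpoints: "hp V s t \<Longrightarrow> s \<in> V \<and> t \<in> V"
  unfolding hp_def ham_path_iff by auto

lemma hp_singleton: "hp {v} v v"
  unfolding hp_def ham_path_iff by (intro exI[of _ "[v]"]) auto

lemma hp_append:
  assumes "hp A s p" and "hp B q t" and "A \<inter> B = {}" and "sg_adj p q" and "V = A \<union> B"
  shows "hp V s t"
proof -
  from assms obtain xs ys where "ham_path A s p xs" "ham_path B q t ys"
    unfolding hp_def by blast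
  then have "ham_path V s t (xs @ ys)"
    using assms(3-5) by (auto simp: ham_path_iff successively_append_iff)
  then show ?thesis unfolding hp_def by blast
qed

lemma hp_append3:
  assumes "hp A s p" and "hp B q r" and "hp C u t" and "sg_adj p q" and "sg_adj r u"
    and "A \<inter> B = {}" and "A \<inter> C = {}" and "B \<inter> C = {}" and "V = A \<union> B \<union> C"
  shows "hp V s t"
  by (rule hp_append[OF hp_append[OF assms(1,2,6,4) refl] assms(3) _ assms(5,9)]) (use assms(7,8) in blast)

lemma hp_append4:
  assumes "hp A s p" and "hp B q r" and "hp C u v" and "hp D w t"
    and "sg_adj p q" and "sg_adj r u" and "sg_adj v w"
    and "A \<inter> B = {}" and "A \<inter> C = {}" and "B \<inter> C = {}" and "A \<inter> D = {}" and "B \<inter> D = {}" and "C \<inter> D = {}"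
    and "V = A \<union> B \<union> C \<union> D"
  shows "hp V s t"
  by (rule hp_append[OF hp_append3[OF assms(1-3,5,6,8-10) refl] assms(4) _ assms(7,14)])
     (use assms(11-13) in blast)

lemma hpe_insert:
  assumes "hpe A s t u v" and "hp B u' v'" and "A \<inter> B = {}"
    and "sg_adj u u'" and "sg_adj v v'" and "V = A \<union> B"
  shows "hp V s t"
proof -
  from assms(2) obtain ys where ys: "ham_path B u' v' ys" unfolding hp_def by blast
  note ysr = ham_path_rev[OF ys]
  have vv: "sg_adj v' v" "sg_adj u' u" using assms by (auto simp: sg_adj_sym)
  from assms(1) consider as bs where "ham_path A s t (as @ u # v # bs)"
    | as bs where "ham_path A s t (as @ v # u # bs)"
    unfolding hpe_def by blast
  then show ?thesis
  proof cases
    case 1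
    then have "ham_path V s t (as @ u # ys @ v # bs)"
      using assms(3-6) vv ys
      by (auto simp: ham_path_iff successively_append_iff successively_Cons hd_append split: if_splits)
    then show ?thesis unfolding hp_def by blast
  next
    case 2
    \<comment> \<open>The edge is traversed from \<open>v\<close> to \<open>u\<close>, so the
      inserted path is reversed.\<close>
    then have "ham_path V s t (as @ v # rev ys @ u # bs)"
      using assms(3-6) vv ysr
      by (auto simp: ham_path_iff successively_append_iff successively_Cons hd_append split: if_splits)
    then show ?thesis unfolding hp_def by blast
  qed
qed

section \<open>Transport along reflections and transposition\<close>

lemma ham_path_map:
  assumes "ham_path V s t ps" and gf: "\<And>z. g (f z) = z" and fg: "\<And>z. f (g z) = z"
    and adj: "\<And>u v. sg_adj (f u) (f v) \<longleftrightarrow> sg_adj u v"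
    and V': "V' = {z. g z \<in> V}"
  shows "ham_path V' (f s) (f t) (map f ps)"
proof -
  have inj: "inj f" by (rule inj_on_inverseI[of _ g]) (simp add: gf)
  have "f ` V = V'" unfolding V' using fg gf by (auto simp: image_iff) (metis fg)
  moreover have "inj_on f (set ps)" using inj by (rule inj_on_subset) simp
  ultimately show ?thesis
    using assms(1) adj
    by (auto simp: ham_path_iff successively_map distinct_map hd_map last_map)
qed

lemma hp_map:
  assumes "hp V s t" and "\<And>z. g (f z) = z" and "\<And>z. f (g z) = z"
    and "\<And>u v. sg_adj (f u) (f v) \<longleftrightarrow> sg_adj u v" and "V' = {z. g z \<in> V}"
  shows "hp V' (f s) (f t)"
  using assms ham_path_map unfolding hp_def by metis

lemma hpe_map:
  assumes "hpe V s t u v" and "\<And>z. g (f z) = z" and "\<And>z. f (g z) = z"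
    and "\<And>u v. sg_adj (f u) (f v) \<longleftrightarrow> sg_adj u v" and "V' = {z. g z \<in> V}"
  shows "hpe V' (f s) (f t) (f u) (f v)"
proof -
  from assms(1) consider as bs where "ham_path V s t (as @ u # v # bs)"
    | as bs where "ham_path V s t (as @ v # u # bs)"
    unfolding hpe_def by blast
  then show ?thesis
  proof cases
    case 1
    from ham_path_map[OF this assms(2-5)]
    have "ham_path V' (f s) (f t) (map f as @ f u # f v # map f bs)" by simp
    then show ?thesis unfolding hpe_def by blast
  next
    case 2
    from ham_path_map[OF this assms(2-5)]
    have "ham_path V' (f s) (f t) (map f as @ f v # f u # map f bs)" by simp
    then show ?thesis unfolding hpe_def by blast
  qed
qed

text \<open>The parameter is the sum of a coordinate and its mirror image: \<open>x1 + x2\<close>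
  maps the interval from \<open>x1\<close> to \<open>x2\<close> onto itself.\<close>

definition flipx :: "int \<Rightarrow> vtx \<Rightarrow> vtx" where "flipx p = (\<lambda>(x, y). (p - x, y))"
definition flipy :: "int \<Rightarrow> vtx \<Rightarrow> vtx" where "flipy p = (\<lambda>(x, y). (x, p - y))"

lemma flip_simps [simp]:
  "flipx p (x, y) = (p - x, y)" "flipy p (x, y) = (x, p - y)"
  by (simp_all add: flipx_def flipy_def)

text \<open>The target is a preimage rather than an image: its membership unfolds to coordinates, so
  concrete instances reduce to linear arithmetic.\<close>

lemma hp_flipx: "hp V (flipx p s) (flipx p t) \<Longrightarrow> V' = {z. flipx p z \<in> V} \<Longrightarrow> hp V' s t"
  using hp_map[of V "flipx p s" "flipx p t" "flipx p" "flipx p" V']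
  by (auto simp: flipx_def sg_adj_def split_beta abs_minus_commute)

lemma hp_flipy: "hp V (flipy p s) (flipy p t) \<Longrightarrow> V' = {z. flipy p z \<in> V} \<Longrightarrow> hp V' s t"
  using hp_map[of V "flipy p s" "flipy p t" "flipy p" "flipy p" V']
  by (auto simp: flipy_def sg_adj_def split_beta abs_minus_commute)

lemma hp_transpose: "hp V (prod.swap s) (prod.swap t) \<Longrightarrow> V' = {z. prod.swap z \<in> V} \<Longrightarrow> hp V' s t"
  using hp_map[of V "prod.swap s" "prod.swap t" prod.swap prod.swap V']
  by (auto simp: sg_adj_def split_beta prod_eq_iff)

lemma hpe_flipx:
  "hpe V (flipx p s) (flipx p t) (flipx p u) (flipx p v) \<Longrightarrow> V' = {z. flipx p z \<in> V} \<Longrightarrow> hpe V' s t u v"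
  using hpe_map[of V "flipx p s" "flipx p t" "flipx p u" "flipx p v" "flipx p" "flipx p" V']
  by (auto simp: flipx_def sg_adj_def split_beta abs_minus_commute)

lemma hpe_flipy:
  "hpe V (flipy p s) (flipy p t) (flipy p u) (flipy p v) \<Longrightarrow> V' = {z. flipy p z \<in> V} \<Longrightarrow> hpe V' s t u v"
  using hpe_map[of V "flipy p s" "flipy p t" "flipy p u" "flipy p v" "flipy p" "flipy p" V']
  by (auto simp: flipy_def sg_adj_def split_beta abs_minus_commute)

lemma hpe_transpose:
  "hpe V (prod.swap s) (prod.swap t) (prod.swap u) (prod.swap v) \<Longrightarrow> V' = {z. prod.swap z \<in> V} \<Longrightarrow>
     hpe V' s t u v"
  using hpe_map[of V "prod.swap s" "prod.swap t" "prod.swap u" "prod.swap v" prod.swap prod.swap V']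
  by (auto simp: sg_adj_def split_beta prod_eq_iff)

text \<open>
  If the path passes the corner \<open>w\<close> by \<open>p, w, q\<close>, then \<open>r\<close> is moved next to \<open>w\<close>: either \<open>r\<close> already
  follows \<open>p\<close> or \<open>q\<close>, and two vertices are exchanged, or \<open>r\<close> is cut out of its place, where its two
  path neighbours are adjacent to each other.
\<close>

lemma corner_edge:
  assumes hp: "hp V s t" and w: "w \<in> V" "w \<noteq> s" "w \<noteq> t" and r: "r \<in> V" "r \<noteq> s" "r \<noteq> t"
    and nw: "\<And>z. z \<in> V \<Longrightarrow> sg_adj w z \<Longrightarrow> z \<in> {p, q, r}"
    and adj: "sg_adj w r" "sg_adj p q" "sg_adj p r" "sg_adj q r"
    and Y: "\<And>y y'. \<lbrakk>y \<in> V; y' \<in> V; sg_adj r y; sg_adj r y'; y \<notin> {w, p, q}; y' \<notin> {w, p, q}; y \<noteq> y'\<rbrakk>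
              \<Longrightarrow> sg_adj y y'"
  shows "hpe V s t w r"
proof -
  \<comment> \<open>The case in which \<open>r\<close> lies after \<open>w\<close>. The other one
    follows by reversing the path, hence the generalised ends.\<close>
  have key: "hpe V s t w r"
    if P: "ham_path V s t (as @ p' # w # q' # bs)" and pq: "{p', q'} = {p, q}" and rb: "r \<in> set bs"
      and r: "r \<noteq> s" "r \<noteq> t" and Y: "\<And>y y'. \<lbrakk>y \<in> V; y' \<in> V; sg_adj r y; sg_adj r y'; y \<notin> {w, p, q}; y' \<notin> {w, p, q}; y \<noteq> y'\<rbrakk>
              \<Longrightarrow> sg_adj y y'"
    for s t as p' q' bs
  proof -
    have adj': "sg_adj p' q'" "sg_adj p' r" "sg_adj q' r" "sg_adj r q'" "sg_adj w r" "sg_adj r w"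
      using pq adj by (auto simp: doubleton_eq_iff sg_adj_sym)
    from rb obtain cs ds where bs: "bs = cs @ r # ds" by (auto simp: in_set_conv_decomp)
    have ds: "ds \<noteq> []" using P r(2) by (auto simp: bs ham_path_iff)
    show ?thesis
    proof (cases "cs = []")
      \<comment> \<open>The segment \<open>p', w, q', r\<close> becomes
        \<open>p', q', w, r\<close>.\<close>
      case True
      have "sg_adj q' w" using P by (auto simp: ham_path_iff successively_append_iff successively_Cons sg_adj_sym)
      then have "ham_path V s t ((as @ [p', q']) @ w # r # ds)"
        using P adj' ds unfolding True bs
        by (auto simp: ham_path_iff successively_append_iff successively_Cons hd_append split: if_splits)
      then show ?thesis by (rule hpeI)
    next
      \<comment> \<open>\<open>r\<close> moves between \<open>w\<close> and \<open>q'\<close>; the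
        gap it leaves between \<open>last cs\<close> and \<open>hd ds\<close> is closed by
        \<open>Y\<close>.\<close>
      case False
      have m: "last cs \<in> set cs" "hd ds \<in> set ds" using False ds by auto
      have D: "distinct (as @ p' # w # q' # cs @ r # ds)" "set (as @ p' # w # q' # cs @ r # ds) = V"
        and S: "successively sg_adj (as @ p' # w # q' # cs @ r # ds)"
        using P bs by (auto simp: ham_path_iff)
      have "sg_adj (last cs) r" "sg_adj r (hd ds)"
        using S False ds by (auto simp: successively_append_iff successively_Cons)
      moreover have "last cs \<notin> {w, p, q}" "hd ds \<notin> {w, p, q}"
        using D(1) m pq by (auto simp: doubleton_eq_iff)
      moreover have "last cs \<noteq> hd ds" using D(1) m by auto
      moreover have "last cs \<in> V" "hd ds \<in> V" using D(2) m by auto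
      ultimately have "sg_adj (last cs) (hd ds)" using Y by (auto simp: sg_adj_sym)
      then have "ham_path V s t ((as @ [p']) @ w # r # q' # cs @ ds)"
        using P adj' ds False unfolding bs
        by (auto simp: ham_path_iff successively_append_iff successively_Cons hd_append split: if_splits)
      then show ?thesis by (rule hpeI)
    qed
  qed
  from hp obtain ps where ps: "ham_path V s t ps" unfolding hp_def by blast
  then have "w \<in> set ps" using w by (auto simp: ham_path_iff)
  then obtain xs ys where xy: "ps = xs @ w # ys" by (auto simp: in_set_conv_decomp)
  have "xs \<noteq> []" "ys \<noteq> []" using ps w by (auto simp: ham_path_iff xy)
  then obtain as p' q' bs where pq: "ps = as @ p' # w # q' # bs"
    unfolding xy by (metis append.assoc append_Cons append_Nil append_butlast_last_id list.exhaust)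
  have 1: "distinct (as @ p' # w # q' # bs)" "set (as @ p' # w # q' # bs) = V" 
      "sg_adj p' w" "sg_adj w q'"
    using ps by (auto simp: ham_path_iff pq successively_append_iff successively_Cons)
  have m: "p' \<in> {p, q, r}" "q' \<in> {p, q, r}" "p' \<noteq> q'"
    using nw[of p'] nw[of q'] 1 by (auto simp: sg_adj_sym)
  show ?thesis
  proof (cases "p' = r \<or> q' = r")
    case True
    then show ?thesis
    proof
      assume "p' = r"
      then show ?thesis using ps unfolding pq hpe_def by blast
    next
      assume "q' = r"
      then have "ham_path V s t ((as @ [p']) @ w # r # bs)" using ps pq by simp
      then show ?thesis by (rule hpeI)
    qed
  next
    case False
    then have pq2: "{p', q'} = {p, q}" using m by auto
    have "r \<in> set as \<or> r \<in> set bs" using r(1) 1(2) False adj(1) by (auto simp: sg_adj_def)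
    then show ?thesis
    proof
      assume "r \<in> set bs"
      then show ?thesis using key[OF ps[unfolded pq] pq2 _ r(2,3)] Y by blast
    next
      assume a: "r \<in> set as"
      have P: "ham_path V t s (rev bs @ q' # w # p' # rev as)"
        using ham_path_rev[OF ps] by (simp add: pq)
      have "r \<in> set (rev as)" "{q', p'} = {p, q}" using a pq2 by auto
      from key[OF P this(2,1) r(3,2)] Y have "hpe V t s w r" by blast
      then have "hpe V t s w r" .
      then show ?thesis by (rule hpe_sym)
    qed
  qed
qed

subsection \<open>Rectangles\<close>

text \<open>\<open>\<sigma>\<close> points from the boundary into the shape, \<open>\<tau>\<close>
  from the corner along the boundary. The excluded cells leave the corner three neighbours, and
  leave the next boundary vertex only two others, in row \<open>y + 2 * \<tau>\<close>, which are
  adjacent to each other. Only cells near the corner are constrained, so the shape may be non-convex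
  elsewhere.\<close>

lemma corner_vertical:
  assumes "hp V s t" and "\<sigma> \<in> {1, -1}" and "\<tau> \<in> {1, -1}"
    and "(x, y) \<in> V" "(x, y) \<noteq> s" "(x, y) \<noteq> t"
    and "(x, y + \<tau>) \<in> V" "(x, y + \<tau>) \<noteq> s" "(x, y + \<tau>) \<noteq> t"
    and "(x - \<sigma>, y - \<tau>) \<notin> V" "(x - \<sigma>, y) \<notin> V" "(x - \<sigma>, y + \<tau>) \<notin> V" "(x - \<sigma>, y + 2 * \<tau>) \<notin> V"
    and "(x, y - \<tau>) \<notin> V" "(x + \<sigma>, y - \<tau>) \<notin> V"
  shows "hpe V s t (x, y) (x, y + \<tau>)"
proof (rule corner_edge[OF assms(1,4-9), where p = "(x + \<sigma>, y)" and q = "(x + \<sigma>, y + \<tau>)"])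
  have near: "i = u - \<rho> \<or> i = u \<or> i = u + \<rho>" if "\<bar>u - i\<bar> \<le> 1" "\<rho> \<in> {1, -1}" for i u \<rho> :: int
    using that by auto
  {
    fix z assume z: "z \<in> V" "sg_adj (x, y) z"
    obtain i j where ij: "z = (i, j)" by (cases z)
    then have "i = x - \<sigma> \<or> i = x \<or> i = x + \<sigma>" "j = y - \<tau> \<or> j = y \<or> j = y + \<tau>" "(i, j) \<noteq> (x, y)"
      using z(2) assms(2,3) by (auto intro!: near)
    then show "z \<in> {(x + \<sigma>, y), (x + \<sigma>, y + \<tau>), (x, y + \<tau>)}"
      using z(1) assms(10-15) ij by blast
  }
  have *: "z = (x, y + 2 * \<tau>) \<or> z = (x + \<sigma>, y + 2 * \<tau>)"
    if z: "z \<in> V" "sg_adj (x, y + \<tau>) z" "z \<notin> {(x, y), (x + \<sigma>, y), (x + \<sigma>, y + \<tau>)}" for z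
  proof -
    obtain i j where ij: "z = (i, j)" by (cases z)
    then have a: "\<bar>x - i\<bar> \<le> 1" "\<bar>y + \<tau> - j\<bar> \<le> 1" "(i, j) \<noteq> (x, y + \<tau>)" using z(2) by auto
    have "i = x - \<sigma> \<or> i = x \<or> i = x + \<sigma>" "j = y \<or> j = y + \<tau> \<or> j = y + 2 * \<tau>"
      using near[OF a(1) assms(2)] near[OF a(2) assms(3)] by auto
    with a(3) show ?thesis using z assms(10-15) ij by blast
  qed
  fix z z' assume "z \<in> V" "z' \<in> V" "sg_adj (x, y + \<tau>) z" "sg_adj (x, y + \<tau>) z'"
    "z \<notin> {(x, y), (x + \<sigma>, y), (x + \<sigma>, y + \<tau>)}" "z' \<notin> {(x, y), (x + \<sigma>, y), (x + \<sigma>, y + \<tau>)}" "z \<noteq> z'"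
  then show "sg_adj z z'" using *[of z] *[of z'] assms(2) by auto
qed (use assms(2,3) in auto)

lemma corner_horizontal:
  assumes "hp V s t" and "\<sigma> \<in> {1, -1}" and "\<tau> \<in> {1, -1}"
    and "(x, y) \<in> V" "(x, y) \<noteq> s" "(x, y) \<noteq> t"
    and "(x + \<sigma>, y) \<in> V" "(x + \<sigma>, y) \<noteq> s" "(x + \<sigma>, y) \<noteq> t"
    and "(x - \<sigma>, y - \<tau>) \<notin> V" "(x, y - \<tau>) \<notin> V" "(x + \<sigma>, y - \<tau>) \<notin> V" "(x + 2 * \<sigma>, y - \<tau>) \<notin> V"
    and "(x - \<sigma>, y) \<notin> V" "(x - \<sigma>, y + \<tau>) \<notin> V"
  shows "hpe V s t (x, y) (x + \<sigma>, y)"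
proof (rule hpe_transpose)
  let ?W = "{z. prod.swap z \<in> V}"
  have "hpe ?W (prod.swap s) (prod.swap t) (y, x) (y, x + \<sigma>)"
  proof (rule corner_vertical[where \<sigma> = \<tau>])
    show "hp ?W (prod.swap s) (prod.swap t)"
      by (rule hp_transpose[of V]) (use assms(1) in simp_all)
  qed (use assms in \<open>auto simp: prod_eq_iff\<close>)
  then show "hpe ?W (prod.swap s) (prod.swap t) (prod.swap (x, y)) (prod.swap (x + \<sigma>, y))" by simp
qed auto

definition rect :: "int \<Rightarrow> int \<Rightarrow> int \<Rightarrow> int \<Rightarrow> vtx set" where
  "rect x1 x2 y1 y2 = {(x, y). x1 \<le> x \<and> x \<le> x2 \<and> y1 \<le> y \<and> y \<le> y2}"

lemma mem_rect [simp]: "(x, y) \<in> rect x1 x2 y1 y2 \<longleftrightarrow> x1 \<le> x \<and> x \<le> x2 \<and> y1 \<le> y \<and> y \<le> y2"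
  by (simp add: rect_def)

text \<open>Two ends that do not separate the rectangle: the extremes of a single line, and in a
  double line no opposite pair away from the extremes. Equal ends are allowed for a single cell
  only, so that cells can serve as pieces.\<close>

definition rgood :: "int \<Rightarrow> int \<Rightarrow> int \<Rightarrow> int \<Rightarrow> int \<Rightarrow> int \<Rightarrow> int \<Rightarrow> int \<Rightarrow> bool" where
  "rgood x1 x2 y1 y2 a b c d \<longleftrightarrow>
     x1 \<le> a \<and> a \<le> x2 \<and> y1 \<le> b \<and> b \<le> y2 \<and> x1 \<le> c \<and> c \<le> x2 \<and> y1 \<le> d \<and> d \<le> y2 \<and>
     (a = c \<and> b = d \<longrightarrow> x1 = x2 \<and> y1 = y2) \<and>
     (x1 = x2 \<longrightarrow> b = y1 \<and> d = y2 \<or> b = y2 \<and> d = y1) \<and>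
     (y1 = y2 \<longrightarrow> a = x1 \<and> c = x2 \<or> a = x2 \<and> c = x1) \<and>
     (x2 = x1 + 1 \<and> b = d \<longrightarrow> b = y1 \<or> b = y2) \<and>
     (y2 = y1 + 1 \<and> a = c \<longrightarrow> a = x1 \<or> a = x2)"

lemma rgood_bounds:
  assumes "rgood x1 x2 y1 y2 a b c d"
  shows "x1 \<le> a" "a \<le> x2" "y1 \<le> b" "b \<le> y2" "x1 \<le> c" "c \<le> x2" "y1 \<le> d" "d \<le> y2"
  using assms unfolding rgood_def by blast+

abbreviation rhp :: "int \<Rightarrow> int \<Rightarrow> int \<Rightarrow> int \<Rightarrow> int \<Rightarrow> int \<Rightarrow> int \<Rightarrow> int \<Rightarrow> bool" where
  "rhp x1 x2 y1 y2 a b c d \<equiv> hp (rect x1 x2 y1 y2) (a, b) (c, d)"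

lemma rhp_sym: "rhp x1 x2 y1 y2 c d a b \<Longrightarrow> rhp x1 x2 y1 y2 a b c d"
  by (rule hp_sym)

lemma rhp_flipx: "rhp x1 x2 y1 y2 (x1 + x2 - a) b (x1 + x2 - c) d \<Longrightarrow> rhp x1 x2 y1 y2 a b c d"
  by (rule hp_flipx[where p = "x1 + x2"]) auto

lemma rhp_flipy: "rhp x1 x2 y1 y2 a (y1 + y2 - b) c (y1 + y2 - d) \<Longrightarrow> rhp x1 x2 y1 y2 a b c d"
  by (rule hp_flipy[where p = "y1 + y2"]) auto

lemma rhp_transpose: "rhp y1 y2 x1 x2 b a d c \<Longrightarrow> rhp x1 x2 y1 y2 a b c d"
  by (rule hp_transpose) auto

lemma rgood_sym: "rgood x1 x2 y1 y2 c d a b \<longleftrightarrow> rgood x1 x2 y1 y2 a b c d"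
  unfolding rgood_def by auto

lemma rgood_flipx: "rgood x1 x2 y1 y2 (x1 + x2 - a) b (x1 + x2 - c) d \<longleftrightarrow> rgood x1 x2 y1 y2 a b c d"
proof -
  have e: "x1 \<le> x1 + x2 - z \<longleftrightarrow> z \<le> x2" "x1 + x2 - z \<le> x2 \<longleftrightarrow> x1 \<le> z" "x1 + x2 - a = x1 + x2 - c \<longleftrightarrow> a = c"
    "x1 + x2 - z = x1 \<longleftrightarrow> z = x2" "x1 + x2 - z = x2 \<longleftrightarrow> z = x1" for z
    by auto
  show ?thesis unfolding rgood_def e by blast
qed

lemma rgood_transpose: "rgood y1 y2 x1 x2 b a d c \<longleftrightarrow> rgood x1 x2 y1 y2 a b c d"
  unfolding rgood_def by auto

lemma rect_cut_v:
  assumes "rhp x1 xm y1 y2 a b xm y" and "rhp (xm + 1) x2 y1 y2 (xm + 1) y' c d" and "\<bar>y - y'\<bar> \<le> 1"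
  shows "rhp x1 x2 y1 y2 a b c d"
proof (rule hp_append[OF assms(1,2)])
  have "x1 \<le> xm" "xm + 1 \<le> x2" using assms(1,2)[THEN hp_endpoints] by auto
  then show "rect x1 x2 y1 y2 = rect x1 xm y1 y2 \<union> rect (xm + 1) x2 y1 y2" by auto
qed (use assms(3) in auto)

lemma rect_cut_h:
  assumes "rhp x1 x2 y1 ym a b x ym" and "rhp x1 x2 (ym + 1) y2 x' (ym + 1) c d" and "\<bar>x - x'\<bar> \<le> 1"
  shows "rhp x1 x2 y1 y2 a b c d"
  by (rule rhp_transpose, rule rect_cut_v[OF assms(1,2)[THEN rhp_transpose] assms(3)])

lemma rhp_column: "y1 \<le> y2 \<Longrightarrow> rhp x x y1 y2 x y1 x y2"
proof (induction y2 rule: int_ge_induct)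
  case base
  have "rect x x y1 y1 = {(x, y1)}" by auto
  then show ?case by (simp add: hp_singleton)
next
  case (step y2)
  have "rect x x (y2 + 1) (y2 + 1) = {(x, y2 + 1)}" by auto
  then have "rhp x x (y2 + 1) (y2 + 1) x (y2 + 1) x (y2 + 1)" by (simp add: hp_singleton)
  then show ?case by (rule rect_cut_h[OF step.IH]) simp
qed

lemma rhp_thin:
  assumes "rgood x1 x2 y1 y2 a b c d" and "x1 = x2 \<or> y1 = y2"
  shows "rhp x1 x2 y1 y2 a b c d"
proof -
  have col: "rhp x1 x2 y1 y2 a b c d" if "rgood x1 x2 y1 y2 a b c d" "x1 = x2" for x1 x2 y1 y2 a b c d
  proof -
    note B = rgood_bounds[OF that(1)]
    have ac: "a = x1" "c = x1" "y1 \<le> y2" using B that(2) by linarith+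
    have "b = y1 \<and> d = y2 \<or> b = y2 \<and> d = y1" using that unfolding rgood_def by blast
    then show ?thesis
      using ac rhp_column[of y1 y2 x1] rhp_sym[OF rhp_column[of y1 y2 x1]] unfolding that(2)[symmetric] by blast
  qed
  show ?thesis
  proof (cases "x1 = x2")
    case False
    then show ?thesis
      using rhp_transpose[OF col[of y1 y2 x1 x2 b a d c]] assms by (simp add: rgood_transpose)
  qed (use assms col in blast)
qed

text \<open>Two columns are covered row by row, except that equal rows force a run down one column and up the other.\<close>

lemma rhp_two_columns:
  assumes "rgood x (x + 1) y1 y2 a b c d"
  shows "rhp x (x + 1) y1 y2 a b c d"
proof -
  have U: "rhp x (x + 1) y1 y2 a y2 c y2" if "y1 \<le> y2" "{a, c} = {x, x + 1}" for y1 y2 a c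
  proof -
    have 1: "rhp x (x + 1) y1 y2 x y2 (x + 1) y2"
      by (rule rect_cut_v[where y = y1 and y' = y1])
         (use that rhp_column[of y1 y2] in \<open>auto intro: rhp_sym\<close>)
    then show ?thesis using that(2) rhp_sym[OF 1] by (auto simp: doubleton_eq_iff)
  qed
  from assms show ?thesis
  proof (induction "nat (y2 - y1)" arbitrary: y1 y2 a b c d rule: less_induct)
    case less
    note IH = less.hyps and g = less.prems
    have main: "rhp x (x + 1) y1 y2 a b c d"
      if g: "rgood x (x + 1) y1 y2 a b c d" and bd: "b < d"  for a b c d
    proof (rule rect_cut_h[where ym = b])
      have c: "(a = x \<or> a = x + 1) \<and> (c = x \<or> c = x + 1)" using g by (auto simp: rgood_def)
      \<comment> \<open>\<open>2 * x + 1 - a\<close> is the column other than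
        \<open>a\<close>.\<close>
      show "rhp x (x + 1) y1 b a b (2 * x + 1 - a) b"
        by (rule U) (use g c in \<open>auto simp: rgood_def doubleton_eq_iff\<close>)
      \<comment> \<open>Entering in the column other than \<open>c\<close> keeps the ends apart if
        \<open>d = b + 1\<close>; their common row is then the first one of the piece.\<close>
      show "rhp x (x + 1) (b + 1) y2 (2 * x + 1 - c) (b + 1) c d"
        by (rule IH) (use g bd c in \<open>auto simp: rgood_def\<close>)
    qed (use g in \<open>auto simp: rgood_def\<close>)
    consider "b < d" | "d < b" | "b = d" by linarith
    then show ?case
    proof cases
      case 1
      then show ?thesis using main g by blast
    next
      case 2
      then show ?thesis using rhp_sym[OF main[of c d a b]] g by (simp add: rgood_sym)
    next
      case 3
      then have ac: "{a, c} = {x, x + 1}" "b = y1 \<or> b = y2" "y1 \<le> y2" using g by (auto simp: rgood_def)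
      then show ?thesis
        using U[of y1 y2 a c] rhp_flipy[of x "x + 1" y1 y2 a b c d] 3 by auto
    qed
  qed
qed

text \<open>The induction hypothesis as a predicate, so that each case of the induction can be a
  lemma of its own. The measure, width plus height, is invariant under transposition.\<close>

definition rih :: "int \<Rightarrow> bool" where
  "rih N \<longleftrightarrow> (\<forall>x1 x2 y1 y2 a b c d. x2 - x1 + (y2 - y1) < N \<longrightarrow> rgood x1 x2 y1 y2 a b c d \<longrightarrow>
      rhp x1 x2 y1 y2 a b c d)"

lemma rihD: "rih N \<Longrightarrow> x2 - x1 + (y2 - y1) < N \<Longrightarrow> rgood x1 x2 y1 y2 a b c d \<Longrightarrow> rhp x1 x2 y1 y2 a b c d"
  unfolding rih_def by blast

context
  fixes N :: int
  assumes ih: "rih N"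
begin

text \<open>If each half keeps at least two columns and the cut is crossed in rows other than those
  of the ends, both halves are admissible, whatever columns the ends lie in.\<close>

lemma split_wide:
  assumes g: "rgood x1 x2 y1 y2 a b c d" and N: "N = x2 - x1 + (y2 - y1)" and h: "y1 < y2"
    and xm: "x1 < xm" "xm + 1 < x2" "a \<le> xm" "xm < c"
  shows "rhp x1 x2 y1 y2 a b c d"
proof -
  obtain y y' where y: "y \<noteq> b" "y' \<noteq> d" "\<bar>y - y'\<bar> \<le> 1" "y1 \<le> y" "y \<le> y2" "y1 \<le> y'" "y' \<le> y2"
  proof (cases "b = d")
    case True
    then show ?thesis using that[of y1 y1] that[of y2 y2] h by (cases "b = y1") auto
  next
    case False
    show ?thesis
    proof (cases "y2 = y1 + 1")
      case True
      \<comment> \<open>With two rows, each half is left in the only row free of its own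
        end.\<close>
      then show ?thesis using that[of d b] False g by (auto simp: rgood_def)
    next
      case F: False
      have "\<exists>y \<in> {y1, y1 + 1, y1 + 2}. y \<noteq> b \<and> y \<noteq> d" by auto
      then show ?thesis using that F h by (auto; smt)
    qed
  qed
  show ?thesis
    by (rule rect_cut_v[where xm = xm and y = y and y' = y'])
       (rule rihD[OF ih] | use g N h xm y in \<open>auto simp: rgood_def\<close>)+
qed

lemma split_last_column:
  assumes g: "rgood x1 x2 y1 y2 a b c d" and N: "N = x2 - x1 + (y2 - y1)" and h: "y1 < y2"
    and x: "x1 + 1 < x2" "a < x2" "c = x2" "d = y1 \<or> d = y2"
  shows "rhp x1 x2 y1 y2 a b c d"
proof -
  \<comment> \<open>The last column is entered at its extreme opposite to \<open>d\<close>;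
    \<open>y\<close> is that row, or the next row inwards if \<open>b\<close> already lies in
    it.\<close>
  define y' where "y' = y1 + y2 - d"
  define y where "y = (if y' \<noteq> b then y' else if d = y1 then y' - 1 else y' + 1)"
  have y: "y \<noteq> b" "\<bar>y - y'\<bar> \<le> 1" "y1 \<le> y" "y \<le> y2" using x h by (auto simp: y_def y'_def)
  show ?thesis
  proof (rule rect_cut_v[where xm = "x2 - 1" and y = y and y' = y'])
    show "rhp x1 (x2 - 1) y1 y2 a b (x2 - 1) y"
      by (rule rihD[OF ih]) (use g N h x y in \<open>auto simp: rgood_def\<close>)
    show "rhp (x2 - 1 + 1) x2 y1 y2 (x2 - 1 + 1) y' c d"
      by (rule rihD[OF ih]) (use g N h x y in \<open>auto simp: rgood_def y'_def\<close>)
  qed fact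
qed

text \<open>A path of two columns may start and stop at adjacent cells of the column facing the
  rest, which fits a vertical corner edge of any height; a single column could only be run from end
  to end.\<close>

lemma absorb_columns:
  assumes g: "rgood (x1 + 2) x2 y1 y2 a b c d" and N: "N = x2 - x1 + (y2 - y1)" and h: "y1 < y2"
    and x: "x1 + 2 < x2"
    and corner: "(x1 + 2, y1) \<notin> {(a, b), (c, d)} \<and> (x1 + 2, y1 + 1) \<notin> {(a, b), (c, d)} \<or>
       (x1 + 2, y2) \<notin> {(a, b), (c, d)} \<and> (x1 + 2, y2 - 1) \<notin> {(a, b), (c, d)}"
  shows "rhp x1 x2 y1 y2 a b c d"
proof -
  have p: "rhp (x1 + 2) x2 y1 y2 a b c d"
    by (rule rihD[OF ih]) (use g N in auto)
  from corner obtain y \<tau> where y: "(x1 + 2, y) \<notin> {(a, b), (c, d)}" "(x1 + 2, y + \<tau>) \<notin> {(a, b), (c, d)}"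
    "y = y1 \<and> \<tau> = 1 \<or> y = y2 \<and> \<tau> = -1"
    by fastforce
  have \<tau>: "\<tau> \<in> {1, -1}" "y1 \<le> y" "y \<le> y2" "y1 \<le> y + \<tau>" "y + \<tau> \<le> y2" "\<not> (y1 \<le> y - \<tau> \<and> y - \<tau> \<le> y2)"
    using y(3) h by auto
  have e: "hpe (rect (x1 + 2) x2 y1 y2) (a, b) (c, d) (x1 + 2, y) (x1 + 2, y + \<tau>)"
    by (rule corner_vertical[OF p _ \<tau>(1), where \<sigma> = 1]) (use y(1,2) \<tau> x in simp_all)
  have q: "rhp x1 (x1 + 1) y1 y2 (x1 + 1) y (x1 + 1) (y + \<tau>)"
    by (rule rihD[OF ih]) (use y(3) h x N in \<open>auto simp: rgood_def\<close>)
  have un: "rect x1 x2 y1 y2 = rect (x1 + 2) x2 y1 y2 \<union> rect x1 (x1 + 1) y1 y2" using x by auto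
  show ?thesis
    by (rule hpe_insert[OF e q _ _ _ un]) (use \<tau>(1) in auto)
qed

text \<open>Both sides of the column are run between top and bottom; the vertex of the column that
  is not an end links them.\<close>

lemma same_column_height3:
  assumes N: "N = x2 - x1 + 2" and x: "x1 < x" "x < x2" and bd: "b \<in> {y1, y1 + 1, y1 + 2}"
    "d \<in> {y1, y1 + 1, y1 + 2}" "b < d"
  shows "rhp x1 x2 y1 (y1 + 2) x b x d"
proof -
  have L: "rhp x1 (x - 1) y1 (y1 + 2) (x - 1) y1 (x - 1) (y1 + 2)"
    by (rule rihD[OF ih]) (use N x in \<open>auto simp: rgood_def\<close>)
  have R: "rhp (x + 1) x2 y1 (y1 + 2) (x + 1) y1 (x + 1) (y1 + 2)"
    by (rule rihD[OF ih]) (use N x in \<open>auto simp: rgood_def\<close>)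
  have S: "hp {(x, y)} (x, y) (x, y)" for y by (rule hp_singleton)
  have 12: "rhp x1 x2 y1 (y1 + 2) x y1 x (y1 + 1)"
    by (rule hp_append4[OF S L S hp_append[OF hp_sym[OF R] S _ _ refl], of _ _ "y1 + 2"]) (use x in auto)
  have 13: "rhp x1 x2 y1 (y1 + 2) x y1 x (y1 + 2)"
    by (rule hp_append4[OF S L S hp_append[OF R S _ _ refl], of _ _ "y1 + 1"]) (use x in auto)
  have 23: "rhp x1 x2 y1 (y1 + 2) x (y1 + 1) x (y1 + 2)"
    by (rule rhp_flipy, rule rhp_sym) (use 12 in \<open>simp add: algebra_simps\<close>)
  show ?thesis using bd 12 13 23 by auto
qed

text \<open>The two columns split into hooks around the upper and the lower corner, between which
  the remaining rectangle is run from top to bottom.\<close>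

lemma first_two_columns_height3:
  assumes N: "N = x2 - x1 + 2" and x: "x1 + 1 < x2"
  shows "rhp x1 x2 y1 (y1 + 2) x1 (y1 + 1) (x1 + 1) (y1 + 1)"
proof -
  have R: "rhp (x1 + 2) x2 y1 (y1 + 2) (x1 + 2) y1 (x1 + 2) (y1 + 2)"
    by (rule rihD[OF ih]) (use N x in \<open>auto simp: rgood_def\<close>)
  have A: "hp {(x1, y1 + 1), (x1, y1), (x1 + 1, y1)} (x1, y1 + 1) (x1 + 1, y1)"
    unfolding hp_def ham_path_iff
    by (rule exI[of _ "[(x1, y1 + 1), (x1, y1), (x1 + 1, y1)]"]) auto
  have B: "hp {(x1 + 1, y1 + 2), (x1, y1 + 2), (x1 + 1, y1 + 1)} (x1 + 1, y1 + 2) (x1 + 1, y1 + 1)"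
    unfolding hp_def ham_path_iff
    by (rule exI[of _ "[(x1 + 1, y1 + 2), (x1, y1 + 2), (x1 + 1, y1 + 1)]"]) auto
  show ?thesis by (rule hp_append3[OF A R B]) (use x in auto)
qed

text \<open>Stripping the first two columns fails only if the rest has two columns with both ends in
  one inner row (\<open>row\<close>), or if ends block both corners of column \<open>x1 + 2\<close>:
  two ends in that column (\<open>col\<close>), or one in the middle of three rows
  (\<open>mid\<close>).\<close>

lemma wide_right_part:
  assumes g: "rgood x1 x2 y1 y2 a b c d" and N: "N = x2 - x1 + (y2 - y1)"
    and w: "x1 + 3 \<le> x2" and h: "y1 + 2 \<le> y2"
    and ac: "x1 + 2 \<le> a" "a = c \<or> a = x2 - 1 \<and> c = x2"
  shows "rhp x1 x2 y1 y2 a b c d"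
proof (cases "rgood (x1 + 2) x2 y1 y2 a b c d \<and>
    ((x1 + 2, y1) \<notin> {(a, b), (c, d)} \<and> (x1 + 2, y1 + 1) \<notin> {(a, b), (c, d)} \<or>
     (x1 + 2, y2) \<notin> {(a, b), (c, d)} \<and> (x1 + 2, y2 - 1) \<notin> {(a, b), (c, d)})")
  case True
  then show ?thesis using absorb_columns[of x1 x2 y1 y2 a b c d] N w h by auto
next
  case False
  note B = rgood_bounds[OF g]
  have ne: "a = c \<Longrightarrow> b \<noteq> d" using g w by (auto simp: rgood_def)
  from False consider
      (row) "x2 = x1 + 3" "a = x1 + 2" "c = x1 + 3" "b = d" "y1 < b" "b < y2"
    | (col) "a = c" "a = x1 + 2" "b = y1 \<or> b = y1 + 1 \<or> d = y1 \<or> d = y1 + 1"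
        "b = y2 \<or> b = y2 - 1 \<or> d = y2 \<or> d = y2 - 1"
    | (mid) "x2 = x1 + 3" "a = x1 + 2" "c = x2" "y2 = y1 + 2" "b = y1 + 1" "b \<noteq> d"
  proof -
    let ?P = "(x1 + 2, y1) \<notin> {(a, b), (c, d)} \<and> (x1 + 2, y1 + 1) \<notin> {(a, b), (c, d)} \<or>
         (x1 + 2, y2) \<notin> {(a, b), (c, d)} \<and> (x1 + 2, y2 - 1) \<notin> {(a, b), (c, d)}"
    show thesis
    proof (cases "rgood (x1 + 2) x2 y1 y2 a b c d")
      case False
      then have "x2 = x1 + 3 \<and> a = x1 + 2 \<and> c = x1 + 3 \<and> b = d \<and> y1 < b \<and> b < y2"
        using g ac w h ne unfolding rgood_def by (smt (verit))
      then show thesis using row by blast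
    next
      case True
      with False have nP: "\<not> ?P" by blast
      show thesis
      proof (cases "a = c")
        case True
        then show thesis using nP by (intro col) auto
      next
        case F: False
        then have "x2 = x1 + 3" "a = x1 + 2" "y2 = y1 + 2" "b = y1 + 1" "c = x2" using nP ac w h by auto
        moreover have "b \<noteq> d" using True \<open>x2 = _\<close> \<open>y2 = _\<close> \<open>b = _\<close> by (auto simp: rgood_def)
        ultimately show thesis using mid by blast
      qed
    qed
  qed
  then show ?thesis
  proof cases
    case row
    show ?thesis
    proof (cases "y2 = y1 + 2")
      case True
      have e: "b = y1 + 1" "d = y1 + 1" using row True by auto
      have "rhp x1 x2 y1 y2 x1 d (x1 + 1) b"
        unfolding e using first_two_columns_height3[of x2 x1 y1] N w True by simp
      then show ?thesis
        by - (rule rhp_flipx, rule rhp_sym, use row(1-3) in simp)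
    next
      case False
      \<comment> \<open>Two rows are stripped instead. Their corner edge lies in columns
        \<open>x1\<close> and \<open>x1 + 1\<close>, left of both ends.\<close>
      have up: "rhp x1 x2 y1 y2 a b c b" if "y1 + 2 \<le> b" "b < y2" for b
      proof (rule rhp_transpose, rule absorb_columns)
        show "rgood (y1 + 2) y2 x1 x2 b a b c" using row that by (auto simp: rgood_def)
      qed (use row that N False h in auto)
      show ?thesis
      proof (cases "b = y1 + 1")
        case True
        then have "rhp x1 x2 y1 y2 a (y1 + y2 - b) c (y1 + y2 - d)"
          using up[of "y1 + y2 - b"] row False h by auto
        then show ?thesis by (rule rhp_flipy)
      next
        case False
        then show ?thesis using up[of b] row by auto
      qed
    qed
  next
    case col
    have main: "rhp x1 x2 y1 y2 a b a d" if "rgood x1 x2 y1 y2 a b a d" "b < d" "b = y1 \<or> b = y1 + 1 \<or> d = y1 + 1"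
      "d = y2 \<or> d = y2 - 1 \<or> b = y2 - 1" for b d
    proof (cases "y2 = y1 + 2")
      case True
      have "rhp x1 x2 y1 (y1 + 2) (x1 + 2) b (x1 + 2) d"
        by (rule same_column_height3) (use that True N w rgood_bounds[OF that(1)] in auto)
      then show ?thesis using True col by simp
    next
      case False
      \<comment> \<open>With at least four rows, the cut below row \<open>y1 + 1\<close> separates
        the ends and leaves two rows on each side.\<close>
      show ?thesis
        by (rule rhp_transpose, rule split_wide[where xm = "y1 + 1"])
           (use that False N w h rgood_bounds[OF that(1)] in \<open>auto simp: rgood_transpose\<close>)
    qed
    show ?thesis
    proof (cases "b < d")
      case True
      then show ?thesis using main[of b d] g col B by auto
    next
      case False
      then have "rhp x1 x2 y1 y2 a d a b" using main[of d b] g ne[OF col(1)] col B by (auto simp: rgood_sym)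
      then show ?thesis using col by - (rule rhp_sym, simp)
    qed
  next
    case mid
    show ?thesis
      by (rule split_last_column) (use mid g N B in auto)
  qed
qed

lemma wide:
  assumes g: "rgood x1 x2 y1 y2 a b c d" and N: "N = x2 - x1 + (y2 - y1)"
    and w: "x1 + 3 \<le> x2" and h: "y1 + 2 \<le> y2"
  shows "rhp x1 x2 y1 y2 a b c d"
proof -
  have main: "rhp x1 x2 y1 y2 a b c d" if g: "rgood x1 x2 y1 y2 a b c d" and "a \<le> c" for a b c d
  proof -
    note B = rgood_bounds[OF g]
    \<comment> \<open>\<open>max (x1 + 1) a\<close> is the leftmost cut that has \<open>a\<close>
      and at least two columns on its left.\<close>
    consider "max (x1 + 1) a < c" "max (x1 + 1) a + 1 < x2"
      | "x1 + 2 \<le> a" "a = c \<or> a = x2 - 1 \<and> c = x2"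
      | "c \<le> x2 - 2" "a = c \<or> a = x1 \<and> c = x1 + 1"
      using B \<open>a \<le> c\<close> w by linarith
    then show ?thesis
    proof cases
      case 1
      then show ?thesis by (intro split_wide[OF g N, of "max (x1 + 1) a"]) (use h in auto)
    next
      case 2
      then show ?thesis by (intro wide_right_part[OF g N w h])
    next
      case 3
      have "rhp x1 x2 y1 y2 (x1 + x2 - c) d (x1 + x2 - a) b"
        by (rule wide_right_part[OF _ N w h]) (use 3 g in \<open>simp add: rgood_flipx rgood_sym\<close>, use 3 in arith, use 3 in arith)
      then show ?thesis by - (rule rhp_flipx, rule rhp_sym)
    qed
  qed
  show ?thesis
  proof (cases "a \<le> c")
    case False
    then show ?thesis using main[of c d a b] g by - (rule rhp_sym, simp add: rgood_sym)
  qed (use main g in blast)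
qed

end

text \<open>No cut leaves two lines on both sides here. Up to symmetry, an end in a corner allows
  the last column to be split off, ends in a common middle line are covered by
  \<open>same_column_height3\<close>, and two side midpoints next to a common corner need the
  explicit path \<open>L\<close>.\<close>

lemma rhp_3x3:
  assumes ih: "rih 4" and g: "rgood x (x + 2) y (y + 2) a b c d"
  shows "rhp x (x + 2) y (y + 2) a b c d"
proof -
  have three: "z \<le> i \<and> i \<le> z + 2 \<longleftrightarrow> i = z \<or> i = z + 1 \<or> i = z + 2" for z i :: int by arith
  have eq: "rect x (x + 2) y (y + 2) = (\<Union>i\<in>{x, x + 1, x + 2}. Pair i ` {y, y + 1, y + 2})"
    unfolding rect_def using three[of x] three[of y] by blast
  have L: "rhp x (x + 2) y (y + 2) x (y + 1) (x + 1) y"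
    unfolding hp_def ham_path_iff eq
    by (rule exI[of _ "[(x, y + 1), (x, y), (x + 1, y + 1), (x, y + 2), (x + 1, y + 2), (x + 2, y + 2),
      (x + 2, y + 1), (x + 2, y), (x + 1, y)]"]) (simp, blast)
  have corner1: "rhp x (x + 2) y (y + 2) a b c d"
    if "rgood x (x + 2) y (y + 2) a b c d" "c \<in> {x, x + 2}" "d \<in> {y, y + 2}" "a \<noteq> c" for x y a b c d
  proof (cases "c = x")
    case True
    show ?thesis
      by (rule rhp_flipx, rule split_last_column[OF ih])
         (use that True rgood_bounds[OF that(1)] rgood_flipx[of x "x + 2" y "y + 2" a b c d] in auto)
  next
    case False
    then show ?thesis
      by (intro split_last_column[OF ih that(1)]) (use that rgood_bounds[OF that(1)] in auto)
  qed
  have corner: "rhp x (x + 2) y (y + 2) a b c d"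
    if "rgood x (x + 2) y (y + 2) a b c d" "c \<in> {x, x + 2}" "d \<in> {y, y + 2}" for a b c d
  proof (cases "a = c")
    case True
    then have "b \<noteq> d" using that(1) by (auto simp: rgood_def)
    then show ?thesis
      by - (rule rhp_transpose, rule corner1, use that in \<open>auto simp: rgood_transpose\<close>)
  qed (use corner1 that in blast)
  have mid: "rhp x (x + 2) y (y + 2) (x + 1) b (x + 1) d"
    if "b \<in> {y, y + 1, y + 2}" "d \<in> {y, y + 1, y + 2}" "b \<noteq> d" for x y b d
  proof (cases "b < d")
    case True
    then show ?thesis by (intro same_column_height3[OF ih]) (use that in auto)
  next
    case False
    then show ?thesis by - (rule rhp_sym, rule same_column_height3[OF ih], use that in auto)
  qed
  have LL: "rhp x (x + 2) y (y + 2) i (y + 1) (x + 1) j" if "i \<in> {x, x + 2}" "j \<in> {y, y + 2}" for i j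
  proof -
    have 1: "rhp x (x + 2) y (y + 2) x (y + 1) (x + 1) (y + 2)"
      by (rule rhp_flipy) (use L in \<open>simp add: algebra_simps\<close>)
    have "rhp x (x + 2) y (y + 2) (x + 2) (y + 1) (x + 1) j" if "rhp x (x + 2) y (y + 2) x (y + 1) (x + 1) j" for j
      by (rule rhp_flipx) (use that in \<open>simp add: algebra_simps\<close>)
    then show ?thesis using that 1 L by auto
  qed
  note B = rgood_bounds[OF g]
  have abcd: "a \<in> {x, x + 1, x + 2}" "b \<in> {y, y + 1, y + 2}" "c \<in> {x, x + 1, x + 2}" "d \<in> {y, y + 1, y + 2}"
    using B by auto
  have ne: "(a, b) \<noteq> (c, d)" using g by (auto simp: rgood_def)
  consider (ct) "c \<in> {x, x + 2}" "d \<in> {y, y + 2}" | (cs) "a \<in> {x, x + 2}" "b \<in> {y, y + 2}"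
    | (col) "a = x + 1" "c = x + 1" | (row) "b = y + 1" "d = y + 1"
    | (l1) "a \<in> {x, x + 2}" "b = y + 1" "c = x + 1" "d \<in> {y, y + 2}"
    | (l2) "c \<in> {x, x + 2}" "d = y + 1" "a = x + 1" "b \<in> {y, y + 2}"
    using abcd by blast
  then show ?thesis
  proof cases
    case ct
    then show ?thesis using corner g by blast
  next
    case cs
    then show ?thesis using corner[of c d a b] g by - (rule rhp_sym, simp add: rgood_sym)
  next
    case col
    then show ?thesis using mid[of b y d x] abcd ne by auto
  next
    case row
    then show ?thesis using mid[of a x c y] abcd ne
      by - (rule rhp_transpose, auto)
  next
    case l1
    then show ?thesis using LL[of a d] by simp
  next
    case l2
    then show ?thesis using LL[of c b] by - (rule rhp_sym, simp)
  qed
qed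

lemma rhp_rect:
  assumes "rgood x1 x2 y1 y2 a b c d"
  shows "rhp x1 x2 y1 y2 a b c d"
  using assms
proof (induction "nat (x2 - x1 + (y2 - y1))" arbitrary: x1 x2 y1 y2 a b c d rule: less_induct)
  case less
  note B = rgood_bounds[OF less.prems]
  define N where "N = x2 - x1 + (y2 - y1)"
  have ih: "rih N"
    unfolding rih_def
  proof (intro allI impI)
    fix x1' x2' y1' y2' a b c d
    assume *: "x2' - x1' + (y2' - y1') < N" "rgood x1' x2' y1' y2' a b c d"
    show "rhp x1' x2' y1' y2' a b c d"
      by (rule less.hyps[OF _ *(2)]) (use * rgood_bounds[OF *(2)] in \<open>simp add: N_def\<close>)
  qed
  have "x1 \<le> x2" "y1 \<le> y2" using B by auto
  then consider "x1 = x2 \<or> y1 = y2" | "x2 = x1 + 1" | "y2 = y1 + 1"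
    | "x1 + 3 \<le> x2" "y1 + 2 \<le> y2" | "x1 + 2 \<le> x2" "y1 + 3 \<le> y2" | "x2 = x1 + 2" "y2 = y1 + 2"
    by linarith
  then show ?case
  proof cases
    case 1
    then show ?thesis using rhp_thin less.prems by blast
  next
    case 2
    then show ?thesis using rhp_two_columns less.prems by blast
  next
    case 3
    then show ?thesis using rhp_transpose[OF rhp_two_columns] less.prems rgood_transpose by blast
  next
    case 4
    then show ?thesis using wide[OF ih less.prems N_def] by blast
  next
    case 5
    then show ?thesis
      using wide[OF ih less.prems[folded rgood_transpose[of y1 y2]]]
      by - (rule rhp_transpose, auto simp: N_def)
  next
    case 6
    then show ?thesis using rhp_3x3[of x1 y1 a b c d] ih less.prems by (simp add: N_def)
  qed
qed

subsection \<open>Rectangle paths through a prescribed corner edge\<close>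

definition ends :: "int \<Rightarrow> int \<Rightarrow> int \<Rightarrow> int \<Rightarrow> vtx \<Rightarrow> vtx \<Rightarrow> bool" where
  "ends a b c d u v \<longleftrightarrow> (a, b) = u \<and> (c, d) = v \<or> (a, b) = v \<and> (c, d) = u"

text \<open>For an end that lies on the wanted edge: this edge is then made the first one of the
  path.\<close>

lemma hpe_start:
  assumes "hp B q t" and "s \<notin> B" "s' \<notin> B" "sg_adj s s'" "sg_adj s' q" and "V = insert s (insert s' B)"
  shows "hpe V s t s s'"
proof -
  from assms(1) obtain ps where "ham_path B q t ps" unfolding hp_def by blast
  then have "ham_path V s t ([] @ s # s' # ps)"
    using assms(2-6) by (auto simp: ham_path_iff successively_Cons sg_adj_def)
  then show ?thesis by (rule hpeI)
qed

text \<open>Supplies what follows an initial edge at the corner; \<open>2 * y1 + 1 - b\<close> is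
  the row of its second vertex. \<open>ne2\<close> excludes diagonal ends in the first two rows of
  two columns: the fourth vertex of this square would have to follow the edge and precede the end at
  once, so that the rows below are missed.\<close>

lemma rect_minus_column_start:
  assumes g: "rgood x1 x2 y1 y2 x1 b c d" and b: "b = y1 \<or> b = y1 + 1" and w: "x1 < x2" and h: "y1 < y2"
    and ne1: "\<not> (c = x1 \<and> d \<le> y1 + 1)"
    and ne2: "x2 = x1 + 1 \<Longrightarrow> y1 + 2 \<le> y2 \<Longrightarrow> \<not> (c = x2 \<and> b + d = 2 * y1 + 1)"
    and V: "V = rect x1 x2 y1 y2 - {(x1, y1), (x1, y1 + 1)}"
  shows "\<exists>q. sg_adj (x1, 2 * y1 + 1 - b) q \<and> hp V q (c, d)"
proof -
  note B = rgood_bounds[OF g]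
  have S: "hp {z} z z" for z by (rule hp_singleton)
  have q: "\<exists>q. sg_adj (x1, 2 * y1 + 1 - b) q \<and> hp V q (c, d)"
    if "hp V (x1 + 1, j) (c, d)" "j = y1 \<or> j = y1 + 1" for j
    using that b by (intro exI[of _ "(x1 + 1, j)"]) auto
  consider (two) "y2 = y1 + 1"
    | (low) "y1 + 3 \<le> y2" "y1 + 2 \<le> d" | (low_left) "y2 = y1 + 2" "d = y2" "c = x1"
    | (low_right) "y2 = y1 + 2" "d = y2" "c = x2"
    | (low_mid) "y2 = y1 + 2" "d = y2" "x1 < c" "c < x2"
    | (high) "y1 + 2 \<le> y2" "d \<le> y1 + 1" "x1 < c"
    using B h ne1 by (smt (verit))
  then show ?thesis
  proof cases
    case two
    have "hp V (x1 + 1, 2 * y1 + 1 - d) (c, d)"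
    proof -
      have "d = y1 \<or> d = y1 + 1" using two B by auto
      then
      have "rhp (x1 + 1) x2 y1 y2 (x1 + 1) (2 * y1 + 1 - d) c d"
        using two B w ne1 by - (rule rhp_rect, auto simp: rgood_def)
      moreover have "V = rect (x1 + 1) x2 y1 y2" unfolding V using two w by auto
      ultimately show ?thesis by simp
    qed
    then show ?thesis using two B by (intro q) auto
  next
    case low
    \<comment> \<open>Entering in a column other than \<open>c\<close> is admissible even if only
      two rows are left.\<close>
    define x' where "x' = (if c = x1 then x1 + 1 else x1)"
    have P: "rhp (x1 + 1) x2 y1 (y1 + 1) (x1 + 1) y1 (x1 + 1) (y1 + 1)"
      by (rule rhp_rect) (use w in \<open>auto simp: rgood_def\<close>)
    have Q: "rhp x1 x2 (y1 + 2) y2 x' (y1 + 2) c d"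
      by (rule rhp_rect) (use w low B in \<open>auto simp: rgood_def x'_def\<close>)
    have "hp V (x1 + 1, y1) (c, d)"
      by (rule hp_append[OF P Q]) (use low w in \<open>auto simp: V x'_def\<close>)
    then show ?thesis by (intro q) auto
  next
    case low_left
    have P: "rhp (x1 + 1) x2 y1 (y1 + 1) (x1 + 1) y1 x2 (y1 + 1)"
      by (rule rhp_rect) (use w in \<open>auto simp: rgood_def\<close>)
    have Q: "rhp x1 x2 y2 y2 x2 y2 c d"
      by (rule rhp_rect) (use w low_left B in \<open>auto simp: rgood_def\<close>)
    have "hp V (x1 + 1, y1) (c, d)"
      by (rule hp_append[OF P Q]) (use low_left w in \<open>auto simp: V\<close>)
    then show ?thesis by (intro q) auto
  next
    case low_right
    have P: "rhp (x1 + 1) x2 y1 (y1 + 1) (x1 + 1) y1 (x1 + 1) (y1 + 1)"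
      by (rule rhp_rect) (use w in \<open>auto simp: rgood_def\<close>)
    have Q: "rhp x1 x2 y2 y2 x1 y2 c d"
      by (rule rhp_rect) (use w low_right B in \<open>auto simp: rgood_def\<close>)
    have "hp V (x1 + 1, y1) (c, d)"
      by (rule hp_append[OF P Q]) (use low_right w in \<open>auto simp: V\<close>)
    then show ?thesis by (intro q) auto
  next
    \<comment> \<open>The last row alone cannot be traversed to an inner vertex, so it is divided
      between two pieces.\<close>
    case low_mid
    show ?thesis
    proof (cases "b = y1")
      case True
      have P: "rhp (x1 + 1) x2 y1 y2 (x1 + 1) (y1 + 1) c d"
        by (rule rhp_rect) (use low_mid in \<open>auto simp: rgood_def\<close>)
      have "hp V (x1, y2) (c, d)"
        by (rule hp_append[OF S P]) (use low_mid in \<open>auto simp: V\<close>)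
      then show ?thesis using True low_mid by (intro exI[of _ "(x1, y2)"]) auto
    next
      case b: False
      show ?thesis
      proof (cases "c = x1 + 1")
        case True
        have P: "rhp (x1 + 2) x2 y1 y2 (x1 + 2) y1 (x1 + 2) y2"
          by (rule rhp_rect) (use low_mid True in \<open>auto simp: rgood_def\<close>)
        have R: "rhp x1 (x1 + 1) y2 y2 x1 y2 c d"
          by (rule rhp_rect) (use low_mid True in \<open>auto simp: rgood_def\<close>)
        have "hp V (x1 + 1, y1) (c, d)"
          by (rule hp_append4[OF S P S[of "(x1 + 1, y1 + 1)"] R]) (use low_mid True in \<open>auto simp: V\<close>)
        then show ?thesis by (intro q) auto
      next
        case False
        have P: "rhp (x1 + 1) (x1 + 1) y1 (y1 + 1) (x1 + 1) y1 (x1 + 1) (y1 + 1)"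
          by (rule rhp_rect) (auto simp: rgood_def)
        have Q: "rhp x1 (x1 + 1) y2 y2 x1 y2 (x1 + 1) y2"
          by (rule rhp_rect) (auto simp: rgood_def)
        have R: "rhp (x1 + 2) x2 y1 y2 (x1 + 2) (y1 + 1) c d"
          by (rule rhp_rect) (use low_mid False in \<open>auto simp: rgood_def\<close>)
        have "hp V (x1 + 1, y1) (c, d)"
          by (rule hp_append3[OF P Q R]) (use low_mid False in \<open>auto simp: V\<close>)
        then show ?thesis by (intro q) auto
      qed
    qed
  next
    case high
    show ?thesis
    proof (cases "b = y1")
      case True
      have P: "rhp x1 x1 (y1 + 2) y2 x1 (y1 + 2) x1 y2"
        by (rule rhp_rect) (use high in \<open>auto simp: rgood_def\<close>)
      have Q: "rhp (x1 + 1) x2 y1 y2 (x1 + 1) y2 c d"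
        by (rule rhp_rect) (use high w B ne2 True in \<open>auto simp: rgood_def\<close>)
      have "hp V (x1, y1 + 2) (c, d)"
        by (rule hp_append[OF P Q]) (use high w in \<open>auto simp: V\<close>)
      then show ?thesis using True by (intro exI[of _ "(x1, y1 + 2)"]) auto
    next
      case False
      then have b: "b = y1 + 1" using b by auto
      \<comment> \<open>Two columns would contradict \<open>ne2\<close> or put both ends into one
        inner row.\<close>
      have w: "x1 + 2 \<le> x2" 
      proof (rule ccontr)
        assume "\<not> x1 + 2 \<le> x2"
        then have *: "x2 = x1 + 1" "c = x2" using high w B by linarith+
        then have "d \<noteq> y1" using ne2 high b by auto
        moreover have "d \<noteq> b" using g * high b by (auto simp: rgood_def)
        ultimately show False using high B b by auto
      qed
      have P: "rhp x1 (x1 + 1) (y1 + 2) y2 x1 (y1 + 2) (x1 + 1) y2"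
        by (rule rhp_rect) (use high in \<open>auto simp: rgood_def\<close>)
      have C: "rhp (x1 + 1) (x1 + 1) y1 (y1 + 1) (x1 + 1) y1 (x1 + 1) (y1 + 1)"
        by (rule rhp_rect) (auto simp: rgood_def)
      have R: "rhp (x1 + 2) x2 y1 y2 (x1 + 2) y2 (x1 + 2) y1"
        by (rule rhp_rect) (use high w in \<open>auto simp: rgood_def\<close>)
      consider (l1) "c = x1 + 1" "d = y1" | (l2) "c = x1 + 1" "d = y1 + 1"
        | (r) "x1 + 2 \<le> c" "x1 + 3 \<le> x2 \<or> d = y1" | (m) "x2 = x1 + 2" "c = x2" "d = y1 + 1"
        using high B w by linarith
      then show ?thesis
      proof cases
        case l1
        have "hp V (x1 + 1, y1 + 1) (c, d)"
          by (rule hp_append4[OF S P R S[of "(c, d)"]]) (use l1 high w in \<open>auto simp: V\<close>)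
        then show ?thesis by (intro q) auto
      next
        case l2
        have "hp V (x1 + 1, y1) (c, d)"
          by (rule hp_append4[OF S hp_sym[OF R] hp_sym[OF P] S[of "(c, d)"]])
             (use l2 high w in \<open>auto simp: V\<close>)
        then show ?thesis by (intro q) auto
      next
        case r
        have R: "rhp (x1 + 2) x2 y1 y2 (x1 + 2) y2 c d"
          by (rule rhp_rect) (use r high w B in \<open>auto simp: rgood_def\<close>)
        have "hp V (x1 + 1, y1) (c, d)"
          by (rule hp_append3[OF C P R]) (use r high w in \<open>auto simp: V\<close>)
        then show ?thesis by (intro q) auto
      next
        \<comment> \<open>The part to the right would be a single column with the end inside it, so
          the cuts are horizontal.\<close>
        case m
        have T: "rhp (x1 + 1) x2 y1 y1 (x1 + 1) y1 x2 y1"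
          by (rule rhp_rect) (use m in \<open>auto simp: rgood_def\<close>)
        have R: "rhp x1 x2 (y1 + 2) y2 x1 (y1 + 2) x2 (y1 + 2)"
          by (rule rhp_rect) (use m high in \<open>auto simp: rgood_def\<close>)
        have "x1 \<le> i \<and> i \<le> x2 \<longleftrightarrow> i = x1 \<or> i = x1 + 1 \<or> i = x2" for i using m(1) by arith
        moreover have "y1 \<le> j \<and> j \<le> y2 \<longleftrightarrow> j = y1 \<or> j = y1 + 1 \<or> y1 + 2 \<le> j \<and> j \<le> y2" for j
          using high by arith
        ultimately have un: "V = rect (x1 + 1) x2 y1 y1 \<union> {(x1 + 1, y1 + 1)} \<union> rect x1 x2 (y1 + 2) y2 \<union> {(c, d)}"
          unfolding V rect_def m(2,3) by (auto simp: m(1))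
        have "hp V (x1 + 1, y1) (c, d)"
          by (rule hp_append4[OF T S[of "(x1 + 1, y1 + 1)"] R S[of "(c, d)"] _ _ _ _ _ _ _ _ _ un])
             (use m high in auto)
        then show ?thesis by (intro q) auto
      qed
    qed
  qed
qed

lemma rect_edge_top_left:
  assumes g: "rgood x1 x2 y1 y2 a b c d" and w: "x1 < x2" and h: "y1 < y2"
    and ne1: "\<not> ends a b c d (x1, y1) (x1, y1 + 1)"
    and ne2: "x2 = x1 + 1 \<Longrightarrow> y1 + 2 \<le> y2 \<Longrightarrow>
       \<not> ends a b c d (x1, y1) (x2, y1 + 1) \<and> \<not> ends a b c d (x1, y1 + 1) (x2, y1)"
  shows "hpe (rect x1 x2 y1 y2) (a, b) (c, d) (x1, y1) (x1, y1 + 1)"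
proof -
  have main: "hpe (rect x1 x2 y1 y2) (a, b) (c, d) (x1, y1) (x1, y1 + 1)"
    if g: "rgood x1 x2 y1 y2 a b c d" and "a = x1" and b: "b = y1 \<or> b = y1 + 1"
      and ne1: "\<not> ends a b c d (x1, y1) (x1, y1 + 1)"
      and ne2: "x2 = x1 + 1 \<Longrightarrow> y1 + 2 \<le> y2 \<Longrightarrow>
       \<not> ends a b c d (x1, y1) (x2, y1 + 1) \<and> \<not> ends a b c d (x1, y1 + 1) (x2, y1)"
    for a b c d
  proof -
    have "(a, b) \<noteq> (c, d)" using g w by (auto simp: rgood_def)
    moreover have "\<not> (c = x1 \<and> d = 2 * y1 + 1 - b)" using ne1 b \<open>a = x1\<close> by (auto simp: ends_def)
    ultimately have c: "\<not> (c = x1 \<and> d \<le> y1 + 1)" using b \<open>a = x1\<close> rgood_bounds[OF g] by (smt (verit))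
    have "\<exists>q. sg_adj (x1, 2 * y1 + 1 - b) q \<and> hp (rect x1 x2 y1 y2 - {(x1, y1), (x1, y1 + 1)}) q (c, d)"
      by (rule rect_minus_column_start[OF _ b w h c _ refl])
         (use g \<open>a = x1\<close> ne2 b in \<open>auto simp: ends_def\<close>)
    then obtain q where q: "sg_adj (x1, 2 * y1 + 1 - b) q"
      "hp (rect x1 x2 y1 y2 - {(x1, y1), (x1, y1 + 1)}) q (c, d)" by blast
    have "hpe (rect x1 x2 y1 y2) (x1, b) (c, d) (x1, b) (x1, 2 * y1 + 1 - b)"
      by (rule hpe_start[OF q(2) _ _ _ q(1)]) (use b w h in auto)
    then show ?thesis using b \<open>a = x1\<close> by (auto intro: hpe_swap)
  qed
  show ?thesis
  proof (cases "a = x1 \<and> (b = y1 \<or> b = y1 + 1)")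
    case True
    then show ?thesis using main[of a b c d] g ne1 ne2 by blast
  next
    case ab: False
    show ?thesis
    proof (cases "c = x1 \<and> (d = y1 \<or> d = y1 + 1)")
      case True
      have s: "ends c d a b u v = ends a b c d u v" for u v by (auto simp: ends_def)
      have "hpe (rect x1 x2 y1 y2) (c, d) (a, b) (x1, y1) (x1, y1 + 1)"
      proof (rule main)
        show "rgood x1 x2 y1 y2 c d a b" using g by (simp only: rgood_sym)
        show "\<not> ends c d a b (x1, y1) (x1, y1 + 1)" using ne1 by (simp only: s not_False_eq_True)
        show "\<not> ends c d a b (x1, y1) (x2, y1 + 1) \<and> \<not> ends c d a b (x1, y1 + 1) (x2, y1)"
          if "x2 = x1 + 1" "y1 + 2 \<le> y2" using ne2[OF that] by (simp only: s not_False_eq_True)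
      qed (use True in auto)
      then show ?thesis by (rule hpe_sym)
    next
      case False
      show ?thesis
        by (rule corner_vertical[OF rhp_rect[OF g], of 1 1]) (use ab False w h in auto)
    qed
  qed
qed

lemma rect_edge_top_right:
  assumes g: "rgood x1 x2 y1 y2 a b c d" and w: "x1 < x2" and h: "y1 < y2"
    and ne1: "\<not> ends a b c d (x2, y1) (x2, y1 + 1)"
    and ne2: "x2 = x1 + 1 \<Longrightarrow> y1 + 2 \<le> y2 \<Longrightarrow>
       \<not> ends a b c d (x1, y1) (x2, y1 + 1) \<and> \<not> ends a b c d (x1, y1 + 1) (x2, y1)"
  shows "hpe (rect x1 x2 y1 y2) (a, b) (c, d) (x2, y1) (x2, y1 + 1)"
proof (rule hpe_flipx[where p = "x1 + x2"])
  have "hpe (rect x1 x2 y1 y2) (x1 + x2 - a, b) (x1 + x2 - c, d) (x1, y1) (x1, y1 + 1)"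
    by (rule rect_edge_top_left[OF _ w h])
       (use g ne1 ne2 in \<open>auto simp: rgood_flipx ends_def\<close>)
  then show "hpe (rect x1 x2 y1 y2) (flipx (x1 + x2) (a, b)) (flipx (x1 + x2) (c, d))
     (flipx (x1 + x2) (x2, y1)) (flipx (x1 + x2) (x2, y1 + 1))" by simp
qed auto

lemma rect_edge_bottom_right:
  assumes g: "rgood x1 x2 y1 y2 a b c d" and w: "x1 < x2" and h: "y1 < y2"
    and ne1: "\<not> ends a b c d (x2, y2) (x2, y2 - 1)"
    and ne2: "x2 = x1 + 1 \<Longrightarrow> y1 + 2 \<le> y2 \<Longrightarrow>
       \<not> ends a b c d (x1, y2) (x2, y2 - 1) \<and> \<not> ends a b c d (x1, y2 - 1) (x2, y2)"
  shows "hpe (rect x1 x2 y1 y2) (a, b) (c, d) (x2, y2) (x2, y2 - 1)"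
proof (rule hpe_flipy[where p = "y1 + y2"])
  have "rgood x1 x2 y1 y2 a (y1 + y2 - b) c (y1 + y2 - d)"
    using g rgood_flipx[of y1 y2 x1 x2 b a d c]
    by (simp add: rgood_transpose[of y1 y2 x1 x2])
  moreover have "ends a (y1 + y2 - b) c (y1 + y2 - d) (i, j) (i', j') \<longleftrightarrow>
      ends a b c d (i, y1 + y2 - j) (i', y1 + y2 - j')" for i j i' j'
    unfolding ends_def prod.inject by (auto simp: algebra_simps)
  ultimately have "hpe (rect x1 x2 y1 y2) (a, y1 + y2 - b) (c, y1 + y2 - d) (x2, y1) (x2, y1 + 1)"
    by (intro rect_edge_top_right[OF _ w h]) (use ne1 ne2 in \<open>simp_all add: algebra_simps\<close>)
  then show "hpe (rect x1 x2 y1 y2) (flipy (y1 + y2) (a, b)) (flipy (y1 + y2) (c, d))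
     (flipy (y1 + y2) (x2, y2)) (flipy (y1 + y2) (x2, y2 - 1))" by simp
qed auto

lemma rect_edge_bottom_left_horizontal:
  assumes g: "rgood x1 x2 y1 y2 a b c d" and w: "x1 < x2" and h: "y1 < y2"
    and ne1: "\<not> ends a b c d (x1, y2) (x1 + 1, y2)"
    and ne2: "y2 = y1 + 1 \<Longrightarrow> x1 + 2 \<le> x2 \<Longrightarrow>
       \<not> ends a b c d (x1, y1) (x1 + 1, y2) \<and> \<not> ends a b c d (x1 + 1, y1) (x1, y2)"
  shows "hpe (rect x1 x2 y1 y2) (a, b) (c, d) (x1, y2) (x1 + 1, y2)"
proof (rule hpe_transpose)
  have "ends b a d c (j, i) (j', i') \<longleftrightarrow> ends a b c d (i, j) (i', j')" for i j i' j'
    unfolding ends_def prod.inject by blast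
  moreover have "rgood y1 y2 x1 x2 b a d c" using g by (simp only: rgood_transpose)
  ultimately have "hpe (rect y1 y2 x1 x2) (b, a) (d, c) (y2, x1) (y2, x1 + 1)"
    by (intro rect_edge_top_right[OF _ h w]) (use ne1 ne2 in simp_all)
  then show "hpe (rect y1 y2 x1 x2) (prod.swap (a, b)) (prod.swap (c, d)) (prod.swap (x1, y2)) (prod.swap (x1 + 1, y2))"
    by simp
qed auto

subsection \<open>L-shapes and the case of ends in the narrow columns\<close>

text \<open>Rows \<open>y1..y2\<close> and \<open>y3+1..y4\<close> are wide (columns \<open>1..m\<close>), the rows between them are narrow (columns \<open>1..a\<close>).
  For \<open>y3 = y4\<close> or \<open>y2 = y1 - 1\<close> one of the wide parts is missing and the shape is an L.\<close>

definition cshape :: "int \<Rightarrow> int \<Rightarrow> int \<Rightarrow> int \<Rightarrow> int \<Rightarrow> int \<Rightarrow> vtx set" where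
  "cshape a m y1 y2 y3 y4 = {(x, y). 1 \<le> x \<and> x \<le> m \<and> y1 \<le> y \<and> y \<le> y4 \<and> (x \<le> a \<or> y \<le> y2 \<or> y3 < y)}"

lemma mem_cshape [simp]:
  "(x, y) \<in> cshape a m y1 y2 y3 y4 \<longleftrightarrow> 1 \<le> x \<and> x \<le> m \<and> y1 \<le> y \<and> y \<le> y4 \<and> (x \<le> a \<or> y \<le> y2 \<or> y3 < y)"
  by (simp add: cshape_def)

text \<open>The reflection sends the narrow rows from \<open>y2 + 1\<close> to \<open>y3\<close>
  onto those from \<open>y1 + y4 - y3\<close> to \<open>y1 + y4 - y2 - 1\<close>; hence the
  parameters.\<close>

lemma hp_cshape_flipy:
  assumes "hp (cshape a m y1 (y1 + y4 - y3 - 1) (y1 + y4 - y2 - 1) y4) (p, y1 + y4 - q) (r, y1 + y4 - u)"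
  shows "hp (cshape a m y1 y2 y3 y4) (p, q) (r, u)"
  by (rule hp_flipy[where p = "y1 + y4"], use assms in simp) auto

text \<open>An arm of two or more rows and columns is run between its two cells beside the edge. A
  single column is run from \<open>y1\<close> to \<open>y2\<close>, and row \<open>y2\<close> is
  within reach of \<open>(a, y1 + 1)\<close> up to \<open>y2 = y1 + 2\<close>.\<close>

lemma attach_top_arm:
  assumes e: "hpe U s t (a, y1) (a, y1 + 1)" and m: "a < m" and y: "y1 \<le> y2"
    and arm: "a + 2 \<le> m \<and> y1 < y2 \<or> m = a + 1 \<and> y2 \<le> y1 + 2"
    and d: "U \<inter> rect (a + 1) m y1 y2 = {}" and V: "V = U \<union> rect (a + 1) m y1 y2"
  shows "hp V s t"
proof -
  have "\<exists>j. rhp (a + 1) m y1 y2 (a + 1) y1 (a + 1) j \<and> \<bar>y1 + 1 - j\<bar> \<le> 1"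
  proof (cases "m = a + 1")
    case True
    have "rhp (a + 1) m y1 y2 (a + 1) y1 (a + 1) y2"
      by (rule rhp_rect) (use True y in \<open>auto simp: rgood_def\<close>)
    then show ?thesis using arm y True by (intro exI[of _ y2]) auto
  next
    case False
    have "rhp (a + 1) m y1 y2 (a + 1) y1 (a + 1) (y1 + 1)"
      by (rule rhp_rect) (use False m arm in \<open>auto simp: rgood_def\<close>)
    then show ?thesis by (intro exI[of _ "y1 + 1"]) auto
  qed
  then obtain j where j: "rhp (a + 1) m y1 y2 (a + 1) y1 (a + 1) j" "\<bar>y1 + 1 - j\<bar> \<le> 1" by blast
  show ?thesis
    by (rule hpe_insert[OF e j(1) d _ _ V]) (use j(2) in auto)
qed

lemma attach_bottom_arm:
  assumes e: "hpe U s t (a, y4) (a, y4 - 1)" and m: "a < m" and y: "y3 < y4"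
    and arm: "a + 2 \<le> m \<and> y3 + 1 < y4 \<or> m = a + 1 \<and> y4 \<le> y3 + 3"
    and d: "U \<inter> rect (a + 1) m (y3 + 1) y4 = {}" and V: "V = U \<union> rect (a + 1) m (y3 + 1) y4"
  shows "hp V s t"
proof -
  have "\<exists>j. rhp (a + 1) m (y3 + 1) y4 (a + 1) y4 (a + 1) j \<and> \<bar>y4 - 1 - j\<bar> \<le> 1"
  proof (cases "m = a + 1")
    case True
    have "rhp (a + 1) m (y3 + 1) y4 (a + 1) y4 (a + 1) (y3 + 1)"
      by (rule rhp_rect) (use True y in \<open>auto simp: rgood_def\<close>)
    then show ?thesis using arm y True by (intro exI[of _ "y3 + 1"]) auto
  next
    case False
    have "rhp (a + 1) m (y3 + 1) y4 (a + 1) y4 (a + 1) (y4 - 1)"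
      by (rule rhp_rect) (use False m arm in \<open>auto simp: rgood_def\<close>)
    then show ?thesis by (intro exI[of _ "y4 - 1"]) auto
  qed
  then obtain j where j: "rhp (a + 1) m (y3 + 1) y4 (a + 1) y4 (a + 1) j" "\<bar>y4 - 1 - j\<bar> \<le> 1" by blast
  show ?thesis
    by (rule hpe_insert[OF e j(1) d _ _ V]) (use j(2) in auto)
qed

text \<open>A one-column arm too long for \<open>attach_top_arm\<close> is cut down to two rows; the
  full rows above form a rectangle, which is inserted at the left corner of the shortened
  shape.\<close>

lemma absorb_top_rows:
  assumes p: "hp (cshape a m (y2 - 1) y2 y3 y4) (p, q) (r, u)" and q: "y2 < q" "y2 < u"
    and y: "y1 + 3 \<le> y2" and a: "2 \<le> a" "a < m" and y4: "y2 \<le> y4"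
  shows "hp (cshape a m y1 y2 y3 y4) (p, q) (r, u)"
proof -
  have e: "hpe (cshape a m (y2 - 1) y2 y3 y4) (p, q) (r, u) (1, y2 - 1) (1 + 1, y2 - 1)"
    by (rule corner_horizontal[OF p, where \<tau> = 1]) (use q a y4 in auto)
  have R: "rhp 1 m y1 (y2 - 2) 1 (y2 - 2) 2 (y2 - 2)"
    by (rule rhp_rect) (use a y in \<open>auto simp: rgood_def\<close>)
  show ?thesis by (rule hpe_insert[OF e R]) (use a y y4 in auto)
qed

lemma absorb_bottom_rows:
  assumes p: "hp (cshape a m y1 y2 y3 (y3 + 2)) (p, q) (r, u)" and q: "q \<le> y3" "u \<le> y3"
    and y: "y3 + 4 \<le> y4" and a: "2 \<le> a" "a < m" and y1: "y1 \<le> y3"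
  shows "hp (cshape a m y1 y2 y3 y4) (p, q) (r, u)"
proof -
  have e: "hpe (cshape a m y1 y2 y3 (y3 + 2)) (p, q) (r, u) (1, y3 + 2) (1 + 1, y3 + 2)"
    by (rule corner_horizontal[OF p, where \<tau> = "-1"]) (use q a y1 in auto)
  have R: "rhp 1 m (y3 + 3) y4 1 (y3 + 3) 2 (y3 + 3)"
    by (rule rhp_rect) (use a y in \<open>auto simp: rgood_def\<close>)
  show ?thesis by (rule hpe_insert[OF e R]) (use a y y1 in auto)
qed

text \<open>The narrow columns over the full height form a rectangle, and as the ends lie below the
  arm, its upper right corner edge is available for the arm. \<open>two\<close> is the two-column
  cut condition of that rectangle.\<close>

lemma hp_foot_below:
  assumes a: "2 \<le> a" "a < m" and y: "y1 \<le> y2" "y2 = y1 \<Longrightarrow> m = a + 1"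
    and s: "1 \<le> p" "p \<le> a" "y2 < q" "q \<le> y4" and t: "1 \<le> r" "r \<le> a" "y2 < u" "u \<le> y4"
    and ne: "(p, q) \<noteq> (r, u)" and two: "a = 2 \<Longrightarrow> q = u \<Longrightarrow> q = y4"
  shows "hp (cshape a m y1 y2 y4 y4) (p, q) (r, u)"
proof -
  have small: "hp (cshape a m y1 y2 y4 y4) (p, q) (r, u)"
    if arm: "a + 2 \<le> m \<and> y1 < y2 \<or> m = a + 1 \<and> y2 \<le> y1 + 2" and y: "y1 \<le> y2" for y1
  proof (rule attach_top_arm[OF _ a(2) y arm])
    show "hpe (rect 1 a y1 y4) (p, q) (r, u) (a, y1) (a, y1 + 1)"
    proof (rule rect_edge_top_right)
      show "rgood 1 a y1 y4 p q r u"
        unfolding rgood_def using a y s t ne two by auto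
    qed (use a y s t in \<open>auto simp: ends_def\<close>)
  qed (use y s a in auto)
  show ?thesis
  proof (cases "m = a + 1 \<and> y1 + 3 \<le> y2")
    case True
    have "hp (cshape a m (y2 - 1) y2 y4 y4) (p, q) (r, u)" by (rule small) (use True in auto)
    then show ?thesis by (rule absorb_top_rows) (use True s t a in auto)
  next
    case False
    moreover have "y1 < y2 \<or> m = a + 1" using y by (cases "y1 = y2") auto
    ultimately show ?thesis by (intro small) (use a y in auto)
  qed
qed

lemma hp_foot_above:
  assumes a: "2 \<le> a" "a < m" and y: "y3 < y4" "y4 = y3 + 1 \<Longrightarrow> m = a + 1"
    and s: "1 \<le> p" "p \<le> a" "y1 \<le> q" "q \<le> y3" and t: "1 \<le> r" "r \<le> a" "y1 \<le> u" "u \<le> y3"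
    and ne: "(p, q) \<noteq> (r, u)" and two: "a = 2 \<Longrightarrow> q = u \<Longrightarrow> q = y1"
  shows "hp (cshape a m y1 (y1 - 1) y3 y4) (p, q) (r, u)"
proof (rule hp_cshape_flipy)
  show "hp (cshape a m y1 (y1 + y4 - y3 - 1) (y1 + y4 - (y1 - 1) - 1) y4) (p, y1 + y4 - q) (r, y1 + y4 - u)"
    using hp_foot_below[OF a, of y1 "y1 + y4 - y3 - 1" p "y1 + y4 - q" y4 r "y1 + y4 - u"] y s t ne two by simp
qed

text \<open>Each end is one of the two neighbours of a one-cell arm, which forces the path to start
  with end, arm, other neighbour, and to finish likewise. What is left, \<open>?U\<close>, is run
  from top to bottom.\<close>

lemma hp_between_tips:
  assumes a: "2 \<le> a" "m = a + 1" and n: "y1 + 3 \<le> y4"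
    and s: "p = a" "q = y1 \<or> q = y1 + 1" and t: "r = a" "u = y4 \<or> u = y4 - 1"
  shows "hp (cshape a m y1 y1 (y4 - 1) y4) (p, q) (r, u)"
proof -
  have tip: "hp {(a, j), (m, k), (a, j')} (a, j) (a, j')"
    if "k \<in> {j, j'}" "\<bar>j - j'\<bar> = 1" for j j' k
    unfolding hp_def ham_path_iff
    by (rule exI[of _ "[(a, j), (m, k), (a, j')]"]) (use that a in auto)
  have P: "hp {(a, q), (m, y1), (a, 2 * y1 + 1 - q)} (p, q) (a, 2 * y1 + 1 - q)"
    unfolding s(1) by (rule tip) (use s in auto)
  have T: "hp {(a, 2 * y4 - 1 - u), (m, y4), (a, u)} (a, 2 * y4 - 1 - u) (r, u)"
    unfolding t(1) by (rule tip) (use t in auto)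
  let ?U = "{(i, j). 1 \<le> i \<and> y1 \<le> j \<and> j \<le> y4 \<and> (i < a \<or> i = a \<and> y1 + 2 \<le> j \<and> j \<le> y4 - 2)}"
  have mid: "hp ?U (a - 1, y1) (a - 1, y4)"
  proof (cases "y4 = y1 + 3")
    case True
    have "rhp 1 (a - 1) y1 y4 (a - 1) y1 (a - 1) y4"
      by (rule rhp_rect) (use a True in \<open>auto simp: rgood_def\<close>)
    moreover have "?U = rect 1 (a - 1) y1 y4" using True by auto
    ultimately show ?thesis by simp
  next
    \<comment> \<open>Column \<open>a\<close> contributes only to the rows in the middle, so
      \<open>?U\<close> is cut into three bands, the middle one being a column wider.\<close>
    case False
    have 1: "rhp 1 (a - 1) y1 (y1 + 1) (a - 1) y1 (a - 1) (y1 + 1)"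
      by (rule rhp_rect) (use a in \<open>auto simp: rgood_def\<close>)
    have 2: "rhp 1 a (y1 + 2) (y4 - 2) a (y1 + 2) 1 (y4 - 2)"
      by (rule rhp_rect) (use a n False in \<open>auto simp: rgood_def\<close>)
    have 3: "rhp 1 (a - 1) (y4 - 1) y4 1 (y4 - 1) (a - 1) y4"
      by (rule rhp_rect) (use a in \<open>auto simp: rgood_def\<close>)
    show ?thesis by (rule hp_append3[OF 1 2 3]) (use a n False in auto)
  qed
  have Ps: "{(a, q), (m, y1), (a, 2 * y1 + 1 - q)} =
      {(i, j). i = a \<and> y1 \<le> j \<and> j \<le> y1 + 1 \<or> i = m \<and> j = y1}" using s(2) by auto
  have Ts: "{(a, 2 * y4 - 1 - u), (m, y4), (a, u)} =
      {(i, j). i = a \<and> y4 - 1 \<le> j \<and> j \<le> y4 \<or> i = m \<and> j = y4}" using t(2) by auto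
  have un: "(i, j) \<in> cshape a m y1 y1 (y4 - 1) y4 \<longleftrightarrow>
      (i = a \<and> y1 \<le> j \<and> j \<le> y1 + 1 \<or> i = m \<and> j = y1) \<or>
      (1 \<le> i \<and> y1 \<le> j \<and> j \<le> y4 \<and> (i < a \<or> i = a \<and> y1 + 2 \<le> j \<and> j \<le> y4 - 2)) \<or>
      (i = a \<and> y4 - 1 \<le> j \<and> j \<le> y4 \<or> i = m \<and> j = y4)" for i j
  proof -
    consider "i < a" | "i = a" | "i = m" | "m < i" using a(2) by linarith
    then show ?thesis
    proof cases
      case 1
      then show ?thesis using a by auto
    next
      case 2
      then show ?thesis using a n by simp presburger
    next
      case 3
      then show ?thesis using a n by simp presburger
    next
      case 4
      then show ?thesis using a by auto
    qed
  qed
  have adj: "sg_adj (a, 2 * y1 + 1 - q) (a - 1, y1)" "sg_adj (a - 1, y4) (a, 2 * y4 - 1 - u)"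
    using s(2) t(2) by auto
  show ?thesis
    by (rule hp_append3[OF P[unfolded Ps] mid T[unfolded Ts] adj])
       (use a n in force, use a n in force, use a n in force, unfold set_eq_iff split_paired_All, simp only: un Un_iff mem_Collect_eq case_prod_conv disj_assoc simp_thms)
qed

text \<open>The upper arm uses a prescribed corner edge of the narrow rectangle; the lower one uses
  the corner of the resulting L-shape, which by \<open>hit\<close> is free of ends. By
  \<open>y2 + 2 < y4\<close>, column \<open>a + 1\<close> is empty in row \<open>y4 - 2\<close>, as
  the corner argument requires.\<close>

lemma hp_inner_half:
  assumes a: "2 \<le> a" "a < m" and y: "y1 \<le> y2" "y2 < y3" "y3 < y4" "y2 + 2 < y4"
    and s: "1 \<le> p" "p \<le> a" and t: "1 \<le> r" "r \<le> a"
    and top: "a + 2 \<le> m \<and> y1 < y2 \<or> m = a + 1 \<and> y2 \<le> y1 + 2"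
    and bottom: "a + 2 \<le> m \<and> y3 + 1 < y4 \<or> m = a + 1 \<and> y4 \<le> y3 + 3"
    and g: "rgood 1 a y1 y4 p q r u"
    and ne1: "\<not> ends p q r u (a, y1) (a, y1 + 1)"
    and ne2: "a = 2 \<Longrightarrow> \<not> ends p q r u (1, y1) (2, y1 + 1) \<and> \<not> ends p q r u (1, y1 + 1) (2, y1)"
    and hit: "(p, q) \<noteq> (a, y4)" "(p, q) \<noteq> (a, y4 - 1)" "(r, u) \<noteq> (a, y4)" "(r, u) \<noteq> (a, y4 - 1)"
  shows "hp (cshape a m y1 y2 y3 y4) (p, q) (r, u)"
proof -
  have "hpe (rect 1 a y1 y4) (p, q) (r, u) (a, y1) (a, y1 + 1)"
    by (rule rect_edge_top_right[OF g _ _ ne1]) (use ne2 a y in auto)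
  then have "hp (cshape a m y1 y2 y4 y4) (p, q) (r, u)"
    by (rule attach_top_arm[OF _ a(2) y(1) top]) (use a y in auto)
  then have "hpe (cshape a m y1 y2 y4 y4) (p, q) (r, u) (a, y4) (a, y4 + (-1))"
    by (rule corner_vertical[where \<sigma> = "-1"]) (use a y hit in auto)
  then have "hpe (cshape a m y1 y2 y4 y4) (p, q) (r, u) (a, y4) (a, y4 - 1)" by simp
  then show ?thesis
    by (rule attach_bottom_arm[OF _ a(2) y(3) bottom]) (use a y in auto)
qed

lemma ends_flip:
  "ends p (z - q) r (z - u) (i, j) (i', j') \<longleftrightarrow> ends p q r u (i, z - j) (i', z - j')"
  unfolding ends_def prod.inject by (auto simp: algebra_simps)

lemma rgood_flipy: "rgood x1 x2 y1 y2 a (y1 + y2 - b) c (y1 + y2 - d) \<longleftrightarrow> rgood x1 x2 y1 y2 a b c d"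
  using rgood_flipx[of y1 y2 x1 x2 b a d c] by (simp add: rgood_transpose[of x1 x2 y1 y2])

text \<open>At one arm the corner edge must be free of ends; at the other it is enough that it can
  be prescribed. An arm of several rows has both ends beyond it, so both corners can be occupied
  only if both arms are single cells, which is the case of \<open>hp_between_tips\<close>.\<close>

lemma hp_inner:
  assumes a: "2 \<le> a" "a < m" and y: "y1 \<le> y2" "y2 < y3" "y3 < y4" and n: "y1 + 3 \<le> y4"
    and s: "1 \<le> p" "p \<le> a" "y1 \<le> q" "q \<le> y4" and t: "1 \<le> r" "r \<le> a" "y1 \<le> u" "u \<le> y4"
    and ne: "(p, q) \<noteq> (r, u)" and two: "a = 2 \<Longrightarrow> q = u \<Longrightarrow> q = y1 \<or> q = y4"
    and top: "y2 = y1 \<and> m = a + 1 \<or> y1 < y2 \<and> y2 < q \<and> y2 < u"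
    and bottom: "y4 = y3 + 1 \<and> m = a + 1 \<or> y3 + 1 < y4 \<and> q \<le> y3 \<and> u \<le> y3"
    and ne1: "\<not> ends p q r u (a, y1) (a, y1 + 1)"
    and ne2: "a = 2 \<Longrightarrow> \<not> ends p q r u (1, y1) (2, y1 + 1) \<and> \<not> ends p q r u (1, y1 + 1) (2, y1)"
    and ne3: "\<not> ends p q r u (a, y4) (a, y4 - 1)"
    and ne4: "a = 2 \<Longrightarrow> \<not> ends p q r u (1, y4) (2, y4 - 1) \<and> \<not> ends p q r u (1, y4 - 1) (2, y4)"
  shows "hp (cshape a m y1 y2 y3 y4) (p, q) (r, u)"
proof -
  \<comment> \<open>Generalised over \<open>y1\<close> and \<open>y4\<close>, because long
    one-column arms are shortened on either side before it is applied.\<close>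
  have small: "hp (cshape a m y1 y2 y3 y4) (p, q) (r, u)"
    if y: "y1 \<le> y2" "y3 < y4" and n: "y1 + 3 \<le> y4"
      and s: "y1 \<le> q" "q \<le> y4" and t: "y1 \<le> u" "u \<le> y4" and two: "a = 2 \<Longrightarrow> q = u \<Longrightarrow> q = y1 \<or> q = y4"
      and top: "y2 = y1 \<and> m = a + 1 \<or> y1 < y2 \<and> y2 < q \<and> y2 < u \<and> (a + 2 \<le> m \<or> y2 \<le> y1 + 2)"
      and bottom: "y4 = y3 + 1 \<and> m = a + 1 \<or> y3 + 1 < y4 \<and> q \<le> y3 \<and> u \<le> y3 \<and> (a + 2 \<le> m \<or> y4 \<le> y3 + 3)"
      and ne1: "\<not> ends p q r u (a, y1) (a, y1 + 1)"
      and ne2: "a = 2 \<Longrightarrow> \<not> ends p q r u (1, y1) (2, y1 + 1) \<and> \<not> ends p q r u (1, y1 + 1) (2, y1)"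
      and ne3: "\<not> ends p q r u (a, y4) (a, y4 - 1)"
      and ne4: "a = 2 \<Longrightarrow> \<not> ends p q r u (1, y4) (2, y4 - 1) \<and> \<not> ends p q r u (1, y4 - 1) (2, y4)"
    for y1 y4
  proof -
    have g: "rgood 1 a y1 y4 p q r u"
      unfolding rgood_def using a n \<open>1 \<le> p\<close> \<open>p \<le> a\<close> \<open>1 \<le> r\<close> \<open>r \<le> a\<close> s t ne two by auto
    have tc: "a + 2 \<le> m \<and> y1 < y2 \<or> m = a + 1 \<and> y2 \<le> y1 + 2" using top a by auto
    have bc: "a + 2 \<le> m \<and> y3 + 1 < y4 \<or> m = a + 1 \<and> y4 \<le> y3 + 3" using bottom a by auto
    consider (b) "y2 + 2 < y4" "(p, q) \<noteq> (a, y4)" "(p, q) \<noteq> (a, y4 - 1)" "(r, u) \<noteq> (a, y4)" "(r, u) \<noteq> (a, y4 - 1)"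
      | (t) "y1 + 1 < y3" "(p, q) \<noteq> (a, y1)" "(p, q) \<noteq> (a, y1 + 1)" "(r, u) \<noteq> (a, y1)" "(r, u) \<noteq> (a, y1 + 1)"
      | (both) "y2 = y1" "y4 = y3 + 1" "m = a + 1" "p = a" "r = a"
          "q = y1 \<or> q = y1 + 1" "u = y4 \<or> u = y4 - 1"
      | (both') "y2 = y1" "y4 = y3 + 1" "m = a + 1" "p = a" "r = a"
          "u = y1 \<or> u = y1 + 1" "q = y4 \<or> q = y4 - 1"
    proof (cases "y1 < y2 \<or> y3 + 1 < y4")
      case True
      then show thesis
      proof
        assume "y1 < y2"
        then show thesis using top \<open>y2 < y3\<close> by (intro t) auto
      next
        assume "y3 + 1 < y4"
        then show thesis using bottom \<open>y2 < y3\<close> by (intro b) auto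
      qed
    next
      case False
      then have e: "y2 = y1" "y4 = y3 + 1" "m = a + 1" using top bottom y by auto
      show thesis
      proof (cases "(p, q) \<in> {(a, y4), (a, y4 - 1)} \<or> (r, u) \<in> {(a, y4), (a, y4 - 1)}")
        case F: False
        then show thesis by (intro b) (use e n in auto)
      next
        case T: True
        show thesis
        proof (cases "(p, q) \<in> {(a, y1), (a, y1 + 1)} \<or> (r, u) \<in> {(a, y1), (a, y1 + 1)}")
          case False
          then show thesis by (intro t) (use e n in auto)
        next
          case True
          then show thesis
          proof
            assume 1: "(p, q) \<in> {(a, y1), (a, y1 + 1)}"
            then have "(r, u) \<in> {(a, y4), (a, y4 - 1)}" using T n by auto
            with 1 show thesis by (intro both) (use e in auto)
          next
            assume 1: "(r, u) \<in> {(a, y1), (a, y1 + 1)}"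
            then have "(p, q) \<in> {(a, y4), (a, y4 - 1)}" using T n by auto
            with 1 show thesis by (intro both') (use e in auto)
          qed
        qed
      qed
    qed
    then show ?thesis
    proof cases
      case b
      then show ?thesis
        by (intro hp_inner_half[OF a y(1) _ y(2) _ _ _ _ _ tc bc g ne1 ne2])
           (use \<open>y2 < y3\<close> \<open>1 \<le> p\<close> \<open>p \<le> a\<close> \<open>1 \<le> r\<close> \<open>r \<le> a\<close> in auto)
    next
      case t
      have "hp (cshape a m y1 (y1 + y4 - y3 - 1) (y1 + y4 - y2 - 1) y4) (p, y1 + y4 - q) (r, y1 + y4 - u)"
      proof (rule hp_inner_half[OF a])
        show "rgood 1 a y1 y4 p (y1 + y4 - q) r (y1 + y4 - u)" using g by (simp only: rgood_flipy)
        show "\<not> ends p (y1 + y4 - q) r (y1 + y4 - u) (a, y1) (a, y1 + 1)"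
          using ne3 by (simp add: ends_flip algebra_simps)
        show "\<not> ends p (y1 + y4 - q) r (y1 + y4 - u) (1, y1) (2, y1 + 1) \<and>
            \<not> ends p (y1 + y4 - q) r (y1 + y4 - u) (1, y1 + 1) (2, y1)" if "a = 2"
          using ne4[OF that] by (simp add: ends_flip algebra_simps)
        show "a + 2 \<le> m \<and> y1 < y1 + y4 - y3 - 1 \<or> m = a + 1 \<and> y1 + y4 - y3 - 1 \<le> y1 + 2"
          using bc by auto
        show "a + 2 \<le> m \<and> y1 + y4 - y2 - 1 + 1 < y4 \<or> m = a + 1 \<and> y4 \<le> y1 + y4 - y2 - 1 + 3"
          using tc by auto
      qed (use t y \<open>y2 < y3\<close> \<open>1 \<le> p\<close> \<open>p \<le> a\<close> \<open>1 \<le> r\<close> \<open>r \<le> a\<close> in auto)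
      then show ?thesis by (rule hp_cshape_flipy)
    next
      case both
      then show ?thesis using hp_between_tips[OF a(1) both(3) n, of p q r u] by auto
    next
      case both'
      then show ?thesis using hp_sym[OF hp_between_tips[OF a(1) both'(3) n, of r u p q]] by auto
    qed
  qed
  have low: "hp (cshape a m y1 y2 y3 y4) (p, q) (r, u)"
    if y1: "y1 \<le> y2" "y1 + 3 \<le> y4" "y1 \<le> q" "y1 \<le> u" and two: "a = 2 \<Longrightarrow> q = u \<Longrightarrow> q = y1 \<or> q = y4"
      and top: "y2 = y1 \<and> m = a + 1 \<or> y1 < y2 \<and> y2 < q \<and> y2 < u \<and> (a + 2 \<le> m \<or> y2 \<le> y1 + 2)"
      and ne1: "\<not> ends p q r u (a, y1) (a, y1 + 1)"
      and ne2: "a = 2 \<Longrightarrow> \<not> ends p q r u (1, y1) (2, y1 + 1) \<and> \<not> ends p q r u (1, y1 + 1) (2, y1)"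
    for y1
  proof (cases "m = a + 1 \<and> y3 + 4 \<le> y4")
    case True
    have "hp (cshape a m y1 y2 y3 (y3 + 2)) (p, q) (r, u)"
      by (rule small[OF y1(1) _ _ y1(3) _ y1(4) _ _ top _ ne1 ne2])
         (use True y1 y two bottom top in \<open>auto simp: ends_def\<close>)
    then show ?thesis by (rule absorb_bottom_rows) (use True y1 y a bottom in auto)
  next
    case False
    show ?thesis
      by (rule small[OF y1(1) y(3) y1(2,3) s(4) y1(4) t(4) two top _ ne1 ne2 ne3 ne4])
         (use False bottom a in auto)
  qed
  show ?thesis
  proof (cases "m = a + 1 \<and> y1 + 3 \<le> y2")
    case True
    have "hp (cshape a m (y2 - 1) y2 y3 y4) (p, q) (r, u)"
      by (rule low) (use True y two top in \<open>auto simp: ends_def\<close>)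
    then show ?thesis by (rule absorb_top_rows) (use True y a top in auto)
  next
    case False
    show ?thesis
      by (rule low[OF y(1) n s(3) t(3) two _ ne1 ne2]) (use False top a in auto)
  qed
qed

subsection \<open>Ends in the arms, and the three-row shape\<close>

text \<open>Generically the L-shape below is inserted into the lower left edge of the upper
  rectangle. In \<open>c1\<close> to \<open>c3\<close> this edge cannot be prescribed, and in
  \<open>c4\<close> the ends cut the two-row rectangle; there the path goes through the part below
  in between pieces of the rectangle.\<close>

lemma hp_both_in_top:
  assumes a: "2 \<le> a" "a < m" and y: "y1 < y2" "y2 < y3" "y3 < y4" and tip: "y4 = y3 + 1 \<Longrightarrow> m = a + 1"
    and s: "1 \<le> p" "p \<le> m" "y1 \<le> q" "q \<le> y2" and t: "1 \<le> r" "r \<le> m" "y1 \<le> u" "u \<le> y2"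
    and ne: "(p, q) \<noteq> (r, u)" and two: "y2 = y1 + 1 \<Longrightarrow> p = r \<Longrightarrow> p \<le> a \<or> p = m"
  shows "hp (cshape a m y1 y2 y3 y4) (p, q) (r, u)"
proof -
  let ?Q = "cshape a m (y2 + 1) y2 y3 y4"
  have S: "hp {z} z z" for z by (rule hp_singleton)
  have S2: "hp {z, z'} z z'" if "sg_adj z z'" for z z'
    unfolding hp_def ham_path_iff by (rule exI[of _ "[z, z']"]) (use that in \<open>auto simp: sg_adj_def\<close>)
  have S3: "hp {z, z', z''} z z''" if "sg_adj z z'" "sg_adj z' z''" "z \<noteq> z''" for z z' z''
    unfolding hp_def ham_path_iff by (rule exI[of _ "[z, z', z'']"]) (use that in \<open>auto simp: sg_adj_def\<close>)
  have Q: "hp ?Q (x, y2 + 1) (x + 1, y2 + 1)" if "1 \<le> x" "x < a" for x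
    using hp_foot_above[OF a y(3) tip, of x "y2 + 1" "y2 + 1" "x + 1" "y2 + 1"] that y by simp
  have R: "rhp 3 m y1 y2 3 y2 3 y1"
    by (rule rhp_rect) (use a y in \<open>auto simp: rgood_def\<close>)
  have Q12: "hp ?Q (1, y2 + 1) (2, y2 + 1)" using Q[of 1] a by simp
  have c1: "hp (cshape a m y1 y2 y3 y4) (1, y2) (2, y2)"
  proof -
    have T: "rhp 1 2 y1 (y2 - 1) 2 y1 1 (y2 - 1)"
      by (rule rhp_rect) (use y in \<open>auto simp: rgood_def\<close>)
    have "hp (rect 3 m y1 y2 \<union> (rect 1 2 y1 (y2 - 1) \<union> {(2, y2)})) (3, y2) (2, y2)"
      by (rule hp_append[OF R hp_append[OF T S _ _ refl] _ _ refl]) (use y in auto)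
    then show ?thesis by (rule hp_append3[OF S Q12]) (use a y in auto)
  qed
  have c2: "hp (cshape a m y1 y2 y3 y4) (1, y2) (2, y1)" if y2: "y2 = y1 + 1"
  proof -
    have "hp {(1, y2), (1, y1), (2, y2)} (1, y2) (2, y2)" by (rule S3) (use y2 in auto)
    then show ?thesis by (rule hp_append4[OF _ Q12 R S]) (use a y y2 in auto)
  qed
  have c3: "hp (cshape a m y1 y2 y3 y4) (1, y1) (2, y2)" if y2: "y2 = y1 + 1"
  proof -
    have "hp {(1, y1), (1, y2)} (1, y1) (1, y2)" "hp {(2, y1), (2, y2)} (2, y1) (2, y2)"
      by (rule S2; use y2 in simp)+
    then show ?thesis by (rule hp_append4[OF _ Q12 R]) (use a y y2 in auto)
  qed
  \<comment> \<open>Column \<open>x\<close> separates the upper rectangle; the part below leads from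
    its left to its right side.\<close>
  have c4: "hp (cshape a m y1 y2 y3 y4) (x, y1) (x, y2)" if y2: "y2 = y1 + 1" and x: "2 \<le> x" "x \<le> a" for x
  proof -
    have 1: "rhp 1 (x - 1) y1 y2 (x - 1) y1 (x - 1) y2"
      by (rule rhp_rect) (use x y2 in \<open>auto simp: rgood_def\<close>)
    have 2: "rhp (x + 1) m y1 y2 (x + 1) y2 (x + 1) y1"
      by (rule rhp_rect) (use x y2 a in \<open>auto simp: rgood_def\<close>)
    have A: "hp ({(x, y1)} \<union> rect 1 (x - 1) y1 y2) (x, y1) (x - 1, y2)"
      by (rule hp_append[OF S 1 _ _ refl]) auto
    have B: "hp (rect (x + 1) m y1 y2 \<union> {(x, y2)}) (x + 1, y2) (x, y2)"
      by (rule hp_append[OF 2 S _ _ refl]) (use y2 in auto)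
    have "hp ?Q (x - 1, y2 + 1) (x, y2 + 1)" using Q[of "x - 1"] x by simp
    then show ?thesis by (rule hp_append3[OF A _ B]) (use x a y y2 in auto)
  qed
  consider "ends p q r u (1, y2) (2, y2)" | "y2 = y1 + 1" "ends p q r u (1, y2) (2, y1)"
    | "y2 = y1 + 1" "ends p q r u (1, y1) (2, y2)" | "y2 = y1 + 1" "p = r" "2 \<le> p" "p \<le> a" 
    | (main) "\<not> ends p q r u (1, y2) (1 + 1, y2)" "y2 = y1 + 1 \<longrightarrow> \<not> ends p q r u (1, y1) (1 + 1, y2) \<and> \<not> ends p q r u (1 + 1, y1) (1, y2)"
        "y2 = y1 + 1 \<longrightarrow> p = r \<longrightarrow> p = 1 \<or> p = m"
  proof -
    have e: "ends p q r u v w \<longleftrightarrow> ends p q r u w v" for v w unfolding ends_def by blast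
    show thesis
    proof (cases "y2 = y1 + 1")
      case True
      have "p = r \<longrightarrow> p = 1 \<or> p = m \<or> 2 \<le> p \<and> p \<le> a" using two[OF True] s by linarith
      then show thesis using that True e[of "(1, y2)" "(2, y1)"] by (cases "p = r"; simp; metis)
    next
      case False
      then show thesis using that by auto
    qed
  qed
  then show ?thesis
  proof cases
    case 1
    then show ?thesis using c1 hp_sym[OF c1] by (auto simp: ends_def)
  next
    case 2
    then show ?thesis using c2 hp_sym[OF c2] by (auto simp: ends_def)
  next
    case 3
    then show ?thesis using c3 hp_sym[OF c3] by (auto simp: ends_def)
  next
    case 4
    then have "q = y1 \<and> u = y2 \<or> q = y2 \<and> u = y1" using s t ne by auto
    then show ?thesis using c4[OF 4(1,3,4)] hp_sym[OF c4[OF 4(1,3,4)]] 4(2) by auto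
  next
    case main
    have "hpe (rect 1 m y1 y2) (p, q) (r, u) (1, y2) (1 + 1, y2)"
    proof (rule rect_edge_bottom_left_horizontal)
      show "rgood 1 m y1 y2 p q r u" unfolding rgood_def using a y s t ne main by auto
    qed (use a y main in auto)
    then show ?thesis by (rule hpe_insert[OF _ Q12]) (use a y in auto)
  qed
qed

text \<open>On either side of the cut, one of the columns 1 and 2 is free of the given end, and any
  two such columns are within reach of each other.\<close>

lemma hp_top_to_middle:
  assumes a: "2 \<le> a" "a < m" and y: "y1 < y2" "y2 < y3" "y3 < y4" and tip: "y4 = y3 + 1 \<Longrightarrow> m = a + 1"
    and s: "1 \<le> p" "p \<le> m" "y1 \<le> q" "q \<le> y2" and t: "1 \<le> r" "r \<le> a" "y2 < u" "u \<le> y3"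
  shows "hp (cshape a m y1 y2 y3 y4) (p, q) (r, u)"
proof -
  define x where "x = (if p = 1 then 2 else 1 :: int)"
  define x' where "x' = (if r = 1 then 2 else 1 :: int)"
  have x: "x \<noteq> p" "x' \<noteq> r" "x = 1 \<or> x = 2" "x' = 1 \<or> x' = 2" by (auto simp: x_def x'_def)
  have 1: "rhp 1 m y1 y2 p q x y2"
    by (rule rhp_rect) (use x(1,3) s a y in \<open>auto simp: rgood_def\<close>)
  have 2: "hp (cshape a m (y2 + 1) y2 y3 y4) (x', y2 + 1) (r, u)"
    using hp_foot_above[OF a y(3) tip, of x' "y2 + 1" "y2 + 1" r u] x t a y by auto
  show ?thesis by (rule hp_append[OF 1 2]) (use x(3,4) y a in auto)
qed

lemma hp_top_to_bottom:
  assumes a: "2 \<le> a" "a < m" and y: "y1 < y2" "y2 < y3" "y3 < y4"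
    and s: "1 \<le> p" "p \<le> m" "y1 \<le> q" "q \<le> y2" and t: "1 \<le> r" "r \<le> m" "y3 < u" "u \<le> y4"
    and tip: "y4 = y3 + 1 \<Longrightarrow> r = m \<or> m = a + 1"
  shows "hp (cshape a m y1 y2 y3 y4) (p, q) (r, u)"
proof -
  have exit: "rhp 1 m y1 y2 p q x y2" if "x \<noteq> p" "1 \<le> x" "x \<le> m" for x
    by (rule rhp_rect) (use that s a y in \<open>auto simp: rgood_def\<close>)
  define x where "x = (if p = 1 then 2 else 1 :: int)"
  have x: "x \<noteq> p" "x = 1 \<or> x = 2" by (auto simp: x_def)
  have E: "rhp 1 m y1 y2 p q x y2" by (rule exit) (use x a in auto)
  have M: "rhp 1 a (y2 + 1) y3 1 (y2 + 1) a y3"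
    by (rule rhp_rect) (use a y in \<open>auto simp: rgood_def\<close>)
  \<comment> \<open>A last part of one row is run from end to end, unless its end is strictly inside
    (\<open>mid\<close>); then its one-cell arm is inserted into the lower narrow rectangle.\<close>
  consider (d2) "y3 + 2 \<le> y4" | (corner) "y4 = y3 + 1" "r = m" | (left) "y4 = y3 + 1" "r = 1" "m = a + 1"
    | (mid) "y4 = y3 + 1" "m = a + 1" "2 \<le> r" "r \<le> a"
    using y tip t by (smt (verit))
  then show ?thesis
  proof cases
    case d2
    define x' where "x' = (if r = a then a + 1 else a)"
    have x': "x' \<noteq> r" "x' = a \<or> x' = a + 1" by (auto simp: x'_def)
    have B: "rhp 1 m (y3 + 1) y4 x' (y3 + 1) r u"
      by (rule rhp_rect) (use x' t a d2 in \<open>auto simp: rgood_def\<close>)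
    show ?thesis by (rule hp_append3[OF E M B]) (use x(2) x'(2) y a in auto)
  next
    case corner
    define x' where "x' = (if p = a then a + 1 else a)"
    have x': "x' \<noteq> p" "x' = a \<or> x' = a + 1" by (auto simp: x'_def)
    have E: "rhp 1 m y1 y2 p q x' y2" by (rule exit) (use x' a in auto)
    have M: "rhp 1 a (y2 + 1) y3 a (y2 + 1) 1 y3"
      by (rule rhp_rect) (use a y in \<open>auto simp: rgood_def\<close>)
    have B: "rhp 1 m (y3 + 1) y4 1 (y3 + 1) r u"
      by (rule rhp_rect) (use t a corner in \<open>auto simp: rgood_def\<close>)
    show ?thesis by (rule hp_append3[OF E M B]) (use x'(2) y a in auto)
  next
    case left
    have B: "rhp 1 m (y3 + 1) y4 m (y3 + 1) r u"
      by (rule rhp_rect) (use t a left in \<open>auto simp: rgood_def\<close>)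
    show ?thesis by (rule hp_append3[OF E M B]) (use x(2) y a left in auto)
  next
    case mid
    have "hpe (rect 1 a (y2 + 1) y4) (1, y2 + 1) (r, u) (a, y4) (a, y4 - 1)"
      by (rule rect_edge_bottom_right) (use mid a y t in \<open>auto simp: rgood_def ends_def\<close>)
    then have "hp (cshape a m (y2 + 1) y2 y3 y4) (1, y2 + 1) (r, u)"
      by (rule attach_bottom_arm[OF _ a(2) y(3)]) (use mid a y in auto)
    then show ?thesis by (rule hp_append[OF E]) (use x(2) y a in auto)
  qed
qed

text \<open>A one-row arm with an end at its tip is run inwards, which leaves an L-shape. If the
  other end is the tip of a one-row lower arm, that arm is run outwards last.\<close>

lemma hp_from_top_tip:
  assumes a: "2 \<le> a" "a < m" and y: "y1 < y3" "y3 < y4"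
    and t: "1 \<le> r" "y1 \<le> u"
    and tc: "r \<le> a \<and> u \<le> y3 \<and> (y4 = y3 + 1 \<longrightarrow> m = a + 1) \<or>
      y4 = y3 + 1 \<and> u = y4 \<and> (r = m \<or> r \<le> a \<and> m = a + 1)"
  shows "hp (cshape a m y1 y1 y3 y4) (m, y1) (r, u)"
proof -
  have T: "rhp (a + 1) m y1 y1 m y1 (a + 1) y1"
    by (rule rhp_rect) (use a in \<open>auto simp: rgood_def\<close>)
  consider (foot) "r \<le> a" "u \<le> y3" "y4 = y3 + 1 \<longrightarrow> m = a + 1"
    | (tip) "y4 = y3 + 1" "u = y4" "r = m" | (row) "y4 = y3 + 1" "u = y4" "r \<le> a" "m = a + 1"
    using tc by blast
  then show ?thesis
  proof cases
    case foot
    \<comment> \<open>Column \<open>a\<close> is entered at the top, unless that vertex is the other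
      end.\<close>
    define j where "j = (if (r, u) = (a, y1) then y1 + 1 else y1)"
    have j: "(a, j) \<noteq> (r, u)" "j = y1 \<or> j = y1 + 1" "a = 2 \<Longrightarrow> j = u \<Longrightarrow> j = y1"
      by (auto simp: j_def split: if_splits)
    have "hp (cshape a m y1 (y1 - 1) y3 y4) (a, j) (r, u)"
      by (rule hp_foot_above) (use a y foot t j in auto)
    then show ?thesis by (rule hp_append[OF T]) (use j(2) a y in auto)
  next
    case tip
    have 1: "rhp 1 a y1 y4 a y1 a y4"
      by (rule rhp_rect) (use a y in \<open>auto simp: rgood_def\<close>)
    have 2: "rhp (a + 1) m y4 y4 (a + 1) y4 r u"
      by (rule rhp_rect) (use a tip in \<open>auto simp: rgood_def\<close>)
    show ?thesis by (rule hp_append3[OF T 1 2]) (use a y tip in auto)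
  next
    case row
    have "hpe (rect 1 a y1 y4) (a, y1) (r, u) (a, y4) (a, y4 - 1)"
      by (rule rect_edge_bottom_right) (use row a y t in \<open>auto simp: rgood_def ends_def\<close>)
    then have "hp (cshape a m y1 (y1 - 1) y3 y4) (a, y1) (r, u)"
      by (rule attach_bottom_arm[OF _ a(2) y(2)]) (use row a y in auto)
    then show ?thesis by (rule hp_append[OF T]) (use a y in auto)
  qed
qed

text \<open>The last two columns form a path \<open>(a, y), (a+1, y), (a, y+1), (a+1, y+2), (a, y+2)\<close>, which is
  joined to, or inserted into, a path of the rectangle of the first \<open>a - 1\<close> columns.\<close>

lemma hp_three_rows:
  assumes a: "2 \<le> a" and s: "1 \<le> p" "p \<le> a" "y \<le> q" "q \<le> y + 2" and t: "1 \<le> r" "r \<le> a" "y \<le> u" "u \<le> y + 2"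
    and ne: "(p, q) \<noteq> (r, u)" and mid: "(p, q) \<noteq> (a, y + 1)" "(r, u) \<noteq> (a, y + 1)"
    and cut: "\<not> ends p q r u (a, y) (a, y + 2)"
    and two: "a = 2 \<Longrightarrow> \<not> ends p q r u (1, y + 1) (2, y) \<and> \<not> ends p q r u (1, y + 1) (2, y + 2) \<and>
       \<not> ends p q r u (1, y) (2, y + 2) \<and> \<not> ends p q r u (1, y + 2) (2, y)"
  shows "hp (cshape a (a + 1) y y (y + 1) (y + 2)) (p, q) (r, u)"
proof -
  let ?V = "cshape a (a + 1) y y (y + 1) (y + 2)"
  let ?B = "{(a, y), (a + 1, y), (a, y + 1), (a + 1, y + 2), (a, y + 2)}"
  have B: "hp ?B (a, y) (a, y + 2)"
    unfolding hp_def ham_path_iff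
    by (rule exI[of _ "[(a, y), (a + 1, y), (a, y + 1), (a + 1, y + 2), (a, y + 2)]"]) auto
  have three: "y \<le> j \<and> j \<le> y + 2 \<longleftrightarrow> j = y \<or> j = y + 1 \<or> j = y + 2" for j by arith
  have V: "?V = rect 1 (a - 1) y (y + 2) \<union> ?B"
  proof -
    have "(i, j) \<in> ?V \<longleftrightarrow> (i, j) \<in> rect 1 (a - 1) y (y + 2) \<union> ?B" for i j
    proof -
      consider "i < a" | "i = a" | "i = a + 1" | "a + 1 < i" by linarith
      then show ?thesis
      proof cases
        case 3
        then show ?thesis using a three[of j] by auto
      qed (use a three[of j] in auto)
    qed
    then show ?thesis unfolding set_eq_iff split_paired_All by blast
  qed
  have disj: "rect 1 (a - 1) y (y + 2) \<inter> ?B = {}" by auto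
  have S: "hp {z} z z" for z by (rule hp_singleton)
  have end_at_a: "hp ?V (r, u) (a, y)"
    if "1 \<le> r" "r < a" "y \<le> u" "u \<le> y + 2" "a = 2 \<Longrightarrow> u = y" for r u
  proof -
    \<comment> \<open>\<open>(a - 1, j)\<close> must be adjacent to \<open>(a, y + 2)\<close> and
      lie in a row other than \<open>u\<close>.\<close>
    define j where "j = (if u = y + 2 then y + 1 else y + 2)"
    have "rhp 1 (a - 1) y (y + 2) r u (a - 1) j"
    proof (rule rhp_rect)
      show "rgood 1 (a - 1) y (y + 2) r u (a - 1) j"
        unfolding rgood_def j_def using that by auto
    qed
    then show ?thesis by (rule hp_append[OF _ hp_sym[OF B]]) (use disj V in \<open>auto simp: j_def\<close>)
  qed
  have end_at_a': "hp ?V (r, u) (a, y + 2)"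
    if "1 \<le> r" "r < a" "y \<le> u" "u \<le> y + 2" "a = 2 \<Longrightarrow> u = y + 2" for r u
    by (rule hp_cshape_flipy) (use end_at_a[of r "2 * y + 2 - u"] that in \<open>simp add: algebra_simps\<close>)
  have inner: "hp ?V (p, q) (r, u)" if pr: "p < a" "r < a"
  proof -
    consider (w2) "a = 2" | (bad) "a = 3" "q = y + 1" "u = y + 1" "p \<noteq> r"
      | (g) "3 \<le> a" "rgood 1 (a - 1) y (y + 2) p q r u"
    proof (cases "a = 2 \<or> rgood 1 (a - 1) y (y + 2) p q r u")
      case True
      then show thesis using a w2 g by (cases "a = 2") auto
    next
      case False
      then have "a = 3 \<and> q = y + 1 \<and> u = y + 1 \<and> p \<noteq> r"
        unfolding rgood_def using a pr s t ne by (smt (verit))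
      then show thesis using bad by blast
    qed
    then show ?thesis
    proof cases
      case w2
      have "rect 1 (a - 1) y (y + 2) = {(1, y)} \<union> rect 1 1 (y + 1) (y + 2)" using w2 by auto
      then have V1: "?V = {(1, y)} \<union> ?B \<union> rect 1 1 (y + 1) (y + 2)" unfolding V by blast
      have B1: "{(1, y)} \<inter> ?B = {}" "{(1, y)} \<inter> rect 1 1 (y + 1) (y + 2) = {}"
        "?B \<inter> rect 1 1 (y + 1) (y + 2) = {}"
        using w2 by auto
      have 12: "hp ?V (1, y) (1, y + 1)"
      proof -
        have R: "rhp 1 1 (y + 1) (y + 2) 1 (y + 2) 1 (y + 1)"
          by (rule rhp_rect) (auto simp: rgood_def)
        show ?thesis by (rule hp_append3[OF S B R _ _ B1 V1]) (use w2 in auto)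
      qed
      have 23: "hp ?V (1, y + 2) (1, y + 1)"
        by (rule hp_cshape_flipy) (use 12 in \<open>simp add: algebra_simps\<close>)
      have 13: "hp ?V (1, y) (1, y + 2)"
      proof -
        have R: "rhp 1 1 (y + 1) (y + 2) 1 (y + 1) 1 (y + 2)"
          by (rule rhp_rect) (auto simp: rgood_def)
        show ?thesis by (rule hp_append3[OF S B R _ _ B1 V1]) (use w2 in auto)
      qed
      have "p = 1" "r = 1" "q \<noteq> u" using w2 pr s t ne by auto
      moreover have "q = y \<or> q = y + 1 \<or> q = y + 2" "u = y \<or> u = y + 1 \<or> u = y + 2" using s t by auto
      ultimately show ?thesis using 12 13 23 hp_sym[OF 12] hp_sym[OF 13] hp_sym[OF 23] by fastforce
    next
      \<comment> \<open>The ends form the middle row of two columns; the five-vertex path links the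
        hook above them to the hook below.\<close>
      case bad
      have A: "hp {(1, y + 1), (1, y), (2, y)} (1, y + 1) (2, y)"
        unfolding hp_def ham_path_iff by (rule exI[of _ "[(1, y + 1), (1, y), (2, y)]"]) auto
      have C: "hp {(2, y + 2), (1, y + 2), (2, y + 1)} (2, y + 2) (2, y + 1)"
        unfolding hp_def ham_path_iff by (rule exI[of _ "[(2, y + 2), (1, y + 2), (2, y + 1)]"]) auto
      have R: "rect 1 (a - 1) y (y + 2) = {(1, y + 1), (1, y), (2, y)} \<union> {(2, y + 2), (1, y + 2), (2, y + 1)}"
      proof -
        have "1 \<le> i \<and> i \<le> 2 \<longleftrightarrow> i = 1 \<or> i = 2" for i :: int by arith
        then have "rect 1 2 y (y + 2) = (\<Union>i\<in>{1, 2}. Pair i ` {y, y + 1, y + 2})"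
          unfolding rect_def using three by blast
        then show ?thesis using bad(1) by (simp, blast)
      qed
      have "hp ?V (1, y + 1) (2, y + 1)"
      proof (rule hp_append3[OF A B C])
        show "?V = {(1, y + 1), (1, y), (2, y)} \<union> ?B \<union> {(2, y + 2), (1, y + 2), (2, y + 1)}"
          unfolding V R by blast
        show "{(1, y + 1), (1, y), (2, y)} \<inter> ?B = {}" "?B \<inter> {(2, y + 2), (1, y + 2), (2, y + 1)} = {}"
          using disj unfolding R by blast+
      qed (simp_all add: bad(1))
      moreover have "p = 1 \<and> r = 2 \<or> p = 2 \<and> r = 1" using bad pr s t by auto
      ultimately show ?thesis using bad(2,3) hp_sym by blast
    next
      case g
      show ?thesis
      proof (cases "ends p q r u (a - 1, y) (a - 1, y + 1) \<or>
           a = 3 \<and> (ends p q r u (1, y) (2, y + 1) \<or> ends p q r u (1, y + 1) (2, y))")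
        case False
        have e: "hpe (rect 1 (a - 1) y (y + 2)) (p, q) (r, u) (a - 1, y) (a - 1, y + 1)"
          by (rule rect_edge_top_right[OF g(2)]) (use False g(1) in auto)
        show ?thesis by (rule hpe_insert[OF e B disj _ _ V]) auto
      next
        case True
        then have "q = y \<or> u = y" unfolding ends_def by blast
        \<comment> \<open>The pairs that would block the lower edge lie entirely in rows
          \<open>y + 1\<close> and \<open>y + 2\<close>.\<close>
        then have n: "\<not> ends p q r u (i, j) (i', j')" if "y < j" "y < j'" for i j i' j'
          using that by (auto simp: ends_def)
        have e: "hpe (rect 1 (a - 1) y (y + 2)) (p, q) (r, u) (a - 1, y + 2) (a - 1, y + 2 - 1)"
          by (rule rect_edge_bottom_right[OF g(2)]) (use n g(1) in auto)
        show ?thesis by (rule hpe_insert[OF e hp_sym[OF B] disj _ _ V]) auto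
      qed
    qed
  qed
  have q3: "q = y \<or> q = y + 1 \<or> q = y + 2" "u = y \<or> u = y + 1 \<or> u = y + 2" using s t by auto
  consider "p < a" "r < a" | "p = a" "r = a" | (pa) "p = a" "r < a" | (ra) "p < a" "r = a"
    using s t by linarith
  then show ?thesis
  proof cases
    case 1
    then show ?thesis by (rule inner)
  next
    case 2
    then have False using q3 ne mid cut by (auto simp: ends_def)
    then show ?thesis ..
  next
    case pa
    have u: "a = 2 \<Longrightarrow> r = 1 \<and> u = q" using pa two mid q3 t by (auto simp: ends_def)
    show ?thesis
    proof (cases "q = y")
      case True
      then show ?thesis using pa t u hp_sym[OF end_at_a[of r u]] by auto
    next
      case False
      then have "q = y + 2" using q3 mid pa by auto
      then show ?thesis using pa t u hp_sym[OF end_at_a'[of r u]] by auto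
    qed
  next
    case ra
    have u: "a = 2 \<Longrightarrow> p = 1 \<and> q = u" using ra two mid q3 s by (auto simp: ends_def)
    show ?thesis
    proof (cases "u = y")
      case True
      then show ?thesis using ra s u end_at_a[of p q] by auto
    next
      case False
      then have "u = y + 2" using q3 mid ra by auto
      then show ?thesis using ra s u end_at_a'[of p q] by auto
    qed
  qed
qed

subsection \<open>Sufficiency\<close>

text \<open>The negations of (F1), (F3) and (F7) at the upper arm, with the cut sets of (F1) made explicit.
  The lower arm is treated by reflecting the rows; \<open>cgood\<close> adds the cuts inside the narrow part and (F8).\<close>

definition top_ok :: "int \<Rightarrow> int \<Rightarrow> int \<Rightarrow> int \<Rightarrow> int \<Rightarrow> int \<Rightarrow> int \<Rightarrow> int \<Rightarrow> bool" where
  "top_ok a m y1 y2 p q r u \<longleftrightarrow>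
     (y2 = y1 \<longrightarrow>
        \<not> (q = y1 \<and> a < p \<and> p < m) \<and> \<not> (u = y1 \<and> a < r \<and> r < m) \<and>
        \<not> ends p q r u (a, y1) (a, y1 + 1) \<and>
        (a + 1 < m \<longrightarrow> p = m \<and> q = y1 \<or> r = m \<and> u = y1) \<and>
        (a = 2 \<and> m = 3 \<longrightarrow> \<not> ends p q r u (1, y1) (2, y1 + 1) \<and> \<not> ends p q r u (1, y1 + 1) (2, y1))) \<and>
     (y2 = y1 + 1 \<and> p = r \<and> a < p \<and> p < m \<longrightarrow> y2 < q \<or> y2 < u)"

definition cgood :: "int \<Rightarrow> int \<Rightarrow> int \<Rightarrow> int \<Rightarrow> int \<Rightarrow> int \<Rightarrow> int \<Rightarrow> int \<Rightarrow> int \<Rightarrow> int \<Rightarrow> bool" where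
  "cgood a m y1 y2 y3 y4 p q r u \<longleftrightarrow>
     (p, q) \<in> cshape a m y1 y2 y3 y4 \<and> (r, u) \<in> cshape a m y1 y2 y3 y4 \<and> (p, q) \<noteq> (r, u) \<and>
     top_ok a m y1 y2 p q r u \<and> top_ok a m y1 (y1 + y4 - y3 - 1) p (y1 + y4 - q) r (y1 + y4 - u) \<and>
     \<not> (a = 2 \<and> q = u \<and> y2 < q \<and> q \<le> y3) \<and>
     (y4 = y1 + 2 \<and> m = a + 1 \<longrightarrow>
        \<not> ends p q r u (a, y1) (a, y4) \<and>
        (a = 2 \<longrightarrow> \<not> ends p q r u (1, y1) (2, y4) \<and> \<not> ends p q r u (1, y4) (2, y1)) \<and>
        (2 < a \<longrightarrow> \<not> (r = a \<and> u = y1 + 1 \<and> p < a) \<and> \<not> (p = a \<and> q = y1 + 1 \<and> r < a)))"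

lemma ends_sym: "ends r u p q v w \<longleftrightarrow> ends p q r u v w"
  unfolding ends_def by blast

lemma top_ok_sym: "top_ok a m y1 y2 r u p q \<longleftrightarrow> top_ok a m y1 y2 p q r u"
  unfolding top_ok_def ends_sym[of r u p q] by blast

lemma cgood_sym: "cgood a m y1 y2 y3 y4 p q r u \<Longrightarrow> cgood a m y1 y2 y3 y4 r u p q"
  unfolding cgood_def ends_sym[of r u p q] top_ok_sym[of _ _ _ _ r _ p _] by blast

text \<open>The second \<open>top_ok\<close> clause is the first one for the reflected shape, so
  reflection exchanges the two; in the three-row clauses it exchanges \<open>y1\<close> and
  \<open>y4\<close>.\<close>

lemma cgood_flip:
  assumes "cgood a m y1 y2 y3 y4 p q r u"
  shows "cgood a m y1 (y1 + y4 - y3 - 1) (y1 + y4 - y2 - 1) y4 p (y1 + y4 - q) r (y1 + y4 - u)"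
proof -
  have 1: "(i, y1 + y4 - j) \<in> cshape a m y1 (y1 + y4 - y3 - 1) (y1 + y4 - y2 - 1) y4"
    if "(i, j) \<in> cshape a m y1 y2 y3 y4" for i j
    using that by simp linarith
  have 2: "top_ok a m y1 (y1 + y4 - (y1 + y4 - y2 - 1) - 1) p (y1 + y4 - (y1 + y4 - q)) r (y1 + y4 - (y1 + y4 - u))"
    using assms unfolding cgood_def by simp
  have 3: "ends p (y1 + y4 - q) r (y1 + y4 - u) (i, j) (i', j') \<longleftrightarrow>
      ends p q r u (i, y1 + y4 - j) (i', y1 + y4 - j')" for i j i' j'
    by (rule ends_flip)
  have 4: "ends p q r u v w \<longleftrightarrow> ends p q r u w v" for v w unfolding ends_def by blast
  have 5: "y1 + y4 - y1 = y4" "y1 + y4 - y4 = y1" by simp_all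
  show ?thesis
    unfolding cgood_def 3 5
  proof (intro conjI)
    show "y4 = y1 + 2 \<and> m = a + 1 \<longrightarrow>
        \<not> ends p q r u (a, y4) (a, y1) \<and>
        (a = 2 \<longrightarrow> \<not> ends p q r u (1, y4) (2, y1) \<and> \<not> ends p q r u (1, y1) (2, y4)) \<and>
        (2 < a \<longrightarrow> \<not> (r = a \<and> y1 + y4 - u = y1 + 1 \<and> p < a) \<and> \<not> (p = a \<and> y1 + y4 - q = y1 + 1 \<and> r < a))"
    proof
      assume *: "y4 = y1 + 2 \<and> m = a + 1"
      then have "y1 + y4 - u = y1 + 1 \<longleftrightarrow> u = y1 + 1" "y1 + y4 - q = y1 + 1 \<longleftrightarrow> q = y1 + 1" by auto
      moreover have "ends p q r u (a, y4) (a, y1) \<longleftrightarrow> ends p q r u (a, y1) (a, y4)" by (rule 4)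
      ultimately show "\<not> ends p q r u (a, y4) (a, y1) \<and>
        (a = 2 \<longrightarrow> \<not> ends p q r u (1, y4) (2, y1) \<and> \<not> ends p q r u (1, y1) (2, y4)) \<and>
        (2 < a \<longrightarrow> \<not> (r = a \<and> y1 + y4 - u = y1 + 1 \<and> p < a) \<and> \<not> (p = a \<and> y1 + y4 - q = y1 + 1 \<and> r < a))"
        using assms * unfolding cgood_def by simp
    qed
    show "(p, y1 + y4 - q) \<noteq> (r, y1 + y4 - u)" using assms unfolding cgood_def by simp
    show "\<not> (a = 2 \<and> y1 + y4 - q = y1 + y4 - u \<and> y1 + y4 - y3 - 1 < y1 + y4 - q \<and> y1 + y4 - q \<le> y1 + y4 - y2 - 1)"
    proof -
      have "\<not> (a = 2 \<and> q = u \<and> y2 < q \<and> q \<le> y3)" using assms unfolding cgood_def by blast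
      then show ?thesis by linarith
    qed
    show "(p, y1 + y4 - q) \<in> cshape a m y1 (y1 + y4 - y3 - 1) (y1 + y4 - y2 - 1) y4"
      "(r, y1 + y4 - u) \<in> cshape a m y1 (y1 + y4 - y3 - 1) (y1 + y4 - y2 - 1) y4"
      using assms unfolding cgood_def by (intro 1; blast)+
    show "top_ok a m y1 (y1 + y4 - y3 - 1) p (y1 + y4 - q) r (y1 + y4 - u)"
      using assms unfolding cgood_def by blast
  qed (rule 2)
qed

text \<open>The last conjunct of \<open>st\<close> sets aside a start at a tip with the other end in
  a lower part of several rows: swapped and reflected, this is an instance of the first
  alternative.\<close>

lemma hp_start_in_top:
  assumes g: "cgood a m y1 y2 y3 y4 p q r u" and a: "2 \<le> a" "a < m" and y: "y1 \<le> y2" "y2 < y3" "y3 < y4"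
    and st: "y1 < y2 \<and> q \<le> y2 \<or> y2 = y1 \<and> p = m \<and> q = y1 \<and> \<not> (y3 + 1 < y4 \<and> y3 < u)"
  shows "hp (cshape a m y1 y2 y3 y4) (p, q) (r, u)"
proof -
  have s: "1 \<le> p" "p \<le> m" "y1 \<le> q" "q \<le> y4" and t: "1 \<le> r" "r \<le> m" "y1 \<le> u" "u \<le> y4"
    and tm: "r \<le> a \<or> u \<le> y2 \<or> y3 < u" and ne: "(p, q) \<noteq> (r, u)"
    and top: "top_ok a m y1 y2 p q r u"
    and bottom: "top_ok a m y1 (y1 + y4 - y3 - 1) p (y1 + y4 - q) r (y1 + y4 - u)"
    using g unfolding cgood_def by simp_all
  have q: "q \<le> y2" using st y by auto
  \<comment> \<open>A lower arm of one row and several cells has an end at its tip, and by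
    \<open>q\<close> this can only be the second end.\<close>
  have tip: "m = a + 1 \<or> r = m \<and> u = y4" if "y4 = y3 + 1"
    using bottom that q y a unfolding top_ok_def by auto
  have tip': "\<not> (u = y4 \<and> a < r \<and> r < m)" if "y4 = y3 + 1"
    using bottom that unfolding top_ok_def by auto
  show ?thesis
  proof (cases "y1 < y2")
    case True
    consider "u \<le> y2" | "y2 < u" "u \<le> y3" | "y3 < u" by linarith
    then show ?thesis
    proof cases
      case 1
      have two: "p \<le> a \<or> p = m" if "y2 = y1 + 1" "p = r"
        using top that 1 q s(2) unfolding top_ok_def by auto
      show ?thesis
        by (rule hp_both_in_top) (use a y True s t q 1 tip two ne in auto)
    next
      case 2
      show ?thesis
        by (rule hp_top_to_middle) (use a y True s t q 2 tip tm in auto)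
    next
      case 3
      show ?thesis
        by (rule hp_top_to_bottom) (use a y True s t q 3 tip in auto)
    qed
  next
    case False
    then have e: "y2 = y1" "p = m" "q = y1" "\<not> (y3 + 1 < y4 \<and> y3 < u)" using st by auto
    have "\<not> (u = y1 \<and> a < r \<and> r < m)" using top e(1) unfolding top_ok_def by blast
    then have r: "u \<le> y3 \<Longrightarrow> r \<le> a" using tm e ne t y by auto
    have "hp (cshape a m y1 y1 y3 y4) (m, y1) (r, u)"
    proof (rule hp_from_top_tip)
      show "r \<le> a \<and> u \<le> y3 \<and> (y4 = y3 + 1 \<longrightarrow> m = a + 1) \<or>
        y4 = y3 + 1 \<and> u = y4 \<and> (r = m \<or> r \<le> a \<and> m = a + 1)"
      proof (cases "u \<le> y3")
        case True
        then show ?thesis using r tip y by auto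
      next
        case False
        then have "y4 = y3 + 1" "u = y4" using e(4) y t by auto
        then show ?thesis using tip tip' t by auto
      qed
    qed (use a y e t in auto)
    then show ?thesis using e by simp
  qed
qed

text \<open>\<open>hp_start_in_top\<close> is available for either end and in either orientation. If
  none of the four versions applies, both ends lie in columns \<open>1\<close> to \<open>a\<close>,
  and every one-row arm is a single cell.\<close>

lemma hp_cshape:
  assumes g: "cgood a m y1 y2 y3 y4 p q r u" and a: "2 \<le> a" "a < m" and y: "y1 \<le> y2" "y2 < y3" "y3 < y4"
  shows "hp (cshape a m y1 y2 y3 y4) (p, q) (r, u)"
proof -
  let ?p = "\<lambda>m y1 y2 y3 y4 p q u. y1 < y2 \<and> q \<le> y2 \<or> y2 = y1 \<and> p = m \<and> q = y1 \<and> \<not> (y3 + 1 < y4 \<and> y3 < u)"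
  have s: "1 \<le> p" "p \<le> m" "y1 \<le> q" "q \<le> y4" "p \<le> a \<or> q \<le> y2 \<or> y3 < q"
    and t: "1 \<le> r" "r \<le> m" "y1 \<le> u" "u \<le> y4" "r \<le> a \<or> u \<le> y2 \<or> y3 < u" and ne: "(p, q) \<noteq> (r, u)"
    and top: "top_ok a m y1 y2 p q r u"
    and bottom: "top_ok a m y1 (y1 + y4 - y3 - 1) p (y1 + y4 - q) r (y1 + y4 - u)"
    using g unfolding cgood_def by simp_all
  have fy: "y1 \<le> y1 + y4 - y3 - 1" "y1 + y4 - y3 - 1 < y1 + y4 - y2 - 1" "y1 + y4 - y2 - 1 < y4"
    using y by linarith+
  show ?thesis
  proof (cases "?p m y1 y2 y3 y4 p q u")
    case True
    then show ?thesis by (rule hp_start_in_top[OF g a y])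
  next
    case n1: False
    show ?thesis
    proof (cases "?p m y1 y2 y3 y4 r u q")
      case True
      then show ?thesis by (rule hp_sym[OF hp_start_in_top[OF cgood_sym[OF g] a y]])
    next
      case n2: False
      show ?thesis
      proof (cases "?p m y1 (y1 + y4 - y3 - 1) (y1 + y4 - y2 - 1) y4 p (y1 + y4 - q) (y1 + y4 - u)")
        case True
        then show ?thesis by - (rule hp_cshape_flipy, rule hp_start_in_top[OF cgood_flip[OF g] a fy])
      next
        case n3: False
        show ?thesis
        proof (cases "?p m y1 (y1 + y4 - y3 - 1) (y1 + y4 - y2 - 1) y4 r (y1 + y4 - u) (y1 + y4 - q)")
          case True
          then show ?thesis
            by - (rule hp_sym, rule hp_cshape_flipy, rule hp_start_in_top[OF cgood_flip[OF cgood_sym[OF g]] a fy])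
        next
          case n4: False
          have n1': "\<not> (y1 < y2 \<and> q \<le> y2)" "\<not> (y1 < y2 \<and> u \<le> y2)" using n1 n2 by blast+
          have n3': "\<not> (y3 + 1 < y4 \<and> y3 < q)" "\<not> (y3 + 1 < y4 \<and> y3 < u)" using n3 n4 by auto
          have tipn: "\<not> (p = m \<and> q = y1)" "\<not> (r = m \<and> u = y1)" if "y2 = y1"
            using n1 n2 n3' that by blast+
          have tipn': "\<not> (p = m \<and> q = y4)" "\<not> (r = m \<and> u = y4)" if "y4 = y3 + 1"
            using n3 n4 n1' that by auto
          have topc: "y2 = y1 \<and> m = a + 1 \<or> y1 < y2 \<and> y2 < q \<and> y2 < u"
          proof (cases "y2 = y1")
            case True
            then show ?thesis using top tipn[OF True] a unfolding top_ok_def by auto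
          qed (use n1' y in auto)
          have botc: "y4 = y3 + 1 \<and> m = a + 1 \<or> y3 + 1 < y4 \<and> q \<le> y3 \<and> u \<le> y3"
          proof (cases "y4 = y3 + 1")
            case True
            then have "y1 + y4 - y3 - 1 = y1" by simp
            then have "a + 1 < m \<longrightarrow> p = m \<and> y1 + y4 - q = y1 \<or> r = m \<and> y1 + y4 - u = y1"
              using bottom unfolding top_ok_def by blast
            then have "\<not> a + 1 < m" using tipn'[OF True] by auto
            then show ?thesis using True a by linarith
          qed (use n3' y in auto)
          \<comment> \<open>An end beyond column \<open>a\<close> would lie in a one-cell arm, that
            is, at a tip, which \<open>tipn\<close> and \<open>tipn'\<close> exclude.\<close>
          have pa: "p \<le> a" "r \<le> a"
          proof -
            have K: "i \<le> a"
              if i: "i \<le> m" "y1 \<le> j" "j \<le> y4" "i \<le> a \<or> j \<le> y2 \<or> y3 < j"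
                and n: "y2 = y1 \<Longrightarrow> \<not> (i = m \<and> j = y1)" "y4 = y3 + 1 \<Longrightarrow> \<not> (i = m \<and> j = y4)"
                and c: "y2 = y1 \<and> m = a + 1 \<or> y2 < j" "y4 = y3 + 1 \<and> m = a + 1 \<or> j \<le> y3" for i j
            proof (rule ccontr)
              assume "\<not> i \<le> a"
              then consider "j \<le> y2" | "y3 < j" using i by linarith
              then show False
              proof cases
                case 1
                then have "y2 = y1" "i = m" "j = y1" using c i \<open>\<not> i \<le> a\<close> by linarith+
                then show False using n by blast
              next
                case 2
                then have "y4 = y3 + 1" "i = m" "j = y4" using c i \<open>\<not> i \<le> a\<close> by linarith+
                then show False using n by blast
              qed
            qed
            show "p \<le> a" using K[OF s(2-5) tipn(1) tipn'(1)] topc botc by blast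
            show "r \<le> a" using K[OF t(2-5) tipn(2) tipn'(2)] topc botc by blast
          qed
          have e1: "\<not> ends p q r u (a, y1) (a, y1 + 1)"
          proof (cases "y2 = y1")
            case True
            then show ?thesis using top unfolding top_ok_def by blast
          qed (use topc in \<open>auto simp: ends_def\<close>)
          have e2: "\<not> ends p q r u (1, y1) (2, y1 + 1) \<and> \<not> ends p q r u (1, y1 + 1) (2, y1)" if "a = 2"
          proof (cases "y2 = y1")
            case True
            then show ?thesis using top topc that unfolding top_ok_def by auto
          qed (use topc in \<open>auto simp: ends_def\<close>)
          have e3: "\<not> ends p q r u (a, y4) (a, y4 - 1)"
          proof (cases "y4 = y3 + 1")
            case True
            then show ?thesis using bottom unfolding top_ok_def ends_flip by (simp add: algebra_simps)
          qed (use botc in \<open>auto simp: ends_def\<close>)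
          have e4: "\<not> ends p q r u (1, y4) (2, y4 - 1) \<and> \<not> ends p q r u (1, y4 - 1) (2, y4)" if "a = 2"
          proof (cases "y4 = y3 + 1")
            case True
            then show ?thesis using bottom botc that unfolding top_ok_def ends_flip by (simp add: algebra_simps)
          qed (use botc in \<open>auto simp: ends_def\<close>)
          have two: "q = y1 \<or> q = y4" if "a = 2" "q = u"
          proof -
            have "\<not> (y2 < q \<and> q \<le> y3)" using g that unfolding cgood_def by blast
            then show ?thesis using topc botc s by linarith
          qed
          show ?thesis
          proof (cases "y1 + 3 \<le> y4")
            case True
            show ?thesis
              by (rule hp_inner[OF a y True]) (use s t pa ne two topc botc e1 e2 e3 e4 in auto)
          next
            case False
            then have e: "y2 = y1" "y3 = y1 + 1" "y4 = y1 + 2" using y by auto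
            have m: "m = a + 1" using topc e by auto
            have mid: "\<not> ends p q r u (a, y1) (a, y4)"
              "a = 2 \<longrightarrow> \<not> ends p q r u (1, y1) (2, y4) \<and> \<not> ends p q r u (1, y4) (2, y1)"
              "2 < a \<longrightarrow> \<not> (r = a \<and> u = y1 + 1 \<and> p < a) \<and> \<not> (p = a \<and> q = y1 + 1 \<and> r < a)"
              using g e m unfolding cgood_def by simp_all
            have r3: "q = y1 \<or> q = y1 + 1 \<or> q = y4" "u = y1 \<or> u = y1 + 1 \<or> u = y4" using s t e by auto
            have y41: "y4 - 1 = y1 + 1" using e by simp
            note e34 = e3[unfolded y41] e4[unfolded y41]
            \<comment> \<open>An end at the centre \<open>(a, y1 + 1)\<close> has no admissible
              partner: column \<open>a\<close> is excluded by \<open>e1\<close> and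
              \<open>e3\<close>, the columns before it by the diagonal pairs and the cut row for
              \<open>a = 2\<close>, and by the three-row clause for \<open>a > 2\<close>.\<close>
            have am: "(p, q) \<noteq> (a, y1 + 1)" "(r, u) \<noteq> (a, y1 + 1)"
            proof -
              {
                fix i j i' j'
                assume i: "i = a" "j = y1 + 1" "1 \<le> i'" "i' \<le> a" "j' = y1 \<or> j' = y1 + 1 \<or> j' = y4"
                  and ij: "(i, j) \<noteq> (i', j')" "2 < a \<longrightarrow> \<not> i' < a"
                  and n: "\<not> ends i j i' j' (a, y1) (a, y1 + 1)" "\<not> ends i j i' j' (a, y4) (a, y1 + 1)"
                    "a = 2 \<Longrightarrow> \<not> ends i j i' j' (1, y1) (2, y1 + 1)" "a = 2 \<Longrightarrow> \<not> ends i j i' j' (1, y4) (2, y1 + 1)"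
                    "a = 2 \<Longrightarrow> j' \<noteq> y1 + 1"
                have "i' = a \<or> a = 2 \<and> i' = 1" using i ij a by linarith
                then have False
                proof
                  assume "i' = a"
                  then show False using i ij n by (auto simp: ends_def)
                next
                  assume "a = 2 \<and> i' = 1"
                  then show False using i n by (auto simp: ends_def)
                qed
              }
              note K = this
              have nn: "u \<noteq> y1 + 1" if "a = 2" "q = y1 + 1" using two[OF that(1)] that e by auto
              have nn': "q \<noteq> y1 + 1" if "a = 2" "u = y1 + 1" using two[OF that(1)] that e by auto
              show "(p, q) \<noteq> (a, y1 + 1)"
              proof
                assume *: "(p, q) = (a, y1 + 1)"
                show False
                  by (rule K[of p q r u]) (use * t(1) pa r3 ne mid(3) e1 e34 e2 nn in auto)
              qed
              show "(r, u) \<noteq> (a, y1 + 1)"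
              proof
                assume *: "(r, u) = (a, y1 + 1)"
                show False
                  by (rule K[of r u p q], unfold ends_sym[of r u p q]) (use * s(1) pa r3 ne mid(3) e1 e34 e2 nn' in auto)
              qed
            qed
            have "hp (cshape a (a + 1) y1 y1 (y1 + 1) (y1 + 2)) (p, q) (r, u)"
              by (rule hp_three_rows) (use a s t pa ne am mid e2 e34 e in auto)
            then show ?thesis using e m by simp
          qed
        qed
      qed
    qed
  qed
qed

text \<open>The narrow column can be reached from columns 1 and 2 only, and one of these avoids the
  end. A one-row part must be run from end to end, which \<open>top\<close> and
  \<open>bottom\<close> ensure.\<close>

lemma hp_one_column:
  assumes m: "2 \<le> m" and y: "y1 \<le> y2" "y2 < y3" "y3 < y4"
    and s: "1 \<le> p" "p \<le> m" "y1 \<le> q" "q \<le> y2" and t: "1 \<le> r" "r \<le> m" "y3 < u" "u \<le> y4"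
    and top: "y2 = y1 \<Longrightarrow> p = m \<or> m = 2" and bottom: "y4 = y3 + 1 \<Longrightarrow> r = m \<or> m = 2"
  shows "hp (cshape 1 m y1 y2 y3 y4) (p, q) (r, u)"
proof -
  define x where "x = (if p = 1 then 2 else 1 :: int)"
  define x' where "x' = (if r = 1 then 2 else 1 :: int)"
  have x: "x \<noteq> p" "x = 1 \<or> x = 2" "x' \<noteq> r" "x' = 1 \<or> x' = 2" by (auto simp: x_def x'_def)
  have 1: "rhp 1 m y1 y2 p q x y2"
    by (rule rhp_rect) (use m y s top in \<open>auto simp: rgood_def x_def\<close>)
  have 2: "rhp 1 1 (y2 + 1) y3 1 (y2 + 1) 1 y3"
    by (rule rhp_rect) (use y in \<open>auto simp: rgood_def\<close>)
  have 3: "rhp 1 m (y3 + 1) y4 x' (y3 + 1) r u"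
    by (rule rhp_rect) (use m y t bottom in \<open>auto simp: rgood_def x'_def\<close>)
  show ?thesis
    by (rule hp_append3[OF 1 2 3]) (use x(2,4) y m in auto)
qed

subsection \<open>Necessity\<close>

lemma sg_walk_iff: "sg_walk V ps \<longleftrightarrow> ps \<noteq> [] \<and> set ps \<subseteq> V \<and> successively sg_adj ps"
  by (auto simp: sg_walk_def successively_conv_nth)

lemma path_stays:
  assumes "successively sg_adj ps" and "set ps \<subseteq> W" and "ps \<noteq> []" and "hd ps \<in> P"
    and "\<And>z z'. \<lbrakk>z \<in> P; z \<in> W; z' \<in> W; sg_adj z z'\<rbrakk> \<Longrightarrow> z' \<in> P"
  shows "set ps \<subseteq> P"
  using assms(1-4)
proof (induction ps)
  case (Cons x xs)
  show ?case
  proof (cases xs)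
    case (Cons z zs)
    then have "z \<in> P" using Cons.prems assms(5)[of x z] by auto
    then show ?thesis using Cons.IH Cons.prems Cons by auto
  qed (use Cons.prems in auto)
qed simp

lemma not_sg_connectedI:
  assumes "u \<in> W" "v \<in> W" "u \<in> P" "v \<notin> P"
    and "\<And>z z'. \<lbrakk>z \<in> P; z \<in> W; z' \<in> W; sg_adj z z'\<rbrakk> \<Longrightarrow> z' \<in> P"
  shows "\<not> sg_connected W"
proof
  assume "sg_connected W"
  then obtain ps where ps: "sg_walk W ps" "hd ps = u" "last ps = v"
    using assms(1,2) unfolding sg_connected_def by blast
  then have "set ps \<subseteq> P"
    using path_stays[of ps W P] assms(3,5) unfolding sg_walk_iff by blast
  then show False using ps assms(4) unfolding sg_walk_iff by (metis last_in_set subsetD)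
qed

text \<open>Applied to a Hamiltonian path without one or both of its ends, this shows that their
  removal does not disconnect the graph.\<close>

lemma sg_connected_path: "successively sg_adj ps \<Longrightarrow> sg_connected (set ps)"
proof (induction ps)
  case (Cons x xs)
  let ?R = "\<lambda>W u v. \<exists>ps. sg_walk W ps \<and> hd ps = u \<and> last ps = v"
  have rev: "?R W v u" if "?R W u v" for W u v
  proof -
    from that obtain ps where "sg_walk W ps" "hd ps = u" "last ps = v" by blast
    then have "sg_walk W (rev ps) \<and> hd (rev ps) = v \<and> last (rev ps) = u"
      by (auto simp: sg_walk_iff successively_sg_adj_rev hd_rev last_rev simp del: successively_rev)
    then show ?thesis by blast
  qed
  have xx: "?R (set (x # xs)) x x" by (rule exI[of _ "[x]"]) (auto simp: sg_walk_iff)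
  have x: "?R (set (x # xs)) x v" if v: "v \<in> set xs" for v
  proof -
    obtain z zs where xs: "xs = z # zs" using v by (cases xs) auto
    then have "sg_connected (set xs)" "sg_adj x z" using Cons by auto
    then obtain ps where ps: "sg_walk (set xs) ps" "hd ps = z" "last ps = v"
      using v xs unfolding sg_connected_def by (meson list.set_intros(1))
    then have "sg_walk (set (x # xs)) (x # ps) \<and> hd (x # ps) = x \<and> last (x # ps) = v"
      using \<open>sg_adj x z\<close> by (auto simp: sg_walk_iff successively_Cons)
    then show ?thesis by blast
  qed
  have in_xs: "?R (set (x # xs)) u v" if uv: "u \<in> set xs" "v \<in> set xs" for u v
  proof -
    have "sg_connected (set xs)" using Cons by (auto simp: successively_Cons)
    then have "?R (set xs) u v" unfolding sg_connected_def using uv by metis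
    then obtain ps where "sg_walk (set xs) ps" "hd ps = u" "last ps = v" by blast
    then show ?thesis by (intro exI[of _ ps]) (auto simp: sg_walk_iff)
  qed
  show ?case
    unfolding sg_connected_def
  proof (intro ballI)
    fix u v assume "u \<in> set (x # xs)" "v \<in> set (x # xs)"
    then show "?R (set (x # xs)) u v" using xx x[of v] rev[OF x[of u]] in_xs[of u v] by auto
  qed
qed (simp add: sg_connected_def)

lemma hp_connected_minus_start:
  assumes "hp V s t"
  shows "sg_connected (V - {s})"
proof -
  from assms obtain ps where ps: "ham_path V s t ps" unfolding hp_def by blast
  then obtain xs where "ps = s # xs" by (cases ps) (auto simp: ham_path_iff)
  then have "set xs = V - {s}" "successively sg_adj xs" using ps by (auto simp: ham_path_iff successively_Cons)
  then show ?thesis using sg_connected_path[of xs] by simp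
qed

lemma hp_connected_minus_both:
  assumes "hp V s t" "s \<noteq> t"
  shows "sg_connected (V - {s, t})"
proof -
  from assms obtain ps where ps: "ham_path V s t ps" unfolding hp_def by blast
  then obtain xs where xs: "ps = s # xs" by (cases ps) (auto simp: ham_path_iff)
  then have "xs \<noteq> []" "last xs = t" using ps assms(2) by (auto simp: ham_path_iff split: if_splits)
  then obtain ys where "xs = ys @ [t]" by (metis append_butlast_last_id)
  then have "set ys = V - {s, t}" "successively sg_adj ys"
    using ps xs by (auto simp: ham_path_iff successively_Cons successively_append_iff)
  then show ?thesis using sg_connected_path[of ys] by simp
qed

lemma ham_path_interior:
  assumes ps: "ham_path V s t ps" and w: "w \<in> V" "w \<noteq> s" "w \<noteq> t"
  obtains as p q bs where "ps = as @ p # w # q # bs" "p \<in> V" "q \<in> V" "p \<noteq> q" "sg_adj w p" "sg_adj w q"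
proof -
  have "w \<in> set ps" using ps w by (auto simp: ham_path_iff)
  then obtain xs ys where xy: "ps = xs @ w # ys" by (auto simp: in_set_conv_decomp)
  have "xs \<noteq> []" "ys \<noteq> []" using ps w by (auto simp: ham_path_iff xy)
  then obtain as p q bs where pq: "ps = as @ p # w # q # bs"
    unfolding xy by (metis append.assoc append_Cons append_Nil append_butlast_last_id list.exhaust)
  have "p \<in> V" "q \<in> V" "p \<noteq> q" "sg_adj w p" "sg_adj w q"
    using ps by (auto simp: ham_path_iff pq successively_append_iff successively_Cons sg_adj_sym)
  then show thesis using that pq by blast
qed

text \<open>An inner vertex of the path uses two neighbours, here \<open>p\<close> and
  \<open>t\<close>; as \<open>t\<close> ends the path, the vertex comes right before it.\<close>

lemma ham_path_last_two:
  assumes ps: "ham_path V s t ps" and w: "w \<in> V" "w \<noteq> s" "w \<noteq> t"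
    and nb: "\<And>z. z \<in> V \<Longrightarrow> sg_adj w z \<Longrightarrow> z = p \<or> z = t"
  obtains as where "ps = as @ [p, w, t]"
proof -
  obtain as p' q' bs where d: "ps = as @ p' # w # q' # bs" "p' \<in> V" "q' \<in> V" "p' \<noteq> q'" "sg_adj w p'" "sg_adj w q'"
    using ham_path_interior[OF ps w] by metis
  have dis: "distinct ps" "last ps = t" using ps by (auto simp: ham_path_iff)
  have "t \<in> set (q' # bs)" using dis(2) d(1) by (auto split: if_splits)
  then have "p' \<noteq> t" using dis(1) d(1) by auto
  then have "p' = p" "q' = t" using nb d by blast+
  moreover have "bs = []"
  proof (rule ccontr)
    assume "bs \<noteq> []"
    then have "t \<in> set bs" using dis(2) d(1) by (auto split: if_splits)
    then show False using dis(1) d(1) \<open>q' = t\<close> by simp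
  qed
  ultimately show thesis using that d(1) by simp
qed

section \<open>Forced vertices beside the short arms\<close>

lemma successively_ends:
  "successively P (as @ x # xs @ y # ys) \<Longrightarrow> xs \<noteq> [] \<Longrightarrow> P x (hd xs) \<and> P (last xs) y"
  by (auto simp: successively_append_iff successively_Cons)

text \<open>All neighbours of \<open>(1, 1)\<close> and of \<open>(2, 1)\<close> except
  \<open>(1, 2)\<close> are used elsewhere or missing, so the segment both starts and stops at
  \<open>(1, 2)\<close>; being repetition-free, it has no other vertex.\<close>

lemma between_corner_vertices:
  assumes ps: "successively sg_adj ((1, 1) # xs @ (2, 1) # ys)" "distinct ((1, 1) # xs @ (2, 1) # ys)"
    and pos: "\<And>i j. (i, j) \<in> set xs \<Longrightarrow> 1 \<le> i \<and> 1 \<le> j" and "(3, 2) \<notin> set xs"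
    and ys: "(2, 2) \<in> set ys" "(3, 1) \<in> set ys" and "xs \<noteq> []"
  shows "xs = [(1, 2)]"
proof -
  obtain i j where h: "hd xs = (i, j)" by (cases "hd xs")
  obtain i' j' where l: "last xs = (i', j')" by (cases "last xs")
  have m: "(i, j) \<in> set xs" "(i', j') \<in> set xs" using h l \<open>xs \<noteq> []\<close> by (metis list.set_sel(1), metis last_in_set)
  have n: "(1, 1) \<notin> set xs" "(2, 1) \<notin> set xs" "(2, 2) \<notin> set xs" "(3, 1) \<notin> set xs" "distinct xs"
    using ps(2) ys by auto
  have "sg_adj (1, 1) (hd xs)" "sg_adj (last xs) (2, 1)"
    using successively_ends[of sg_adj "[]" "(1, 1)" xs] ps(1) \<open>xs \<noteq> []\<close> by simp_all
  then have "(i = 1 \<or> i = 2) \<and> (j = 1 \<or> j = 2)" "(i' = 1 \<or> i' = 2 \<or> i' = 3) \<and> (j' = 1 \<or> j' = 2)"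
    using pos[OF m(1)] pos[OF m(2)] h l by auto
  then have "hd xs = (1, 2)" "last xs = (1, 2)" using h l m n assms(4) by blast+
  moreover obtain z zs where "xs = z # zs" using \<open>xs \<noteq> []\<close> by (cases xs) auto
  moreover have "zs = [] \<or> last zs \<in> set zs" using last_in_set by blast
  ultimately show ?thesis using n(5) by (auto split: if_splits)
qed

text \<open>The tip \<open>(3, 1)\<close> forces the path to finish with
  \<open>(2, 1), (3, 1), (2, 2)\<close>. Only \<open>(1, 2)\<close> fits between
  \<open>(1, 1)\<close> and \<open>(2, 1)\<close>, so \<open>(1, 3)\<close> is missed.\<close>

lemma no_hp_short_corner_diagonal:
  assumes y: "1 < y3" "y3 < n"
  shows "\<not> hp (cshape 2 3 1 1 y3 n) (1, 1) (2, 2)"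
proof
  let ?V = "cshape 2 3 1 1 y3 n"
  assume "hp ?V (1, 1) (2, 2)"
  then obtain ps where ps: "ham_path ?V (1, 1) (2, 2) ps" unfolding hp_def by blast
  obtain as where as: "ps = as @ [(2, 1), (3, 1), (2, 2)]"
    by (rule ham_path_last_two[OF ps, of "(3, 1)" "(2, 1)"]) (use y in auto)
  have D: "distinct ps" "successively sg_adj ps" "set ps = ?V" "hd ps = (1, 1)"
    using ps by (auto simp: ham_path_iff)
  then obtain as' where as': "as = (1, 1) # as'" unfolding as by (cases as) auto
  have in_V: "(1, 2) \<in> set ps" "(1, 3) \<in> set ps" using y by (auto simp: D(3))
  then have "as' \<noteq> []" by (auto simp: as as')
  have "as' = [(1, 2)]"
  proof (rule between_corner_vertices)
    show "successively sg_adj ((1, 1) # as' @ (2, 1) # [(3, 1), (2, 2)])"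
      "distinct ((1, 1) # as' @ (2, 1) # [(3, 1), (2, 2)])"
      using D(1,2) by (simp_all add: as as')
    have V: "z \<in> ?V" if "z \<in> set as'" for z using that D(3) by (auto simp: as as')
    show "1 \<le> i \<and> 1 \<le> j" if "(i, j) \<in> set as'" for i j using V[OF that] by simp
    show "(3, 2) \<notin> set as'" using V[of "(3, 2)"] y by auto
  qed (use \<open>as' \<noteq> []\<close> in auto)
  then show False using in_V by (auto simp: as as')
qed

text \<open>The path finishes with \<open>(2, 2), (3, 1), (2, 1)\<close>. The three neighbours of
  \<open>(1, 1)\<close> are both ends and \<open>(2, 2)\<close>, so \<open>(1, 1)\<close> comes
  directly between \<open>(1, 2)\<close> and \<open>(2, 2)\<close>, and \<open>(1, 3)\<close> is
  missed.\<close>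

lemma no_hp_short_corner_antidiagonal:
  assumes y: "1 < y3" "y3 < n"
  shows "\<not> hp (cshape 2 3 1 1 y3 n) (1, 2) (2, 1)"
proof
  let ?V = "cshape 2 3 1 1 y3 n"
  assume "hp ?V (1, 2) (2, 1)"
  then obtain ps where ps: "ham_path ?V (1, 2) (2, 1) ps" unfolding hp_def by blast
  obtain as where as: "ps = as @ [(2, 2), (3, 1), (2, 1)]"
    by (rule ham_path_last_two[OF ps, of "(3, 1)" "(2, 2)"]) (use y in auto)
  have D: "distinct ps" "successively sg_adj ps" "set ps = ?V" "hd ps = (1, 2)"
    using ps by (auto simp: ham_path_iff)
  then obtain as' where as': "as = (1, 2) # as'" unfolding as by (cases as) auto
  have in_V: "(1, 1) \<in> set ps" "(1, 3) \<in> set ps" using y by (auto simp: D(3))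
  then obtain cs ds where cd: "as' = cs @ (1, 1) # ds" by (auto simp: as as' in_set_conv_decomp)
  have nb: "z = (1, 2) \<or> z = (2, 1) \<or> z = (2, 2)" if "sg_adj (1, 1) z" "z \<in> ?V" for z
    using that by (cases z) auto
  have "cs = []"
  proof (rule ccontr)
    assume "cs \<noteq> []"
    then have "sg_adj (last cs) (1, 1)" "last cs \<in> set cs"
      using successively_ends[of sg_adj "[]" "(1, 2)" cs "(1, 1)"] D(2) by (simp_all add: as as' cd)
    moreover from this have "last cs \<in> ?V" unfolding D(3)[symmetric] by (simp add: as as' cd)
    moreover have "(1, 2) \<notin> set cs" "(2, 1) \<notin> set cs" "(2, 2) \<notin> set cs" using D(1) by (auto simp: as as' cd)
    ultimately show False using nb[of "last cs"] unfolding sg_adj_sym[of "last cs"] by metis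
  qed
  moreover have "ds = []"
  proof (rule ccontr)
    assume "ds \<noteq> []"
    then have "sg_adj (1, 1) (hd ds)" "hd ds \<in> set ds"
      using successively_ends[of sg_adj "(1, 2) # cs" "(1, 1)" ds] D(2) by (simp_all add: as as' cd)
    moreover from this have "hd ds \<in> ?V" unfolding D(3)[symmetric] by (simp add: as as' cd)
    moreover have "(1, 2) \<notin> set ds" "(2, 1) \<notin> set ds" "(2, 2) \<notin> set ds" using D(1) by (auto simp: as as' cd)
    ultimately show False using nb[of "hd ds"] by metis
  qed
  ultimately show False using in_V by (auto simp: as as' cd)
qed

lemma three_rows_tip_neighbours:
  assumes "2 \<le> a" "z \<in> cshape a (a + 1) 1 1 2 3"
  shows "sg_adj (a + 1, 1) z \<Longrightarrow> z = (a, 1) \<or> z = (a, 2)" "sg_adj (a + 1, 3) z \<Longrightarrow> z = (a, 3) \<or> z = (a, 2)"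
  using assms by (cases z; auto)+

text \<open>Both tips have \<open>(a, 2)\<close> as one of two neighbours, so both would have to be
  the last vertex but one.\<close>

lemma no_hp_three_rows_centre:
  assumes a: "2 \<le> a" and s: "fst s < a"
  shows "\<not> hp (cshape a (a + 1) 1 1 2 3) s (a, 2)"
proof
  let ?V = "cshape a (a + 1) 1 1 2 3"
  assume "hp ?V s (a, 2)"
  then obtain ps where ps: "ham_path ?V s (a, 2) ps" unfolding hp_def by blast
  obtain as where as: "ps = as @ [(a, 1), (a + 1, 1), (a, 2)]"
    by (rule ham_path_last_two[OF ps, of "(a + 1, 1)" "(a, 1)"])
       (use a s three_rows_tip_neighbours[OF a] in auto)
  obtain bs where bs: "ps = bs @ [(a, 3), (a + 1, 3), (a, 2)]"
    by (rule ham_path_last_two[OF ps, of "(a + 1, 3)" "(a, 3)"])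
       (use a s three_rows_tip_neighbours[OF a] in auto)
  from as bs show False by simp
qed

text \<open>The upper tip forces \<open>(a, 2)\<close> to be the third vertex, the lower tip forces
  it to be the third from the end. The path then has only five vertices and misses
  \<open>(1, 1)\<close>.\<close>

lemma no_hp_three_rows_vertical:
  assumes a: "2 \<le> a"
  shows "\<not> hp (cshape a (a + 1) 1 1 2 3) (a, 1) (a, 3)"
proof
  let ?V = "cshape a (a + 1) 1 1 2 3"
  assume "hp ?V (a, 1) (a, 3)"
  then obtain ps where ps: "ham_path ?V (a, 1) (a, 3) ps" unfolding hp_def by blast
  obtain as where as: "ps = as @ [(a, 2), (a + 1, 3), (a, 3)]"
    by (rule ham_path_last_two[OF ps, of "(a + 1, 3)" "(a, 2)"])
       (use a three_rows_tip_neighbours[OF a] in auto)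
  obtain bs where bs: "rev ps = bs @ [(a, 2), (a + 1, 1), (a, 1)]"
    by (rule ham_path_last_two[OF ham_path_rev[OF ps], of "(a + 1, 1)" "(a, 2)"])
       (use a three_rows_tip_neighbours[OF a] in auto)
  from bs have ps': "ps = [(a, 1), (a + 1, 1)] @ (a, 2) # rev bs" by (simp add: rev_swap)
  have "distinct ps" "(1, 1) \<in> set ps" using ps a by (auto simp: ham_path_iff)
  moreover from this have "as = [(a, 1), (a + 1, 1)]"
    using as ps' append_Cons_eq_iff[of "(a, 2)" as "[(a + 1, 3), (a, 3)]" "[(a, 1), (a + 1, 1)]" "rev bs"] by auto
  ultimately show False using as a by auto
qed

text \<open>The lower tip comes directly after \<open>(2, 2)\<close>, so the upper tip comes
  directly before it, preceded by \<open>(2, 1)\<close>. This leaves only \<open>(1, 2)\<close>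
  between \<open>(1, 1)\<close> and \<open>(2, 1)\<close>, and \<open>(1, 3)\<close> is
  missed.\<close>

lemma no_hp_three_rows_diagonal: "\<not> hp (cshape 2 3 1 1 2 3) (1, 1) (2, 3)"
proof
  let ?V = "cshape 2 3 1 1 2 3"
  assume "hp ?V (1, 1) (2, 3)"
  then obtain ps where ps: "ham_path ?V (1, 1) (2, 3) ps" unfolding hp_def by blast
  have nb: "sg_adj (3, 1) z \<Longrightarrow> z = (2, 1) \<or> z = (2, 2)" "sg_adj (3, 3) z \<Longrightarrow> z = (2, 3) \<or> z = (2, 2)"
    if "z \<in> ?V" for z
    using three_rows_tip_neighbours[of 2 z] that by simp_all
  obtain as where as: "ps = as @ [(2, 2), (3, 3), (2, 3)]"
    by (rule ham_path_last_two[OF ps, of "(3, 3)" "(2, 2)"]) (use nb in auto)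
  have "(3, 1) \<in> ?V" "(3, 1) \<noteq> (1 :: int, 1 :: int)" "(3, 1) \<noteq> (2 :: int, 3 :: int)" by auto
  from ham_path_interior[OF ps this]
  obtain cs p q ds where c: "ps = cs @ p # (3, 1) # q # ds" "p \<in> ?V" "q \<in> ?V" "p \<noteq> q"
    "sg_adj (3, 1) p" "sg_adj (3, 1) q" .
  have D: "distinct ps" "successively sg_adj ps" "set ps = ?V" "hd ps = (1, 1)"
    using ps by (auto simp: ham_path_iff)
  have "p \<noteq> (2, 2)"
  proof
    assume "p = (2, 2)"
    then show False
      using D(1) as c(1) append_Cons_eq_iff[of "(2, 2)" as "[(3, 3), (2, 3)]" cs "(3, 1) # q # ds"] by auto
  qed
  then have pq: "p = (2, 1)" "q = (2, 2)" using nb(1)[of p] nb(1)[of q] c by auto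
  have "as = cs @ [(2, 1), (3, 1)] \<and> ds = [(3, 3), (2, 3)]"
    using D(1) as c(1) append_Cons_eq_iff[of "(2, 2)" as "[(3, 3), (2, 3)]" "cs @ [(2, 1), (3, 1)]" ds]
    unfolding pq by auto
  then have ps2: "ps = cs @ [(2, 1), (3, 1), (2, 2), (3, 3), (2, 3)]" using as by simp
  obtain as' where as': "cs = (1, 1) # as'" using D(4) unfolding ps2 by (cases cs) auto
  have in_V: "(1, 2) \<in> set ps" "(1, 3) \<in> set ps" by (auto simp: D(3))
  then have "as' \<noteq> []" by (auto simp: ps2 as')
  have "as' = [(1, 2)]"
  proof (rule between_corner_vertices)
    show "successively sg_adj ((1, 1) # as' @ (2, 1) # [(3, 1), (2, 2), (3, 3), (2, 3)])"
      "distinct ((1, 1) # as' @ (2, 1) # [(3, 1), (2, 2), (3, 3), (2, 3)])"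
      using D(1,2) by (simp_all add: ps2 as')
    have V: "z \<in> ?V" if "z \<in> set as'" for z using that D(3) by (auto simp: ps2 as')
    show "1 \<le> i \<and> 1 \<le> j" if "(i, j) \<in> set as'" for i j using V[OF that] by simp
    show "(3, 2) \<notin> set as'" using V[of "(3, 2)"] by auto
  qed (use \<open>as' \<noteq> []\<close> in auto)
  then show False using in_V by (auto simp: ps2 as')
qed

text \<open>\<open>?w\<close> is the uppermost cell of the narrow rows. The part of the path before
  it and the reversed part after it both start in the upper rows and avoid \<open>?w\<close>, so
  neither leaves them.\<close>

lemma no_hp_one_column_top:
  assumes y: "y1 \<le> y2" "y2 < y3" "y3 < y4" and q: "q \<le> y2" "u \<le> y2"
  shows "\<not> hp (cshape 1 m y1 y2 y3 y4) (p, q) (r, u)"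
proof
  let ?V = "cshape 1 m y1 y2 y3 y4" and ?w = "(1 :: int, y2 + 1)" and ?P = "{z :: vtx. snd z \<le> y2}"
  assume h: "hp ?V (p, q) (r, u)"
  then obtain ps where ps: "ham_path ?V (p, q) (r, u) ps" unfolding hp_def by blast
  have m: "1 \<le> m" using hp_endpoints[OF h] by auto
  have closed: "z' \<in> ?P" if "z \<in> ?P" "z' \<in> ?V - {?w}" "sg_adj z z'" for z z'
    using that y by (cases z; cases z') auto
  have half: "set xs \<subseteq> ?P" if "successively sg_adj (xs @ [?w])" "set xs \<subseteq> ?V" "?w \<notin> set xs" "xs \<noteq> []" "hd xs \<in> ?P" for xs
    by (rule path_stays[of xs "?V - {?w}"]) (use that closed in \<open>auto simp: successively_append_iff\<close>)
  have "?w \<in> ?V" using y m by simp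
  then have "?w \<in> set ps" using ps by (simp only: ham_path_iff)
  then obtain xs ys where xy: "ps = xs @ ?w # ys" by (auto simp: in_set_conv_decomp)
  have D: "distinct ps" "successively sg_adj ps" "set ps = ?V" "hd ps = (p, q)" "last ps = (r, u)"
    using ps by (auto simp: ham_path_iff)
  have ne: "xs \<noteq> []" "ys \<noteq> []" using D(4,5) q by (auto simp: xy)
  have 1: "set xs \<subseteq> ?P"
    by (rule half) (use D ne q in \<open>auto simp: xy successively_append_iff\<close>)
  have "successively sg_adj (rev ys @ [?w])"
    using D(2) successively_sg_adj_rev[of "?w # ys"] by (auto simp: xy successively_append_iff simp del: successively_rev)
  then have 2: "set (rev ys) \<subseteq> ?P"
    by (rule half) (use D ne q in \<open>auto simp: xy hd_rev\<close>)
  have "(1, y4) \<in> set ps" using y m by (auto simp: D(3))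
  then show False using 1 2 y by (auto simp: xy)
qed

lemma C_graph_eq_cshape: "C_graph m n k l c = cshape (m - k) m 1 c (c + l) n"
  by (auto simp: C_graph_def)

section \<open>Reflection of connectivity and degree, and explicit cuts\<close>

lemma flipy_flipy [simp]: "flipy k (flipy k z) = z"
  by (cases z) simp

lemma sg_adj_flipy [simp]: "sg_adj (flipy k u) (flipy k v) \<longleftrightarrow> sg_adj u v"
  by (cases u; cases v) auto

lemma mem_flipy_image: "z \<in> flipy k ` A \<longleftrightarrow> flipy k z \<in> A"
  by (metis flipy_flipy imageE imageI)

lemma sg_connected_flipy:
  assumes "sg_connected W"
  shows "sg_connected {z. flipy k z \<in> W}"
  unfolding sg_connected_def
proof (intro ballI)
  fix u v assume "u \<in> {z. flipy k z \<in> W}" "v \<in> {z. flipy k z \<in> W}"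
  then obtain ps where ps: "sg_walk W ps" "hd ps = flipy k u" "last ps = flipy k v"
    using assms unfolding sg_connected_def by blast
  have "sg_walk {z. flipy k z \<in> W} (map (flipy k) ps)" "hd (map (flipy k) ps) = u" "last (map (flipy k) ps) = v"
    using ps by (auto simp: sg_walk_iff successively_map hd_map last_map)
  then show "\<exists>ps. sg_walk {z. flipy k z \<in> W} ps \<and> hd ps = u \<and> last ps = v" by blast
qed

lemma sg_deg_flipy: "sg_deg {z. flipy k z \<in> V} w = sg_deg V (flipy k w)"
proof -
  have "sg_adj (flipy k w) (flipy k u) \<longleftrightarrow> sg_adj w u" for u by simp
  then have "{u \<in> {z. flipy k z \<in> V}. sg_adj w u} = flipy k ` {u \<in> V. sg_adj (flipy k w) u}"
    unfolding set_eq_iff mem_flipy_image by simp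
  moreover have "inj_on (flipy k) A" for A by (rule inj_on_inverseI[of _ "flipy k"]) simp
  ultimately show ?thesis unfolding sg_deg_def by (simp add: card_image)
qed

text \<open>Adjacent vertices differ by at most one in their rows, so no path from above row
  \<open>q\<close> can get past it.\<close>

lemma cut_row:
  assumes y: "y1 \<le> y2" "y2 < y3" "y3 < y4" and a: "1 \<le> a" "a \<le> m" and q: "y2 < q" "q \<le> y3"
    and W: "\<And>i. 1 \<le> i \<Longrightarrow> i \<le> a \<Longrightarrow> (i, q) \<in> X" and X: "(1, y1) \<notin> X" "(1, y4) \<notin> X"
  shows "\<not> sg_connected (cshape a m y1 y2 y3 y4 - X)"
proof (rule not_sg_connectedI[of "(1, y1)" _ "(1, y4)" "{z. snd z < q}"])
  fix z z' assume *: "z \<in> {z. snd z < q}" "z' \<in> cshape a m y1 y2 y3 y4 - X" "sg_adj z z'"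
  obtain i j i' j' where ij: "z = (i, j)" "z' = (i', j')" by (cases z; cases z')
  have "j' \<noteq> q"
  proof
    assume "j' = q"
    then have "(i', j') \<in> X" using * ij q by (intro W[of i', folded \<open>j' = q\<close>]) auto
    then show False using * ij by blast
  qed
  then show "z' \<in> {z. snd z < q}" using * ij by auto
qed (use y a q X in auto)

lemma top_okI:
  assumes a: "1 \<le> a" "a < m" and y: "y1 \<le> y2" "y2 < y3" "y3 < y4"
    and V: "V = cshape a m y1 y2 y3 y4" and s: "(p, q) \<in> V" and t: "(r, u) \<in> V" and ne: "(p, q) \<noteq> (r, u)"
    and cs: "sg_connected (V - {(p, q)})" and ct: "sg_connected (V - {(r, u)})"
    and cb: "sg_connected (V - {(p, q), (r, u)})"
    and deg: "\<And>w. w \<in> V \<Longrightarrow> sg_deg V w = 1 \<Longrightarrow> w = (p, q) \<or> w = (r, u)"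
    and F7: "y2 = y1 \<and> a = 2 \<and> m = 3 \<longrightarrow> \<not> ends p q r u (1, y1) (2, y1 + 1) \<and> \<not> ends p q r u (1, y1 + 1) (2, y1)"
    and a2: "2 \<le> a \<or> (\<not> ends p q r u (a, y1) (a, y1 + 1))"
  shows "top_ok a m y1 y2 p q r u"
proof -
  \<comment> \<open>Deleting column \<open>x\<close> of the arm cuts off its outer part. For
    \<open>x = a\<close> the cell below the arm must go as well, as \<open>(a, y2 + 1)\<close>
    touches \<open>(a + 1, y2)\<close> diagonally.\<close>
  have arm: "\<not> sg_connected (V - X)"
    if x: "a \<le> x" "x < m" and X: "\<And>j. y1 \<le> j \<Longrightarrow> j \<le> y2 + (if x = a then 1 else 0) \<Longrightarrow> (x, j) \<in> X"
      and XX: "(m, y1) \<notin> X" "(1, y4) \<notin> X" for x X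
  proof (rule not_sg_connectedI[of "(m, y1)" _ "(1, y4)" "{z. x < fst z \<and> snd z \<le> y2}"])
    fix z z' assume *: "z \<in> {z. x < fst z \<and> snd z \<le> y2}" "z \<in> V - X" "z' \<in> V - X" "sg_adj z z'"
    obtain i j i' j' where ij: "z = (i, j)" "z' = (i', j')" by (cases z; cases z')
    have b: "x < i" "j \<le> y2" "x \<le> i'" "j' \<le> y2 + 1" "y1 \<le> j'" "i' \<le> a \<or> j' \<le> y2 \<or> y3 < j'"
      using * ij by (auto simp: V)
    have j': "j' \<le> y2 + (if x = a then 1 else 0) \<or> x < i' \<and> False"
      using b x y by auto
    have "i' \<noteq> x"
    proof
      assume "i' = x"
      then have "(i', j') \<in> X" using X[of j'] b j' by auto
      then show False using * ij by blast
    qed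
    then show "z' \<in> {z. x < fst z \<and> snd z \<le> y2}" using b x y ij by auto
  qed (use a y x XX in \<open>auto simp: V\<close>)
  have edge: False if "ends p q r u v w" "\<not> sg_connected (V - {v, w})" for v w
    using that cb by (auto simp: ends_def insert_commute)
  show ?thesis
    unfolding top_ok_def
  proof (intro conjI impI)
    assume e: "y2 = y1"
    show "\<not> (q = y1 \<and> a < p \<and> p < m)"
      using arm[of p "{(p, q)}"] cs e y by auto
    show "\<not> (u = y1 \<and> a < r \<and> r < m)"
      using arm[of r "{(r, u)}"] ct e y by auto
    show "\<not> ends p q r u (a, y1) (a, y1 + 1)"
    proof (cases "2 \<le> a")
      case True
      have "\<not> sg_connected (V - {(a, y1), (a, y1 + 1)})"
        by (rule arm[of a]) (use a True e y in auto)
      then show ?thesis using edge by blast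
    qed (use a2 in blast)
    show "\<not> ends p q r u (1, y1) (2, y1 + 1)" "\<not> ends p q r u (1, y1 + 1) (2, y1)" if "a = 2 \<and> m = 3"
      using F7 e that by blast+
    show "p = m \<and> q = y1 \<or> r = m \<and> u = y1" if "a + 1 < m"
    proof -
      have "{v \<in> V. sg_adj (m, y1) v} = {(m - 1, y1)}"
      proof (rule set_eqI)
        fix v :: vtx
        obtain i j where v: "v = (i, j)" by (cases v)
        show "v \<in> {v \<in> V. sg_adj (m, y1) v} \<longleftrightarrow> v \<in> {(m - 1, y1)}"
          using that a y e unfolding v V by auto
      qed
      then have "sg_deg V (m, y1) = 1" by (simp add: sg_deg_def)
      moreover have "(m, y1) \<in> V" using a y by (simp add: V)
      ultimately show ?thesis using deg by blast
    qed
  next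
    assume e: "y2 = y1 + 1 \<and> p = r \<and> a < p \<and> p < m"
    show "y2 < q \<or> y2 < u"
    proof (rule ccontr)
      assume "\<not> (y2 < q \<or> y2 < u)"
      then have "q = y1 \<and> u = y2 \<or> q = y2 \<and> u = y1" using e s t ne by (auto simp: V)
      then have "\<not> sg_connected (V - {(p, q), (r, u)})"
        using e y a by (intro arm[of p]) auto
      then show False using cb by blast
    qed
  qed
qed

lemma doubleton_ends: "{(p, q), (r, u)} = {v, w} \<longleftrightarrow> ends p q r u v w"
  unfolding ends_def doubleton_eq_iff by auto

lemma hp_excludes_short_arm:
  assumes h: "hp (cshape 2 3 1 1 y3 n) (p, q) (r, u)" and y: "1 < y3" "y3 < n"
  shows "\<not> ends p q r u (1, 1) (2, 2) \<and> \<not> ends p q r u (1, 2) (2, 1)"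
  using no_hp_short_corner_diagonal[OF y] no_hp_short_corner_antidiagonal[OF y] h hp_sym[OF h]
  unfolding ends_def by auto

lemma hp_excludes_three_rows:
  assumes h: "hp (cshape a (a + 1) 1 1 2 3) (p, q) (r, u)" and a: "2 \<le> a" 
    and m: "1 \<le> q" "q \<le> 3" "1 \<le> u" "u \<le> 3"
  shows "\<not> (p = a \<and> r = a \<and> \<bar>q - u\<bar> = 2)"
    and "\<not> (a = 2 \<and> p = 1 \<and> r = 2 \<and> \<bar>q - u\<bar> = 2)"
    and "\<not> (p < a \<and> (r, u) = (a, 2))"
proof -
  have qu: "q = 1 \<and> u = 3 \<or> q = 3 \<and> u = 1" if "\<bar>q - u\<bar> = 2" using that m by linarith
  show "\<not> (p = a \<and> r = a \<and> \<bar>q - u\<bar> = 2)"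
    using qu no_hp_three_rows_vertical[OF a] h hp_sym[OF h] by auto
  show "\<not> (a = 2 \<and> p = 1 \<and> r = 2 \<and> \<bar>q - u\<bar> = 2)"
  proof
    assume *: "a = 2 \<and> p = 1 \<and> r = 2 \<and> \<bar>q - u\<bar> = 2"
    have "hp (cshape 2 3 1 1 2 3) (1, 1) (2, 3)" if "hp (cshape 2 3 1 1 2 3) (1, 3) (2, 1)"
      by (rule hp_cshape_flipy) (use that in simp)
    then show False using * qu no_hp_three_rows_diagonal h by auto
  qed
  show "\<not> (p < a \<and> (r, u) = (a, 2))"
    using no_hp_three_rows_centre[OF a, of "(p, q)"] h by auto
qed

lemma hp_degree_one:
  assumes "hp V s t" and "w \<in> V" "sg_deg V w = 1"
  shows "w = s \<or> w = t"
proof (rule ccontr)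
  assume n: "\<not> (w = s \<or> w = t)"
  obtain ps where ps: "ham_path V s t ps" using assms(1) unfolding hp_def by blast
  obtain as p q bs where pq: "p \<in> V" "q \<in> V" "p \<noteq> q" "sg_adj w p" "sg_adj w q"
    using ham_path_interior[OF ps assms(2)] n by metis
  obtain x where x: "{z \<in> V. sg_adj w z} = {x}"
    using assms(3) unfolding sg_deg_def by (rule card_1_singletonE)
  have "p \<in> {x}" "q \<in> {x}" unfolding x[symmetric] using pq by simp_all
  then show False using pq(3) by simp
qed

lemma hp_excludes_one_column:
  assumes h: "hp (cshape 1 m 1 c y3 n) (p, q) (r, u)" and y: "1 \<le> c" "c < y3" "y3 < n"
  shows "\<not> (q \<le> c \<and> u \<le> c)" "\<not> (y3 < q \<and> y3 < u)"
proof -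
  show "\<not> (q \<le> c \<and> u \<le> c)" using no_hp_one_column_top[OF y] h by blast
  have "hp (cshape 1 m 1 (n - y3) (n - c) n) (p, 1 + n - q) (r, 1 + n - u)"
    by (rule hp_cshape_flipy) (use h in simp)
  then show "\<not> (y3 < q \<and> y3 < u)"
    using no_hp_one_column_top[of 1 "n - y3" "n - c" n "1 + n - q" "1 + n - u" m p r] y by auto
qed

theorem theorem5:
  fixes m n k l c :: int and s t :: vtx
  defines "a \<equiv> m - k" and "d \<equiv> n - l - c" and "V \<equiv> C_graph m n k l c"
  assumes "m \<ge> 2" and "n \<ge> 3" and "k \<ge> 1" and "l \<ge> 1" and "c \<ge> 1"
    and "d \<ge> 1" and "a \<ge> 1"
    and "s \<in> V" and "t \<in> V" and "s \<noteq> t" and "fst s \<le> fst t"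
  shows "(\<exists>ps. ham_path V s t ps) \<longleftrightarrow>
    \<not> ( \<comment> \<open>(F1)\<close>
          (cut_vertex V s \<or> cut_vertex V t \<or> vertex_cut V {s, t})
        \<or> \<comment> \<open>(F3)\<close>
          (\<exists>w\<in>V. sg_deg V w = 1 \<and> w \<noteq> s \<and> w \<noteq> t)
        \<or> \<comment> \<open>(F7)\<close>
          (m = 3 \<and> a = 2 \<and>
            ((c = 1 \<and> ({s, t} = {(1, 1), (2, 2)} \<or> {s, t} = {(1, 2), (2, 1)}))
           \<or> (d = 1 \<and> ({s, t} = {(1, n), (2, n - 1)} \<or> {s, t} = {(1, n - 1), (2, n)}))))
        \<or> \<comment> \<open>(F8)\<close>
          (n = 3 \<and> k = 1 \<and> c = 1 \<and> d = 1 \<and>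
            ((a \<ge> 2 \<and> fst s = m - 1 \<and> fst t = m - 1 \<and> \<bar>snd s - snd t\<bar> = 2)
           \<or> (a = 2 \<and> fst s = 1 \<and> fst t = 2 \<and> \<bar>snd s - snd t\<bar> = 2)
           \<or> (a > 2 \<and> fst s < m - 1 \<and> t = (m - 1, 2))))
        \<or> \<comment> \<open>(F9)\<close>
          (a = 1 \<and> ((snd s \<le> c \<and> snd t \<le> c) \<or> (snd s > c + l \<and> snd t > c + l))))"
    (is "?hp \<longleftrightarrow> \<not> (?F1 \<or> ?F3 \<or> ?F7 \<or> ?F8 \<or> ?F9)")
proof -
  obtain p q r u where st: "s = (p, q)" "t = (r, u)" by (cases s; cases t)
  define y3 where "y3 = c + l"
  have V: "V = cshape a m 1 c y3 n" unfolding V_def a_def y3_def by (rule C_graph_eq_cshape)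
  have a: "1 \<le> a" "a < m" using assms by (auto simp: a_def)
  have y: "1 \<le> c" "c < y3" "y3 < n" using assms by (auto simp: y3_def d_def)
  have s: "(p, q) \<in> V" and t: "(r, u) \<in> V" and ne: "(p, q) \<noteq> (r, u)" and pr: "p \<le> r"
    using assms(11-14) by (simp_all add: st)
  have b: "1 \<le> p" "p \<le> m" "1 \<le> q" "q \<le> n" "1 \<le> r" "r \<le> m" "1 \<le> u" "u \<le> n"
    "p \<le> a \<or> q \<le> c \<or> y3 < q" "r \<le> a \<or> u \<le> c \<or> y3 < u"
    using s t by (simp_all add: V)
  have d1: "d = 1 \<longleftrightarrow> n = y3 + 1" and k1: "k = 1 \<longleftrightarrow> m = a + 1" by (auto simp: d_def a_def y3_def)
  show ?thesis
  proof
    assume ?hp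
    then have h: "hp V (p, q) (r, u)" unfolding hp_def st .
    have F1: "\<not> ?F1"
      using hp_connected_minus_start[OF h] hp_connected_minus_start[OF hp_sym[OF h]] hp_connected_minus_both[OF h ne]
      unfolding cut_vertex_def vertex_cut_def st by blast
    have F3: "\<not> ?F3" using hp_degree_one[OF h] unfolding st by blast
    have F7: "\<not> ?F7"
    proof
      assume F: ?F7
      then have am: "a = 2" "m = 3" by blast+
      have 1: "\<not> ({s, t} = {(1, 1), (2, 2)} \<or> {s, t} = {(1, 2), (2, 1)})" if "c = 1"
        using hp_excludes_short_arm[of y3 n p q r u] h y unfolding V am that st doubleton_ends by blast
      have 2: "\<not> ({s, t} = {(1, n), (2, n - 1)} \<or> {s, t} = {(1, n - 1), (2, n)})" if "d = 1"
      proof -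
        have "hp (cshape 2 3 1 1 (n - c) n) (p, 1 + n - q) (r, 1 + n - u)"
          by (rule hp_cshape_flipy) (use h that d1 in \<open>simp add: V am\<close>)
        from hp_excludes_short_arm[OF this]
        have "\<not> ends p (1 + n - q) r (1 + n - u) (1, 1) (2, 2) \<and> \<not> ends p (1 + n - q) r (1 + n - u) (1, 2) (2, 1)"
          using y by auto
        then show ?thesis unfolding st doubleton_ends ends_flip by (simp add: algebra_simps)
      qed
      show False using F 1 2 by blast
    qed
    have F8: "\<not> ?F8"
    proof
      assume F: ?F8
      then have e: "n = 3" "m = a + 1" "c = 1" "y3 = 2" using d1 k1 by auto
      then have h3: "hp (cshape a (a + 1) 1 1 2 3) (p, q) (r, u)" using h by (simp add: V)
      have a2: "2 \<le> a" using F by auto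
      show False using F hp_excludes_three_rows[OF h3 a2] b e unfolding st by auto
    qed
    have F9: "\<not> ?F9"
      using hp_excludes_one_column[of m c y3 n p q r u] h y unfolding V st y3_def by auto
    show "\<not> (?F1 \<or> ?F3 \<or> ?F7 \<or> ?F8 \<or> ?F9)" using F1 F3 F7 F8 F9 by blast
  next
    assume F: "\<not> (?F1 \<or> ?F3 \<or> ?F7 \<or> ?F8 \<or> ?F9)"
    then have F1: "\<not> ?F1" and F3: "\<not> ?F3" and F7: "\<not> ?F7" and F8: "\<not> ?F8" and F9: "\<not> ?F9"
      by simp_all
    have cs: "sg_connected (V - {(p, q)})" and ct: "sg_connected (V - {(r, u)})"
      and cb: "sg_connected (V - {(p, q), (r, u)})"
      using F1 s t unfolding cut_vertex_def vertex_cut_def st by blast+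
    have deg: "w = (p, q) \<or> w = (r, u)" if "w \<in> V" "sg_deg V w = 1" for w
      using F3 that unfolding st by blast
    have F7t: "c = 1 \<and> a = 2 \<and> m = 3 \<longrightarrow> \<not> ends p q r u (1, 1) (2, 1 + 1) \<and> \<not> ends p q r u (1, 1 + 1) (2, 1)"
      using F7 unfolding st doubleton_ends one_add_one by blast
    have F7b: "d = 1 \<and> a = 2 \<and> m = 3 \<longrightarrow> \<not> ends p q r u (1, n) (2, n - 1) \<and> \<not> ends p q r u (1, n - 1) (2, n)"
      using F7 unfolding st doubleton_ends by blast
    let ?W = "cshape a m 1 (1 + n - y3 - 1) (1 + n - c - 1) n"
    \<comment> \<open>Transfers the connectivity hypotheses to the reflected shape, with
      \<open>Y\<close> the removed ends; an empty \<open>Y\<close> gives the shape itself.\<close>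
    have W: "{z. flipy (1 + n) z \<in> X} = ?W - flipy (1 + n) ` Y" if "X = V - Y" for X Y
    proof (rule set_eqI)
      fix z :: vtx
      obtain i j where z: "z = (i, j)" by (cases z)
      have "(i, j) \<in> flipy (1 + n) ` Y \<longleftrightarrow> (i, 1 + n - j) \<in> Y"
        by (simp add: mem_flipy_image)
      then show "z \<in> {z. flipy (1 + n) z \<in> X} \<longleftrightarrow> z \<in> ?W - flipy (1 + n) ` Y"
        unfolding that z V by auto
    qed
    have top: "top_ok a m 1 c p q r u" if "2 \<le> a \<or> \<not> ends p q r u (a, 1) (a, 1 + 1)"
      by (rule top_okI[OF a y V s t ne cs ct cb deg F7t that])
    have bottom: "top_ok a m 1 (1 + n - y3 - 1) p (1 + n - q) r (1 + n - u)"
      if a2: "2 \<le> a \<or> \<not> ends p (1 + n - q) r (1 + n - u) (a, 1) (a, 1 + 1)"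
    proof (rule top_okI[OF a _ _ _ refl _ _ _ _ _ _ _ _ a2])
      show "sg_connected (?W - {(p, 1 + n - q)})" "sg_connected (?W - {(r, 1 + n - u)})"
        "sg_connected (?W - {(p, 1 + n - q), (r, 1 + n - u)})"
        using sg_connected_flipy[OF cs, of "1 + n"] sg_connected_flipy[OF ct, of "1 + n"]
          sg_connected_flipy[OF cb, of "1 + n"] unfolding W[OF refl] by simp_all
      show "w = (p, 1 + n - q) \<or> w = (r, 1 + n - u)" if w: "w \<in> ?W" "sg_deg ?W w = 1" for w
      proof -
        have "?W = {z. flipy (1 + n) z \<in> V}" using W[of V "{}"] by simp
        then have "flipy (1 + n) w \<in> V" "sg_deg V (flipy (1 + n) w) = 1"
          using w sg_deg_flipy[of "1 + n" V w] by auto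
        from deg[OF this] show ?thesis by (cases w) auto
      qed
      show "1 + n - y3 - 1 = 1 \<and> a = 2 \<and> m = 3 \<longrightarrow>
        \<not> ends p (1 + n - q) r (1 + n - u) (1, 1) (2, 1 + 1) \<and> \<not> ends p (1 + n - q) r (1 + n - u) (1, 1 + 1) (2, 1)"
        using F7b unfolding ends_flip d1 by (auto simp: algebra_simps)
    qed (use b y ne in auto)
    have "hp V (p, q) (r, u)"
    proof (cases "a = 1")
      case False
      then have a2: "2 \<le> a" using a by simp
      \<comment> \<open>In two narrow columns, ends in a common row fill this row and separate the
        two arms.\<close>
      have mid: "\<not> (a = 2 \<and> q = u \<and> c < q \<and> q \<le> y3)"
      proof
        assume *: "a = 2 \<and> q = u \<and> c < q \<and> q \<le> y3"
        then have "p = 1 \<and> r = 2" using b ne pr by auto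
        then have "\<not> sg_connected (cshape a m 1 c y3 n - {(p, q), (r, u)})"
          by (intro cut_row[OF y _ _ _ _, of a m q]) (use * a y b in auto)
        then show False using cb V by simp
      qed
      have n3: "n = 1 + 2 \<and> m = a + 1 \<longrightarrow>
        \<not> ends p q r u (a, 1) (a, n) \<and>
        (a = 2 \<longrightarrow> \<not> ends p q r u (1, 1) (2, n) \<and> \<not> ends p q r u (1, n) (2, 1)) \<and>
        (2 < a \<longrightarrow> \<not> (r = a \<and> u = 1 + 1 \<and> p < a) \<and> \<not> (p = a \<and> q = 1 + 1 \<and> r < a))"
      proof
        assume *: "n = 1 + 2 \<and> m = a + 1"
        then have e: "n = 3" "k = 1" "c = 1" "d = 1" "m - 1 = a" using k1 d1 y by auto
        have G: "\<not> (p = a \<and> r = a \<and> \<bar>q - u\<bar> = 2)" "\<not> (a = 2 \<and> p = 1 \<and> r = 2 \<and> \<bar>q - u\<bar> = 2)"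
          "\<not> (2 < a \<and> p < a \<and> r = a \<and> u = 2)"
          using F8 a2 unfolding st e by auto
        have 1: "\<not> ends p q r u (a, 1) (a, n)" using G(1) by (auto simp: ends_def e(1))
        \<comment> \<open>By \<open>p <= r\<close> only one order of the ends remains, namely the
          one listed in \<open>F8\<close>.\<close>
        have 2: "a = 2 \<longrightarrow> \<not> ends p q r u (1, 1) (2, n) \<and> \<not> ends p q r u (1, n) (2, 1)"
          using G(2) pr by (auto simp: ends_def e(1))
        show "\<not> ends p q r u (a, 1) (a, n) \<and>
          (a = 2 \<longrightarrow> \<not> ends p q r u (1, 1) (2, n) \<and> \<not> ends p q r u (1, n) (2, 1)) \<and>
          (2 < a \<longrightarrow> \<not> (r = a \<and> u = 1 + 1 \<and> p < a) \<and> \<not> (p = a \<and> q = 1 + 1 \<and> r < a))"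
          using 1 2 G(3) pr by auto
      qed
      have "cgood a m 1 c y3 n p q r u"
        unfolding cgood_def
      proof (intro conjI)
        show "(p, q) \<in> cshape a m 1 c y3 n" "(r, u) \<in> cshape a m 1 c y3 n" using s t V by simp_all
      qed (use ne top bottom a2 mid n3 in blast)+
      then show ?thesis unfolding V by (rule hp_cshape[OF _ a2 a(2) y])
    next
      case True
      \<comment> \<open>A vertex in the rows of the hole is a cut vertex here, so both ends lie in
        the wide rows, and by \<open>F9\<close> in different parts.\<close>
      have out: "j \<le> c \<or> y3 < j" if ij: "(i, j) \<in> V" "sg_connected (V - {(i, j)})" for i j
      proof (rule ccontr)
        assume *: "\<not> (j \<le> c \<or> y3 < j)"
        then have "i = 1" using ij(1) True by (auto simp: V)
        then have "\<not> sg_connected (cshape a m 1 c y3 n - {(i, j)})"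
          by (intro cut_row[OF y, of a m j]) (use * a y True in auto)
        then show False using ij(2) V by simp
      qed
      have arms: "q \<le> c \<and> y3 < u \<or> u \<le> c \<and> y3 < q"
        using out[OF s cs] out[OF t ct] F9 True unfolding st y3_def by auto
      have tops: "top_ok a m 1 c p q r u"
        by (rule top) (use arms y in \<open>auto simp: ends_def\<close>)
      have bottoms: "top_ok a m 1 (1 + n - y3 - 1) p (1 + n - q) r (1 + n - u)"
        by (rule bottom) (use arms y in \<open>auto simp: ends_def\<close>)
      have tip: "c = 1 \<Longrightarrow> p = m \<and> q = 1 \<or> r = m \<and> u = 1 \<or> m = 2"
        using tops True a unfolding top_ok_def by auto
      have tip': "n = y3 + 1 \<Longrightarrow> p = m \<and> q = n \<or> r = m \<and> u = n \<or> m = 2"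
      proof -
        assume "n = y3 + 1"
        then have "1 + n - y3 - 1 = 1" by simp
        then have "a + 1 < m \<longrightarrow> p = m \<and> 1 + n - q = 1 \<or> r = m \<and> 1 + n - u = 1"
          using bottoms unfolding top_ok_def by blast
        then show ?thesis using True a by auto
      qed
      from arms show ?thesis
      proof
        assume "q \<le> c \<and> y3 < u"
        then have "hp (cshape 1 m 1 c y3 n) (p, q) (r, u)"
          by (intro hp_one_column) (use a y b tip tip' in auto)
        then show ?thesis using V True by simp
      next
        assume "u \<le> c \<and> y3 < q"
        then have "hp (cshape 1 m 1 c y3 n) (r, u) (p, q)"
          by (intro hp_one_column) (use a y b tip tip' in auto)
        then show ?thesis using V True hp_sym by simp
      qed
    qed
    then show ?hp unfolding hp_def st .
  qed
qed

end
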